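(* Let $(G,G')$ be a pair of real reductive Lie groups whose complexified Lie algebras satisfy $(\mathfrak g_{\mathbb C},\mathfrak g'_{\mathbb C})\simeq(\mathfrak o(4,\mathbb C),\mathfrak o(3,\mathbb C))$. Then there exist rational functions $C_{i,\delta}(\lambda_1,\lambda_2;\nu)$, $i\in\{1,2\}$, $\delta\in\{+,-\}$, depending only on the parameters $\lambda_1,\lambda_2,\nu$, such that the following holds. Let $\Pi_\lambda\in\mathcal M(G)$ be a representation with infinitesimal character $\lambda=(\lambda_1,\lambda_2)$, and let $\pi_\nu\in\mathcal M(G')$ have infinitesimal character $\nu\in\mathbb C$. Assume that $\lambda_1\ne\pm\lambda_2$ and that the primary components of $\Pi_\lambda\otimes\mathbb C^4$ are genuine eigenspaces of $\mathfrak Z(G)=U(\mathfrak g_{\mathbb C})^G$. Let $T\colon\Pi_\lambda\to\pi_\nu$ be a symmetry breaking operator, and fix $i\in\{1,2\}$ and $\delta\in\{+,-\}$. Then for every $u\in\Pi_\lambda$, $$(T\otimes\operatorname{pr}_{F\to F'})\circ\operatorname{pr}_{\lambda\to\lambda+\delta e_i}(u\otimes f_0)=C_{i,\delta}(\lambda_1,\lambda_2;\nu)\,Tu.$$ Moreover, the rational functions $C_{i,\delta}(\lambda_1,\lambda_2;\nu)$ are universal in the sense that they depend only on the infinitesimal characters $(\lambda_1,\lambda_2)$ and $\nu$, and are independent of the choice of real forms $(G,G')$ as well as of the representations $\Pi_\lambda$ and $\pi_\nu$. Explicitly (identifying $\{+,-\}$ with $\{1,-1\}$), they are given by $$C_{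i,\delta}(\lambda_1,\lambda_2;\nu)=\frac{\bigl(\lambda_i+\nu+\tfrac12\delta\bigr)\bigl(\lambda_i-\nu+\tfrac12\delta\bigr)}{2(\lambda_1^2-\lambda_2^2)}.$$
   Context: $G\supset G'$, with $\mathfrak o(3,\mathbb C)\subset\mathfrak o(4,\mathbb C)$ embedded in the standard way (corresponding to $\operatorname{diag}(\mathfrak{sl}(2,\mathbb C))\subset\mathfrak{sl}(2,\mathbb C)\oplus\mathfrak{sl}(2,\mathbb C)$). $\mathcal M(G)$ is the category of admissible smooth Fréchet representations of $G$ of finite length and moderate growth (similarly $\mathcal M(G')$). A symmetry breaking operator is a continuous $G'$-homomorphism $\Pi_\lambda|_{G'}\to\pi_\nu$. With standard bases of Cartan subalgebras, the Harish-Chandra isomorphisms identify infinitesimal characters of $\mathfrak Z(\mathfrak o(4,\mathbb C))$ with elements of $\mathbb C^2/W(D_2)$ and those of $\mathfrak Z(\mathfrak o(3,\mathbb C))$ with elements of $\mathbb C/W(B_1)=\mathbb C/\{\pm1\}$ (so the trivial representations have infinitesimal characters $(1,0)$ and $\frac12$, respectively). $e_1,e_2$ denote the standard basis vectors of $\mathbb C^2$. $F=\mathbb C^4$ is the natural representation of $\mathfrak o(4,\mathbb C)$; as a $\mathfrak g'_{\mathbb C}$-module $F=\mathbb C\oplus\mathbb C^3=:F'\oplus F''$. Fix a generator $f_0$ of $F'$ and identify $F'=\mathbb Cf_0\simeq\mathbb C$; $\operatorname{pr}_{F\to F'}\colon F\to F'\simeq\mathbb C$ is the projection along $F''$. The map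 $T\otimes\operatorname{pr}_{F\to F'}$ takes values in $\pi_\nu\otimes F'\simeq\pi_\nu$. $\operatorname{pr}_{\lambda\to\lambda+\delta e_i}$ is the projection of $\Pi_\lambda\otimes\mathbb C^4$ onto its primary component (generalized eigenspace of the center of the enveloping algebra) of infinitesimal character $\lambda+\delta e_i$.
   Formalization: For i=2 the printed formula for C_{2,δ} has the wrong sign (it contradicts the symmetry exchanging λ_1 and λ_2; e.g. λ=(3/2,-1/2), ν=1, δ=+ gives -1/4 instead of 1/4); the formal statement multiplies C_{2,δ} by -1 and keeps C_{1,δ} as printed. *)

theory Defs
  imports "HOL-Analysis.Analysis" "HOL-Algebra.Group" "HOL-Library.Poly_Mapping"
begin

section \<open>Real reductive Lie groups\<close>

definition topological_grp :: "('g, 'z) monoid_scheme \<Rightarrow> 'g topology \<Rightarrow> bool" where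
  "topological_grp G \<T> \<longleftrightarrow>
     Group.group G \<and> topspace \<T> = carrier G \<and>
     continuous_map (prod_topology \<T> \<T>) \<T> (\<lambda>(x, y). x \<otimes>\<^bsub>G\<^esub> y) \<and>
     continuous_map \<T> \<T> (\<lambda>x. inv\<^bsub>G\<^esub> x)"

text \<open>Real points of a symmetric (i.e. transpose-stable) real algebraic subgroup of GL(n).\<close>

definition symmetric_algebraic_group :: "(real^'n^'n) set \<Rightarrow> bool" where
  "symmetric_algebraic_group R \<longleftrightarrow>
     (\<exists>S. (\<forall>f\<in>S. real_polynomial_function f) \<and> R = {A. invertible A \<and> (\<forall>f\<in>S. f A = 0)}) \<and>
     mat 1 \<in> R \<and> (\<forall>A\<in>R. \<forall>B\<in>R. A ** B \<in> R) \<and>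
     (\<forall>A\<in>R. matrix_inv A \<in> R \<and> transpose A \<in> R)"

text \<open>Real reductive groups in the sense of Wallach: finite coverings \<open>p\<close> of an open subgroup of
  a symmetric algebraic group. An open continuous homomorphism of Hausdorff groups with finite
  kernel is a covering of its image. A group is reductive if some such \<open>p\<close> exists; the realization
  \<open>p\<close> is carried along because it yields a matrix model of the Lie algebra, a maximal compact
  subgroup and a norm.\<close>

definition real_reductive_group ::
    "('g, 'z) monoid_scheme \<Rightarrow> 'g topology \<Rightarrow> ('g \<Rightarrow> real^'n^'n) \<Rightarrow> bool" where
  "real_reductive_group G \<T> p \<longleftrightarrow>
     topological_grp G \<T> \<and> Hausdorff_space \<T> \<and>
     (\<exists>R. symmetric_algebraic_group R \<and> openin (top_of_set R) (p ` carrier G)) \<and>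
     (\<forall>x\<in>carrier G. \<forall>y\<in>carrier G. p (x \<otimes>\<^bsub>G\<^esub> y) = p x ** p y) \<and>
     continuous_map \<T> euclidean p \<and> open_map \<T> (top_of_set (p ` carrier G)) p \<and>
     finite {x \<in> carrier G. p x = mat 1}"

definition maximal_compact :: "('g, 'z) monoid_scheme \<Rightarrow> ('g \<Rightarrow> real^'n^'n) \<Rightarrow> 'g set" where
  "maximal_compact G p = {k \<in> carrier G. orthogonal_matrix (p k)}"

definition group_norm :: "('g, 'z) monoid_scheme \<Rightarrow> ('g \<Rightarrow> real^'n^'n) \<Rightarrow> 'g \<Rightarrow> real" where
  "group_norm G p g = max (onorm ((*v) (p g))) (onorm ((*v) (p (inv\<^bsub>G\<^esub> g))))"

text \<open>The Lie algebra is realized by the velocities \<open>(p \<circ> \<gamma>)'(0)\<close> of the one-parameter subgroups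
  \<open>\<gamma>\<close>. As \<open>p\<close> is a covering, \<open>\<gamma>\<close> is determined by its velocity.\<close>

definition one_param :: "('g, 'z) monoid_scheme \<Rightarrow> 'g topology \<Rightarrow> (real \<Rightarrow> 'g) \<Rightarrow> bool" where
  "one_param G \<T> \<gamma> \<longleftrightarrow>
     continuous_map euclidean \<T> \<gamma> \<and> (\<forall>s t. \<gamma> (s + t) = \<gamma> s \<otimes>\<^bsub>G\<^esub> \<gamma> t)"

definition has_velocity ::
    "('g, 'z) monoid_scheme \<Rightarrow> 'g topology \<Rightarrow> ('g \<Rightarrow> real^'n^'n) \<Rightarrow> (real \<Rightarrow> 'g) \<Rightarrow> real^'n^'n \<Rightarrow> bool"
  where
  "has_velocity G \<T> p \<gamma> X \<longleftrightarrow>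
     one_param G \<T> \<gamma> \<and> ((\<lambda>t. p (\<gamma> t)) has_vector_derivative X) (at 0)"

definition lie_alg ::
    "('g, 'z) monoid_scheme \<Rightarrow> 'g topology \<Rightarrow> ('g \<Rightarrow> real^'n^'n) \<Rightarrow> (real^'n^'n) set" where
  "lie_alg G \<T> p = {X. \<exists>\<gamma>. has_velocity G \<T> p \<gamma> X}"

definition exp_curve ::
    "('g, 'z) monoid_scheme \<Rightarrow> 'g topology \<Rightarrow> ('g \<Rightarrow> real^'n^'n) \<Rightarrow> real^'n^'n \<Rightarrow> real \<Rightarrow> 'g" where
  "exp_curve G \<T> p X = (SOME \<gamma>. has_velocity G \<T> p \<gamma> X)"

text \<open>Since the Lie algebra consists of real matrices, its complexification is its complex span.\<close>

definition mRe :: "complex^'n^'m \<Rightarrow> real^'n^'m" where "mRe Z = (\<chi> i j. Re (Z $ i $ j))"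
definition mIm :: "complex^'n^'m \<Rightarrow> real^'n^'m" where "mIm Z = (\<chi> i j. Im (Z $ i $ j))"
definition mcomplex :: "real^'n^'m \<Rightarrow> complex^'n^'m" where
  "mcomplex A = (\<chi> i j. complex_of_real (A $ i $ j))"
definition mscale :: "complex \<Rightarrow> complex^'n^'m \<Rightarrow> complex^'n^'m" where
  "mscale c Z = (\<chi> i j. c * Z $ i $ j)"

definition complexified :: "(real^'n^'n) set \<Rightarrow> (complex^'n^'n) set" where
  "complexified \<gg> = {Z. mRe Z \<in> \<gg> \<and> mIm Z \<in> \<gg>}"

definition bracket :: "complex^'n^'n \<Rightarrow> complex^'n^'n \<Rightarrow> complex^'n^'n" where
  "bracket X Y = X ** Y - Y ** X"


section \<open>The category of smooth admissible Frechet representations of moderate growth\<close>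

text \<open>A representation space is a type \<open>'v\<close> carrying a complex scalar multiplication \<open>s\<close>; its topology
  is that of the type class.\<close>

definition cseminorm :: "(complex \<Rightarrow> 'v::ab_group_add \<Rightarrow> 'v) \<Rightarrow> ('v \<Rightarrow> real) \<Rightarrow> bool" where
  "cseminorm s q \<longleftrightarrow>
     (\<forall>x y. q (x + y) \<le> q x + q y) \<and> (\<forall>c x. q (s c x) = cmod c * q x)"

definition frechet_space ::
    "(complex \<Rightarrow> 'v::{topological_ab_group_add, t2_space} \<Rightarrow> 'v) \<Rightarrow> bool" where
  "frechet_space s \<longleftrightarrow> vector_space s \<and>
     (\<exists>q :: nat \<Rightarrow> 'v \<Rightarrow> real. (\<forall>k. cseminorm s (q k)) \<and>
        (\<forall>x. (\<forall>k. q k x = 0) \<longrightarrow> x = 0) \<and>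
        (\<forall>U. open U \<longleftrightarrow> (\<forall>x\<in>U. \<exists>k. \<exists>e>0. {y. \<forall>j\<le>k. q j (y - x) < e} \<subseteq> U)) \<and>
        (\<forall>x :: nat \<Rightarrow> 'v.
           (\<forall>k. \<forall>e>0. \<exists>N. \<forall>m\<ge>N. \<forall>n\<ge>N. q k (x m - x n) < e) \<longrightarrow> (\<exists>l. x \<longlonglongrightarrow> l)))"

definition continuous_rep ::
    "('g, 'z) monoid_scheme \<Rightarrow> 'g topology \<Rightarrow> (complex \<Rightarrow> 'v \<Rightarrow> 'v)
      \<Rightarrow> ('g \<Rightarrow> 'v \<Rightarrow> 'v::{topological_ab_group_add, t2_space}) \<Rightarrow> bool" where
  "continuous_rep G \<T> s \<Phi> \<longleftrightarrow>
     (\<forall>g\<in>carrier G. Vector_Spaces.linear s s (\<Phi> g)) \<and>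
     (\<forall>v. \<Phi> \<one>\<^bsub>G\<^esub> v = v) \<and>
     (\<forall>g\<in>carrier G. \<forall>h\<in>carrier G. \<forall>v. \<Phi> (g \<otimes>\<^bsub>G\<^esub> h) v = \<Phi> g (\<Phi> h v)) \<and>
     continuous_map (prod_topology \<T> euclidean) euclidean (\<lambda>(g, v). \<Phi> g v)"

text \<open>\<open>Ck_on s E U k f\<close>: on the relatively open subset \<open>U\<close> of the real vector space \<open>E\<close>, all iterated
  directional derivatives of \<open>f\<close> of order at most \<open>k\<close> exist and are continuous.\<close>

primrec Ck_on ::
    "(complex \<Rightarrow> 'v \<Rightarrow> 'v) \<Rightarrow> 'e::real_normed_vector set \<Rightarrow> 'e set \<Rightarrow> nat
      \<Rightarrow> ('e \<Rightarrow> 'v::{topological_ab_group_add, t2_space}) \<Rightarrow> bool" where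
  "Ck_on s E U 0 f = continuous_on U f"
| "Ck_on s E U (Suc k) f =
     (continuous_on U f \<and>
      (\<forall>X\<in>E. \<exists>f'.
         (\<forall>x\<in>U. ((\<lambda>t::real. s (complex_of_real (1 / t)) (f (x + t *\<^sub>R X) - f x)) \<longlongrightarrow> f' x) (at 0)) \<and>
         Ck_on s E U k f'))"

text \<open>Smoothness of an orbit map, in the exponential charts \<open>X \<mapsto> g exp X\<close> around every \<open>g\<close>.\<close>

definition smooth_vector ::
    "('g, 'z) monoid_scheme \<Rightarrow> 'g topology \<Rightarrow> ('g \<Rightarrow> real^'n^'n) \<Rightarrow> (complex \<Rightarrow> 'v \<Rightarrow> 'v)
      \<Rightarrow> ('g \<Rightarrow> 'v \<Rightarrow> 'v::{topological_ab_group_add, t2_space}) \<Rightarrow> 'v \<Rightarrow> bool" where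
  "smooth_vector G \<T> p s \<Phi> u \<longleftrightarrow>
     (\<forall>g\<in>carrier G. \<exists>U. openin (top_of_set (lie_alg G \<T> p)) U \<and> 0 \<in> U \<and>
        (\<forall>k. Ck_on s (lie_alg G \<T> p) U k (\<lambda>X. \<Phi> (g \<otimes>\<^bsub>G\<^esub> exp_curve G \<T> p X 1) u)))"

definition deriv_rep ::
    "('g, 'z) monoid_scheme \<Rightarrow> 'g topology \<Rightarrow> ('g \<Rightarrow> real^'n^'n) \<Rightarrow> (complex \<Rightarrow> 'v \<Rightarrow> 'v)
      \<Rightarrow> ('g \<Rightarrow> 'v \<Rightarrow> 'v::{topological_ab_group_add, t2_space}) \<Rightarrow> real^'n^'n \<Rightarrow> 'v \<Rightarrow> 'v" where
  "deriv_rep G \<T> p s \<Phi> X u =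
     Lim (at 0) (\<lambda>t::real. s (complex_of_real (1 / t)) (\<Phi> (exp_curve G \<T> p X t) u - u))"

definition cderiv_rep ::
    "('g, 'z) monoid_scheme \<Rightarrow> 'g topology \<Rightarrow> ('g \<Rightarrow> real^'n^'n) \<Rightarrow> (complex \<Rightarrow> 'v \<Rightarrow> 'v)
      \<Rightarrow> ('g \<Rightarrow> 'v \<Rightarrow> 'v::{topological_ab_group_add, t2_space}) \<Rightarrow> complex^'n^'n \<Rightarrow> 'v \<Rightarrow> 'v" where
  "cderiv_rep G \<T> p s \<Phi> Z u =
     deriv_rep G \<T> p s \<Phi> (mRe Z) u + s \<i> (deriv_rep G \<T> p s \<Phi> (mIm Z) u)"

text \<open>A smooth Frechet representation satisfies \<open>V = V\<^sup>\<infinity>\<close> as topological vector spaces. As the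
  topology of \<open>V\<^sup>\<infinity>\<close> is given by the seminorms \<open>q (X\<^sub>1 \<cdots> X\<^sub>k u)\<close>, the topological part of this says
  that the Lie algebra acts by continuous operators.\<close>

definition smooth_frechet_rep ::
    "('g, 'z) monoid_scheme \<Rightarrow> 'g topology \<Rightarrow> ('g \<Rightarrow> real^'n^'n) \<Rightarrow> (complex \<Rightarrow> 'v \<Rightarrow> 'v)
      \<Rightarrow> ('g \<Rightarrow> 'v \<Rightarrow> 'v::{topological_ab_group_add, t2_space}) \<Rightarrow> bool" where
  "smooth_frechet_rep G \<T> p s \<Phi> \<longleftrightarrow>
     frechet_space s \<and> continuous_rep G \<T> s \<Phi> \<and> (\<forall>u. smooth_vector G \<T> p s \<Phi> u) \<and>
     (\<forall>X\<in>lie_alg G \<T> p. continuous_on UNIV (deriv_rep G \<T> p s \<Phi> X))"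

definition invariant_subspace ::
    "'g set \<Rightarrow> (complex \<Rightarrow> 'v \<Rightarrow> 'v) \<Rightarrow> ('g \<Rightarrow> 'v \<Rightarrow> 'v::ab_group_add) \<Rightarrow> 'v set \<Rightarrow> bool" where
  "invariant_subspace K s \<Phi> E \<longleftrightarrow> module.subspace s E \<and> (\<forall>k\<in>K. \<forall>x\<in>E. \<Phi> k x \<in> E)"

definition fin_dim :: "(complex \<Rightarrow> 'v \<Rightarrow> 'v::ab_group_add) \<Rightarrow> 'v set \<Rightarrow> bool" where
  "fin_dim s E \<longleftrightarrow> (\<exists>B. finite B \<and> E \<subseteq> module.span s B)"

definition irreducible_fd ::
    "'g set \<Rightarrow> (complex \<Rightarrow> 'v \<Rightarrow> 'v) \<Rightarrow> ('g \<Rightarrow> 'v \<Rightarrow> 'v::ab_group_add) \<Rightarrow> 'v set \<Rightarrow> bool" where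
  "irreducible_fd K s \<Phi> E \<longleftrightarrow>
     invariant_subspace K s \<Phi> E \<and> fin_dim s E \<and> E \<noteq> {0} \<and>
     (\<forall>E'\<subseteq>E. invariant_subspace K s \<Phi> E' \<longrightarrow> E' = {0} \<or> E' = E)"

definition equivalent_on ::
    "'g set \<Rightarrow> (complex \<Rightarrow> 'v \<Rightarrow> 'v) \<Rightarrow> ('g \<Rightarrow> 'v \<Rightarrow> 'v::ab_group_add) \<Rightarrow> 'v set \<Rightarrow> 'v set \<Rightarrow> bool" where
  "equivalent_on K s \<Phi> E E' \<longleftrightarrow>
     (\<exists>\<phi>. bij_betw \<phi> E E' \<and> (\<forall>x\<in>E. \<forall>y\<in>E. \<phi> (x + y) = \<phi> x + \<phi> y) \<and>
          (\<forall>c. \<forall>x\<in>E. \<phi> (s c x) = s c (\<phi> x)) \<and> (\<forall>k\<in>K. \<forall>x\<in>E. \<phi> (\<Phi> k x) = \<Phi> k (\<phi> x)))"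

text \<open>Admissibility: every \<open>K\<close>-type has finite multiplicity, i.e. all isotypic components are
  finite-dimensional. Every \<open>K\<close>-type that occurs is represented by a subspace \<open>E\<close>.\<close>

definition admissible_rep ::
    "'g set \<Rightarrow> (complex \<Rightarrow> 'v \<Rightarrow> 'v) \<Rightarrow> ('g \<Rightarrow> 'v \<Rightarrow> 'v::ab_group_add) \<Rightarrow> bool" where
  "admissible_rep K s \<Phi> \<longleftrightarrow>
     (\<forall>E. irreducible_fd K s \<Phi> E \<longrightarrow>
        fin_dim s (module.span s (\<Union>{E'. irreducible_fd K s \<Phi> E' \<and> equivalent_on K s \<Phi> E E'})))"

definition finite_length ::
    "'g set \<Rightarrow> (complex \<Rightarrow> 'v \<Rightarrow> 'v)
      \<Rightarrow> ('g \<Rightarrow> 'v \<Rightarrow> 'v::{topological_ab_group_add, t2_space}) \<Rightarrow> bool" where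
  "finite_length K s \<Phi> \<longleftrightarrow>
     (\<exists>(n::nat) V. V 0 = {0} \<and> V n = UNIV \<and>
        (\<forall>i\<le>n. closed (V i) \<and> invariant_subspace K s \<Phi> (V i)) \<and>
        (\<forall>i<n. V i \<subset> V (Suc i) \<and>
           \<not> (\<exists>E. closed E \<and> invariant_subspace K s \<Phi> E \<and> V i \<subset> E \<and> E \<subset> V (Suc i))))"

definition moderate_growth ::
    "('g, 'z) monoid_scheme \<Rightarrow> ('g \<Rightarrow> real^'n^'n) \<Rightarrow> (complex \<Rightarrow> 'v \<Rightarrow> 'v)
      \<Rightarrow> ('g \<Rightarrow> 'v \<Rightarrow> 'v::{topological_ab_group_add, t2_space}) \<Rightarrow> bool" where
  "moderate_growth G p s \<Phi> \<longleftrightarrow>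
     (\<forall>q. cseminorm s q \<and> continuous_on UNIV q \<longrightarrow>
        (\<exists>(N::nat) q'. cseminorm s q' \<and> continuous_on UNIV q' \<and>
           (\<forall>g\<in>carrier G. \<forall>v. q (\<Phi> g v) \<le> group_norm G p g ^ N * q' v)))"

definition in_cat_M ::
    "('g, 'z) monoid_scheme \<Rightarrow> 'g topology \<Rightarrow> ('g \<Rightarrow> real^'n^'n) \<Rightarrow> (complex \<Rightarrow> 'v \<Rightarrow> 'v)
      \<Rightarrow> ('g \<Rightarrow> 'v \<Rightarrow> 'v::{topological_ab_group_add, t2_space}) \<Rightarrow> bool" where
  "in_cat_M G \<T> p s \<Phi> \<longleftrightarrow>
     smooth_frechet_rep G \<T> p s \<Phi> \<and> admissible_rep (maximal_compact G p) s \<Phi> \<and>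
     finite_length (carrier G) s \<Phi> \<and> moderate_growth G p s \<Phi>"

definition symmetry_breaking ::
    "'g set \<Rightarrow> (complex \<Rightarrow> 'v \<Rightarrow> 'v) \<Rightarrow> (complex \<Rightarrow> 'w \<Rightarrow> 'w)
      \<Rightarrow> ('g \<Rightarrow> 'v \<Rightarrow> 'v::{topological_ab_group_add, t2_space})
      \<Rightarrow> ('g \<Rightarrow> 'w \<Rightarrow> 'w::{topological_ab_group_add, t2_space}) \<Rightarrow> ('v \<Rightarrow> 'w) \<Rightarrow> bool" where
  "symmetry_breaking H sV sW \<Phi> \<pi> T \<longleftrightarrow>
     Vector_Spaces.linear sV sW T \<and> continuous_on UNIV T \<and>
     (\<forall>h\<in>H. \<forall>u. T (\<Phi> h u) = \<pi> h (T u))"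


section \<open>Universal enveloping algebras and infinitesimal characters\<close>

text \<open>The free algebra on a type of letters is the monoid algebra of the free monoid of words.\<close>

instantiation list :: (type) monoid_add
begin
definition zero_list :: "'a list" where "zero_list = []"
definition plus_list :: "'a list \<Rightarrow> 'a list \<Rightarrow> 'a list" where "plus_list = (@)"
instance by standard (simp_all add: zero_list_def plus_list_def)
end

type_synonym 'a free_alg = "'a list \<Rightarrow>\<^sub>0 complex"

definition letter :: "'a \<Rightarrow> 'a free_alg" where
  "letter X = Poly_Mapping.single [X] 1"

definition free_over :: "'a set \<Rightarrow> 'a free_alg set" where
  "free_over L = {z. \<forall>w\<in>Poly_Mapping.keys z. set w \<subseteq> L}"

text \<open>\<open>U(L)\<close> is the quotient of \<open>free_over L\<close> by \<open>U_ideal L\<close>; we calculate with representatives.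
  The linearity relations are needed since all elements of \<open>L\<close> serve as letters.\<close>

definition U_rel :: "(complex^'n^'n) set \<Rightarrow> (complex^'n^'n) free_alg set" where
  "U_rel L =
     {letter (X + Y) - letter X - letter Y | X Y. X \<in> L \<and> Y \<in> L} \<union>
     {letter (mscale c X) - Poly_Mapping.single [X] c | c X. X \<in> L} \<union>
     {letter X * letter Y - letter Y * letter X - letter (bracket X Y) | X Y. X \<in> L \<and> Y \<in> L}"

inductive_set U_ideal :: "(complex^'n^'n) set \<Rightarrow> (complex^'n^'n) free_alg set" for L where
  zero: "0 \<in> U_ideal L"
| add: "x \<in> U_ideal L \<Longrightarrow> a \<in> free_over L \<Longrightarrow> b \<in> free_over L \<Longrightarrow> r \<in> U_rel L
        \<Longrightarrow> x + a * r * b \<in> U_ideal L"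

definition U_center :: "(complex^'n^'n) set \<Rightarrow> (complex^'n^'n) free_alg set" where
  "U_center L = {z \<in> free_over L. \<forall>u\<in>free_over L. u * z - z * u \<in> U_ideal L}"

text \<open>(Preimage of) the left ideal \<open>U(L) N\<close>.\<close>

inductive_set U_left_ideal ::
    "(complex^'n^'n) set \<Rightarrow> (complex^'n^'n) set \<Rightarrow> (complex^'n^'n) free_alg set" for L N where
  base: "x \<in> U_ideal L \<Longrightarrow> x \<in> U_left_ideal L N"
| add: "x \<in> U_left_ideal L N \<Longrightarrow> a \<in> free_over L \<Longrightarrow> X \<in> N
        \<Longrightarrow> x + a * letter X \<in> U_left_ideal L N"

definition free_act ::
    "(complex \<Rightarrow> 'v \<Rightarrow> 'v) \<Rightarrow> ('a \<Rightarrow> 'v \<Rightarrow> 'v::ab_group_add) \<Rightarrow> 'a free_alg \<Rightarrow> 'v \<Rightarrow> 'v" where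
  "free_act s \<rho> z v = (\<Sum>w\<in>Poly_Mapping.keys z. s (Poly_Mapping.lookup z w) (foldr \<rho> w v))"

definition free_eval :: "('a \<Rightarrow> complex) \<Rightarrow> 'a free_alg \<Rightarrow> complex" where
  "free_eval \<tau> z = (\<Sum>w\<in>Poly_Mapping.keys z. Poly_Mapping.lookup z w * prod_list (map \<tau> w))"

definition free_map :: "('a \<Rightarrow> 'b) \<Rightarrow> 'a free_alg \<Rightarrow> 'b free_alg" where
  "free_map f z =
     (\<Sum>w\<in>Poly_Mapping.keys z. Poly_Mapping.single (map f w) (Poly_Mapping.lookup z w))"

text \<open>Harish-Chandra isomorphism: for central \<open>z\<close> there is \<open>y \<in> U(h)\<close>, unique in \<open>U(L)\<close>, with
  \<open>z - y \<in> U(L) N\<close> (\<open>N\<close> the sum of the positive root spaces), and the character with parameter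
  \<open>\<lambda>\<close> maps \<open>z\<close> to the value of \<open>y\<close> at \<open>\<tau> = \<lambda> - \<rho>\<close>. We write this as a relation between
  \<open>z\<close> and the value.\<close>

definition HC_value ::
    "(complex^'n^'n) set \<Rightarrow> (complex^'n^'n) set \<Rightarrow> (complex^'n^'n) set
      \<Rightarrow> (complex^'n^'n \<Rightarrow> complex) \<Rightarrow> (complex^'n^'n) free_alg \<Rightarrow> complex \<Rightarrow> bool" where
  "HC_value L h N \<tau> z c \<longleftrightarrow>
     z \<in> U_center L \<and> (\<exists>y\<in>free_over h. z - y \<in> U_left_ideal L N \<and> c = free_eval \<tau> y)"


section \<open>The pair (o(4,C), o(3,C))\<close>

definition o4 :: "(complex^4^4) set" where "o4 = {X. transpose X = - X}"
definition o3 :: "(complex^4^4) set" where "o3 = {X \<in> o4. \<forall>i. X $ i $ 4 = 0}"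

text \<open>\<open>H1, H2\<close> act on \<open>C\<^sup>4\<close> with weights \<open>\<plusminus>e1\<close> and \<open>\<plusminus>e2\<close>. The positive roots are \<open>e1 + e2, e1 - e2\<close>
  for o(4) and \<open>e1\<close> for o(3), so in both cases the positive root spaces add up to the eigenspace of
  \<open>ad H1\<close> with eigenvalue 1.\<close>

definition H1 :: "complex^4^4" where
  "H1 = (\<chi> i j. if i = 2 \<and> j = 1 then \<i> else if i = 1 \<and> j = 2 then - \<i> else 0)"
definition H2 :: "complex^4^4" where
  "H2 = (\<chi> i j. if i = 4 \<and> j = 3 then \<i> else if i = 3 \<and> j = 4 then - \<i> else 0)"

definition cartan4 :: "(complex^4^4) set" where
  "cartan4 = {mscale a H1 + mscale b H2 | a b. True}"
definition cartan3 :: "(complex^4^4) set" where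
  "cartan3 = {mscale a H1 | a. True}"
definition npos4 :: "(complex^4^4) set" where "npos4 = {X \<in> o4. bracket H1 X = X}"
definition npos3 :: "(complex^4^4) set" where "npos3 = {X \<in> o3. bracket H1 X = X}"

text \<open>The weights \<open>l1 e1 + l2 e2\<close> and \<open>\<nu> e1\<close>: the (2,1) and (4,3) entries of \<open>a H1 + b H2\<close> are
  \<open>\<i> a\<close> and \<open>\<i> b\<close>.\<close>

definition weight4 :: "complex^2 \<Rightarrow> complex^4^4 \<Rightarrow> complex" where
  "weight4 l X = - \<i> * (l $ 1 * X $ 2 $ 1 + l $ 2 * X $ 4 $ 3)"
definition weight3 :: "complex \<Rightarrow> complex^4^4 \<Rightarrow> complex" where
  "weight3 n X = - \<i> * (n * X $ 2 $ 1)"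

text \<open>Half sums of positive roots: \<open>\<rho> = (1,0)\<close> for o(4) and \<open>\<rho> = 1/2\<close> for o(3).\<close>

definition HC4 :: "complex^2 \<Rightarrow> (complex^4^4) free_alg \<Rightarrow> complex \<Rightarrow> bool" where
  "HC4 l = HC_value o4 cartan4 npos4 (weight4 (l - axis 1 1))"
definition HC3 :: "complex \<Rightarrow> (complex^4^4) free_alg \<Rightarrow> complex \<Rightarrow> bool" where
  "HC3 n = HC_value o3 cartan3 npos3 (weight3 (n - 1/2))"

definition inf_char4 ::
    "(complex \<Rightarrow> 'v \<Rightarrow> 'v) \<Rightarrow> (complex^4^4 \<Rightarrow> 'v \<Rightarrow> 'v::ab_group_add) \<Rightarrow> complex^2 \<Rightarrow> bool" where
  "inf_char4 s \<rho> l \<longleftrightarrow> (\<forall>z c. HC4 l z c \<longrightarrow> (\<forall>v. free_act s \<rho> z v = s c v))"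
definition inf_char3 ::
    "(complex \<Rightarrow> 'v \<Rightarrow> 'v) \<Rightarrow> (complex^4^4 \<Rightarrow> 'v \<Rightarrow> 'v::ab_group_add) \<Rightarrow> complex \<Rightarrow> bool" where
  "inf_char3 s \<rho> n \<longleftrightarrow> (\<forall>z c. HC3 n z c \<longrightarrow> (\<forall>v. free_act s \<rho> z v = s c v))"

text \<open>Primary components are generalized eigenspaces of the center of \<open>U(o(4,C))\<close>.\<close>

definition primary ::
    "(complex \<Rightarrow> 'v \<Rightarrow> 'v) \<Rightarrow> (complex^4^4 \<Rightarrow> 'v \<Rightarrow> 'v::ab_group_add) \<Rightarrow> complex^2 \<Rightarrow> 'v set" where
  "primary s \<rho> l =
     {v. \<forall>z c. HC4 l z c \<longrightarrow> (\<exists>k::nat. ((\<lambda>w. free_act s \<rho> z w - s c w) ^^ k) v = 0)}"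

text \<open>The orbits of the Weyl group \<open>W(D\<^sub>2)\<close>: permutations and even sign changes.\<close>

definition W_D2_orbit :: "complex^2 \<Rightarrow> (complex^2) set" where
  "W_D2_orbit l = {vector [l $ 1, l $ 2], vector [l $ 2, l $ 1],
                   vector [- l $ 1, - l $ 2], vector [- l $ 2, - l $ 1]}"

definition primary_proj ::
    "(complex \<Rightarrow> 'v \<Rightarrow> 'v) \<Rightarrow> (complex^4^4 \<Rightarrow> 'v \<Rightarrow> 'v::ab_group_add) \<Rightarrow> complex^2 \<Rightarrow> 'v \<Rightarrow> 'v" where
  "primary_proj s \<rho> l v =
     (THE x. x \<in> primary s \<rho> l \<and>
        v - x \<in> module.span s (\<Union>{primary s \<rho> m | m. m \<notin> W_D2_orbit l}))"

text \<open>\<open>V \<otimes> C\<^sup>4\<close> is modelled by \<open>V\<^sup>4\<close>, with \<open>u \<otimes> f = (f\<^sub>1 u, \<dots>, f\<^sub>4 u)\<close>.\<close>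

definition tensor :: "(complex \<Rightarrow> 'v \<Rightarrow> 'v) \<Rightarrow> 'v \<Rightarrow> complex^4 \<Rightarrow> 'v^4" where
  "tensor s u f = (\<chi> i. s (f $ i) u)"
definition tensor_scale :: "(complex \<Rightarrow> 'v \<Rightarrow> 'v) \<Rightarrow> complex \<Rightarrow> 'v^4 \<Rightarrow> 'v^4" where
  "tensor_scale s c x = (\<chi> i. s c (x $ i))"
definition tensor_act ::
    "(complex \<Rightarrow> 'v \<Rightarrow> 'v) \<Rightarrow> (complex^4^4 \<Rightarrow> 'v \<Rightarrow> 'v::ab_group_add) \<Rightarrow> complex^4^4 \<Rightarrow> 'v^4 \<Rightarrow> 'v^4" where
  "tensor_act s \<rho> X x = (\<chi> i. \<rho> X (x $ i) + (\<Sum>j\<in>UNIV. s (X $ i $ j) (x $ j)))"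

definition F' :: "(complex^4) set" where "F' = {f. \<forall>X\<in>o3. X *v f = 0}"
definition F'' :: "(complex^4) set" where "F'' = {f. f $ 4 = 0}"

definition pr_F' :: "complex^4 \<Rightarrow> complex^4 \<Rightarrow> complex" where
  "pr_F' f0 f = (THE c. f - c *s f0 \<in> F'')"

definition tensor_pr ::
    "(complex \<Rightarrow> 'w \<Rightarrow> 'w::ab_group_add) \<Rightarrow> ('v \<Rightarrow> 'w) \<Rightarrow> complex^4 \<Rightarrow> 'v^4 \<Rightarrow> 'w" where
  "tensor_pr sW T f0 x = (\<Sum>j\<in>UNIV. sW (pr_F' f0 (axis j 1)) (T (x $ j)))"

text \<open>An isomorphism of pairs of complex Lie algebras \<open>(o4, o3) \<rightarrow> (g, g')\<close>.\<close>

definition pair_iso ::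
    "(complex^4^4 \<Rightarrow> complex^'n^'n) \<Rightarrow> (complex^'n^'n) set \<Rightarrow> (complex^'n^'n) set \<Rightarrow> bool" where
  "pair_iso \<psi> g g' \<longleftrightarrow>
     (\<forall>X\<in>o4. \<forall>Y\<in>o4. \<psi> (X + Y) = \<psi> X + \<psi> Y \<and> \<psi> (bracket X Y) = bracket (\<psi> X) (\<psi> Y)) \<and>
     (\<forall>c. \<forall>X\<in>o4. \<psi> (mscale c X) = mscale c (\<psi> X)) \<and>
     bij_betw \<psi> o4 g \<and> \<psi> ` o3 = g'"

text \<open>The algebra \<open>Z(G) = U(g)\<^sup>G\<close>, transported to o(4,C) by \<open>\<psi>\<close>.\<close>

definition Ad_o4 ::
    "(complex^4^4 \<Rightarrow> complex^'n^'n) \<Rightarrow> ('g \<Rightarrow> real^'n^'n) \<Rightarrow> 'g \<Rightarrow> complex^4^4 \<Rightarrow> complex^4^4" where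
  "Ad_o4 \<psi> p g X = inv_into o4 \<psi> (mcomplex (p g) ** \<psi> X ** mcomplex (matrix_inv (p g)))"

definition Z_group ::
    "('g, 'z) monoid_scheme \<Rightarrow> ('g \<Rightarrow> real^'n^'n) \<Rightarrow> (complex^4^4 \<Rightarrow> complex^'n^'n)
      \<Rightarrow> (complex^4^4) free_alg set" where
  "Z_group G p \<psi> =
     {z \<in> free_over o4. \<forall>g\<in>carrier G. free_map (Ad_o4 \<psi> p g) z - z \<in> U_ideal o4}"

definition primary_genuine ::
    "(complex^4^4) free_alg set \<Rightarrow> (complex \<Rightarrow> 'v \<Rightarrow> 'v)
      \<Rightarrow> (complex^4^4 \<Rightarrow> 'v \<Rightarrow> 'v::ab_group_add) \<Rightarrow> bool" where
  "primary_genuine Z s \<rho> \<longleftrightarrow>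
     (\<forall>l. \<forall>z\<in>Z. \<exists>c. \<forall>v\<in>primary s \<rho> l. free_act s \<rho> z v = s c v)"


section \<open>The universal coefficients\<close>

text \<open>The sign is forced by \<open>W(D\<^sub>2)\<close>-invariance: interchanging \<open>\<lambda>\<^sub>1\<close> and \<open>\<lambda>\<^sub>2\<close> turns \<open>\<lambda> + \<delta> e2\<close> into
  \<open>\<lambda> + \<delta> e1\<close> and \<open>\<lambda>\<^sub>1\<^sup>2 - \<lambda>\<^sub>2\<^sup>2\<close> into its negative. Equivalently, the four coefficients sum to 1.\<close>

definition C_coeff :: "2 \<Rightarrow> complex \<Rightarrow> complex^2 \<Rightarrow> complex \<Rightarrow> complex" where
  "C_coeff i \<delta> l n =
     (if i = 1 then 1 else - 1) *
     ((l $ i + n + \<delta> / 2) * (l $ i - n + \<delta> / 2) / (2 * ((l $ 1)\<^sup>2 - (l $ 2)\<^sup>2)))"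

inductive polynomial_fun3 :: "(complex^2 \<Rightarrow> complex \<Rightarrow> complex) \<Rightarrow> bool" where
  "polynomial_fun3 (\<lambda>l n. c)"
| "polynomial_fun3 (\<lambda>l n. l $ j)"
| "polynomial_fun3 (\<lambda>l n. n)"
| "polynomial_fun3 P \<Longrightarrow> polynomial_fun3 Q \<Longrightarrow> polynomial_fun3 (\<lambda>l n. P l n + Q l n)"
| "polynomial_fun3 P \<Longrightarrow> polynomial_fun3 Q \<Longrightarrow> polynomial_fun3 (\<lambda>l n. P l n * Q l n)"

definition rational_fun3 :: "(complex^2 \<Rightarrow> complex \<Rightarrow> complex) \<Rightarrow> bool" where
  "rational_fun3 f \<longleftrightarrow>
     (\<exists>P Q. polynomial_fun3 P \<and> polynomial_fun3 Q \<and> (\<exists>l n. Q l n \<noteq> 0) \<and>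
        (\<forall>l n. Q l n \<noteq> 0 \<longrightarrow> f l n = P l n / Q l n))"

end

(* o(4,C) is the sum of two copies of sl(2,C), embedded in the 4 x 4 matrices as the left and the
   right multiplications with quaternions. Their Casimir elements generate the center of U(o(4,C))
   and act on Pi by (lambda_1 + lambda_2)^2 - 1 and (lambda_1 - lambda_2)^2 - 1. On Pi (x) C^4, each of
   them is an affine function of an operator S with (S - 1)^2 = (lambda_1 +- lambda_2)^2. As
   lambda_1 and +-lambda_2 differ, both act semisimply with two eigenvalues, and the projections to
   the primary components are products of two Lagrange polynomials. The F'-component of such a
   projection of u (x) f_0 is a combination of u and of the mixed term sum_k A_k B_k u, where
   A_k and B_k are matching quaternionic bases of the two copies of sl(2,C). As the A_k + B_k span o(3,C),
   the mixed term is a combination of the three Casimir elements, and T turns the one of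
   o(3,C) into 4 nu^2 - 1.

   That the joint eigenspaces of the Casimir elements are primary components requires that every
   central element acts on them by its Harish-Chandra value. The operator
   sum_k ad(A_k)^2 acts on the degree n layer of U modulo the Casimir elements by -4 n (n + 1);
   being killed by it, central elements are constants modulo the Casimir elements, and these
   constants can be read off from a Verma module. *)

theory Submission
  imports Defs "HOL-Library.Function_Algebras"
begin

section \<open>Limits in Frechet spaces\<close>

text \<open>The analytic obstacle is to turn the complexified differential of \<open>\<Phi>\<close>
  into a Lie algebra representation. \<open>Ck_on\<close> speaks of directional derivatives only and
  \<open>lie_alg\<close> is merely a set of velocities. Additivity of the derivative therefore rests
  on a mean value inequality, and closure of \<open>lie_alg\<close> under sums and brackets is
  borrowed from o(4,C) through \<open>\<psi>\<close>. Everything after that is algebra. There,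
  \<open>HC_value\<close> is only a relation, and \<open>primary_proj\<close> is a definite
  description that involves all central elements and all other Weyl orbits. For the first, a basis
  theorem for U is avoided: the two-sided ideal of elements that kill both a joint eigenspace and a
  Verma module carries the value of a central element from one to the other. For the second, W(D_2)
  changes the signs of \<lambda>_1 + \<lambda>_2 and \<lambda>_1 - \<lambda>_2 independently, and as
  neither is zero, the four shifts by +1 and -1 lie in different orbits.\<close>

locale frechet_seminorms =
  fixes s :: "complex \<Rightarrow> 'v \<Rightarrow> 'v::{topological_ab_group_add, t2_space}"
    and q :: "nat \<Rightarrow> 'v \<Rightarrow> real"
  assumes vector_space: "vector_space s"
    and seminorm: "cseminorm s (q k)"
    and separating: "(\<And>k. q k x = 0) \<Longrightarrow> x = 0"
    and open_iff: "open U \<longleftrightarrow> (\<forall>x\<in>U. \<exists>k. \<exists>e>0. {y. \<forall>j\<le>k. q j (y - x) < e} \<subseteq> U)"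
begin

sublocale vector_space s by (rule vector_space)

lemma q_triangle: "q k (x + y) \<le> q k x + q k y"
  using seminorm[of k] by (simp add: cseminorm_def)

lemma q_scale: "q k (s c x) = cmod c * q k x"
  using seminorm[of k] by (simp add: cseminorm_def)

lemma q_0 [simp]: "q k 0 = 0"
  using q_scale[of k 0 0] by simp

lemma q_minus: "q k (- x) = q k x"
  using q_scale[of k "-1" x] by simp

lemma q_nonneg: "0 \<le> q k x"
  using q_triangle[of k x "- x"] by (simp add: q_minus)

lemma tendsto_iff_q: "(f \<longlongrightarrow> l) F \<longleftrightarrow> (\<forall>k. ((\<lambda>x. q k (f x - l)) \<longlongrightarrow> 0) F)"
proof
  assume f: "(f \<longlongrightarrow> l) F"
  show "\<forall>k. ((\<lambda>x. q k (f x - l)) \<longlongrightarrow> 0) F"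
  proof (intro allI tendstoI)
    fix k and e :: real assume "e > 0"
    define U where "U = {y. q k (y - l) < e}"
    have "open U"
      unfolding open_iff
    proof (intro ballI exI conjI)
      fix x assume "x \<in> U"
      then show "0 < e - q k (x - l)" by (simp add: U_def)
      show "{y. \<forall>j\<le>k. q j (y - x) < e - q k (x - l)} \<subseteq> U"
      proof
        fix y assume "y \<in> {y. \<forall>j\<le>k. q j (y - x) < e - q k (x - l)}"
        then have "q k (y - x) < e - q k (x - l)" by simp
        moreover have "q k (y - l) \<le> q k (y - x) + q k (x - l)"
          using q_triangle[of k "y - x" "x - l"] by simp
        ultimately show "y \<in> U" by (simp add: U_def)
      qed
    qed
    moreover have "l \<in> U" using \<open>e > 0\<close> by (simp add: U_def)
    ultimately have "\<forall>\<^sub>F x in F. f x \<in> U" using f topological_tendstoD by blast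
    then show "\<forall>\<^sub>F x in F. dist (q k (f x - l)) 0 < e"
      by eventually_elim (simp add: U_def q_nonneg)
  qed
next
  assume *: "\<forall>k. ((\<lambda>x. q k (f x - l)) \<longlongrightarrow> 0) F"
  show "(f \<longlongrightarrow> l) F"
  proof (rule topological_tendstoI)
    fix U assume "open U" "l \<in> U"
    then obtain k e where "e > 0" and U: "{y. \<forall>j\<le>k. q j (y - l) < e} \<subseteq> U"
      unfolding open_iff by blast
    have "\<forall>\<^sub>F x in F. q j (f x - l) < e" for j
      using order_tendstoD(2)[OF *[rule_format] \<open>e > 0\<close>] .
    then have "\<forall>\<^sub>F x in F. \<forall>j\<in>{..k}. q j (f x - l) < e"
      by (intro eventually_ball_finite) auto
    then show "\<forall>\<^sub>F x in F. f x \<in> U"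
      by eventually_elim (use U in auto)
  qed
qed

lemma tendsto_scale:
  assumes c: "(c \<longlongrightarrow> c0) F" and f: "(f \<longlongrightarrow> l) F"
  shows "((\<lambda>x. s (c x) (f x)) \<longlongrightarrow> s c0 l) F"
  unfolding tendsto_iff_q
proof
  fix k
  have "((\<lambda>x. q k (f x - l)) \<longlongrightarrow> 0) F" using f unfolding tendsto_iff_q by blast
  then have "((\<lambda>x. cmod (c x) * q k (f x - l) + cmod (c x - c0) * q k l)
     \<longlongrightarrow> cmod c0 * 0 + cmod (c0 - c0) * q k l) F"
    by (intro tendsto_intros c)
  then have lim: "((\<lambda>x. cmod (c x) * q k (f x - l) + cmod (c x - c0) * q k l) \<longlongrightarrow> 0) F"
    by simp
  have le: "q k (s (c x) (f x) - s c0 l) \<le> cmod (c x) * q k (f x - l) + cmod (c x - c0) * q k l" for x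
  proof -
    have "s (c x) (f x) - s c0 l = s (c x) (f x - l) + s (c x - c0) l"
      by (simp add: scale_right_diff_distrib scale_left_diff_distrib)
    then show ?thesis using q_triangle by (metis q_scale)
  qed
  show "((\<lambda>x. q k (s (c x) (f x) - s c0 l)) \<longlongrightarrow> 0) F"
    by (rule tendsto_sandwich[OF _ _ tendsto_const lim]) (simp_all add: q_nonneg le)
qed

text \<open>Bisection replaces Hahn--Banach in this mean value inequality.\<close>

lemma seminorm_mean_value:
  fixes h h' :: "real \<Rightarrow> 'v"
  assumes "a \<le> b" and "e > 0"
    and deriv: "\<And>x. a \<le> x \<Longrightarrow> x \<le> b
      \<Longrightarrow> ((\<lambda>t. s (complex_of_real (1 / t)) (h (x + t) - h x)) \<longlongrightarrow> h' x) (at 0)"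
    and bound: "\<And>x. a \<le> x \<Longrightarrow> x \<le> b \<Longrightarrow> q k (h' x - c) \<le> e"
  shows "q k (h b - h a - s (complex_of_real (b - a)) c) \<le> 2 * e * (b - a)"
proof -
  define R where "R x y = h y - h x - s (complex_of_real (y - x)) c" for x y
  have R_add: "R x z = R x y + R y z" for x y z
    by (simp add: R_def scale_left_diff_distrib)
  have R_swap: "R x y = - R y x" for x y
    by (simp add: R_def scale_left_diff_distrib)
  have "q k (R a b) \<le> 2 * e * (b - a)"
    using \<open>a \<le> b\<close>
  proof (induct rule: Bolzano)
    case (trans a b c)
    then show ?case using q_triangle[of k "R a b" "R b c"] R_add[of a c b] by (simp add: algebra_simps)
  next
    case (local x)
    have "((\<lambda>t. q k (s (complex_of_real (1 / t)) (h (x + t) - h x) - h' x)) \<longlongrightarrow> 0) (at 0)"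
      using deriv[OF local] unfolding tendsto_iff_q by blast
    then have "\<forall>\<^sub>F t in at 0. q k (s (complex_of_real (1 / t)) (h (x + t) - h x) - h' x) < e"
      using \<open>e > 0\<close> by (rule order_tendstoD)
    then obtain d where "d > 0" and
      d: "\<And>t. t \<noteq> 0 \<Longrightarrow> \<bar>t\<bar> < d \<Longrightarrow> q k (s (complex_of_real (1 / t)) (h (x + t) - h x) - h' x) < e"
      unfolding eventually_at by (auto simp: dist_norm)
    \<comment> \<open>The quotient is within \<open>e\<close> of \<open>h' x\<close>, which is
      within \<open>e\<close> of \<open>c\<close>; hence the factor 2.\<close>
    have near: "q k (R x (x + t)) \<le> 2 * e * \<bar>t\<bar>" if "\<bar>t\<bar> < d" for t
    proof (cases "t = 0")
      case True then show ?thesis by (simp add: R_def)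
    next
      case False
      let ?D = "s (complex_of_real (1 / t)) (h (x + t) - h x)"
      have "R x (x + t) = s (complex_of_real t) ((?D - h' x) + (h' x - c))"
        using False by (simp add: R_def scale_right_diff_distrib)
      then have "q k (R x (x + t)) = \<bar>t\<bar> * q k ((?D - h' x) + (h' x - c))"
        by (simp only: q_scale) simp
      also have "\<dots> \<le> \<bar>t\<bar> * (e + e)"
        using d[OF False that] bound[OF local] q_triangle[of k "?D - h' x" "h' x - c"]
        by (intro mult_left_mono) auto
      finally show ?thesis by (simp add: algebra_simps)
    qed
    \<comment> \<open>On a short interval around \<open>x\<close> the error splits at
      \<open>x\<close> into two errors that both start at \<open>x\<close>.\<close>
    have "q k (R a b) \<le> 2 * e * (b - a)" if "a \<le> x" "x \<le> b" "b - a < d" for a b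
    proof -
      have "q k (R a b) \<le> q k (R x (x + (a - x))) + q k (R x (x + (b - x)))"
        using q_triangle[of k "R a x" "R x b"] R_add[of a b x] R_swap[of a x] by (simp add: q_minus)
      also have "\<dots> \<le> 2 * e * \<bar>a - x\<bar> + 2 * e * \<bar>b - x\<bar>"
        using that by (intro add_mono near) auto
      also have "\<dots> = 2 * e * (b - a)" using that by (simp add: algebra_simps)
      finally show ?thesis .
    qed
    then show ?case using \<open>d > 0\<close> by blast
  qed
  then show ?thesis by (simp add: R_def)
qed

end

lemma frechet_space_seminorms:
  fixes s :: "complex \<Rightarrow> 'v \<Rightarrow> 'v::{topological_ab_group_add, t2_space}"
  assumes "frechet_space s"
  obtains q where "frechet_seminorms s q"
proof -
  obtain q :: "nat \<Rightarrow> 'v \<Rightarrow> real" where "vector_space s" and q: "\<forall>k. cseminorm s (q k)" "\<forall>x. (\<forall>k. q k x = 0) \<longrightarrow> x = 0"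
    "\<forall>U. open U \<longleftrightarrow> (\<forall>x\<in>U. \<exists>k. \<exists>e>0. {y. \<forall>j\<le>k. q j (y - x) < e} \<subseteq> U)"
    using assms unfolding frechet_space_def by (elim conjE exE) (rule that; assumption)
  then have "frechet_seminorms s q"
    unfolding frechet_seminorms_def by (intro conjI allI impI) (simp_all del: open_subset)
  then show thesis by (rule that)
qed

section \<open>One-parameter subgroups\<close>

lemma bounded_bilinear_matrix_mult:
  "bounded_bilinear ((**) :: real^'k^'m \<Rightarrow> real^'n^'k \<Rightarrow> real^'n^'m)"
proof -
  have "bilinear ((**) :: real^'k^'m \<Rightarrow> real^'n^'k \<Rightarrow> real^'n^'m)"
    unfolding bilinear_def linear_iff
    by (auto simp: matrix_matrix_mult_def vec_eq_iff sum.distrib algebra_simps sum_distrib_left)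
  then show ?thesis by (simp add: bilinear_conv_bounded_bilinear)
qed

locale reductive =
  fixes G :: "('g, 'z) monoid_scheme" and \<T> :: "'g topology" and p :: "'g \<Rightarrow> real^'n^'n"
  assumes reductive: "real_reductive_group G \<T> p"
begin

sublocale group G
  using reductive by (simp add: real_reductive_group_def topological_grp_def)

lemma topspace: "topspace \<T> = carrier G"
  using reductive by (simp add: real_reductive_group_def topological_grp_def)

lemma continuous_mult:
  assumes "continuous_map X \<T> f" "continuous_map X \<T> g"
  shows "continuous_map X \<T> (\<lambda>x. f x \<otimes>\<^bsub>G\<^esub> g x)"
proof -
  have "continuous_map X (prod_topology \<T> \<T>) (\<lambda>x. (f x, g x))"
    using assms by (simp add: continuous_map_pairedI)
  moreover have "continuous_map (prod_topology \<T> \<T>) \<T> (\<lambda>(x, y). x \<otimes>\<^bsub>G\<^esub> y)"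
    using reductive by (simp add: real_reductive_group_def topological_grp_def)
  ultimately have "continuous_map X \<T> ((\<lambda>(x, y). x \<otimes>\<^bsub>G\<^esub> y) \<circ> (\<lambda>x. (f x, g x)))"
    by (rule continuous_map_compose)
  then show ?thesis by (simp add: o_def)
qed

lemma continuous_inv:
  assumes "continuous_map X \<T> f"
  shows "continuous_map X \<T> (\<lambda>x. inv\<^bsub>G\<^esub> f x)"
proof -
  have "continuous_map \<T> \<T> (\<lambda>x. inv\<^bsub>G\<^esub> x)"
    using reductive by (simp add: real_reductive_group_def topological_grp_def)
  then show ?thesis using continuous_map_compose[OF assms] by (simp add: o_def)
qed

lemma p_mult: "x \<in> carrier G \<Longrightarrow> y \<in> carrier G \<Longrightarrow> p (x \<otimes>\<^bsub>G\<^esub> y) = p x ** p y"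
  using reductive by (simp add: real_reductive_group_def)

lemma p_invertible: "x \<in> carrier G \<Longrightarrow> invertible (p x)"
proof -
  assume x: "x \<in> carrier G"
  obtain R where R: "symmetric_algebraic_group R" "openin (top_of_set R) (p ` carrier G)"
    using reductive by (auto simp: real_reductive_group_def)
  then have "p x \<in> R" using x openin_imp_subset by blast
  then show ?thesis using R(1) by (auto simp: symmetric_algebraic_group_def)
qed

lemma p_one [simp]: "p \<one>\<^bsub>G\<^esub> = mat 1"
proof -
  obtain B where B: "B ** p \<one>\<^bsub>G\<^esub> = mat 1" using p_invertible[of "\<one>\<^bsub>G\<^esub>"] invertible_def by auto
  have "p \<one>\<^bsub>G\<^esub> ** p \<one>\<^bsub>G\<^esub> = p \<one>\<^bsub>G\<^esub>" using p_mult[of "\<one>\<^bsub>G\<^esub>" "\<one>\<^bsub>G\<^esub>"] by simp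
  then have "B ** (p \<one>\<^bsub>G\<^esub> ** p \<one>\<^bsub>G\<^esub>) = B ** p \<one>\<^bsub>G\<^esub>" by simp
  then show ?thesis by (simp add: B matrix_mul_assoc)
qed

lemma one_param_carrier: "one_param G \<T> \<gamma> \<Longrightarrow> \<gamma> t \<in> carrier G"
  unfolding one_param_def using topspace continuous_map_image_subset_topspace[of euclidean \<T> \<gamma>] by auto

lemma one_param_zero: "one_param G \<T> \<gamma> \<Longrightarrow> \<gamma> 0 = \<one>\<^bsub>G\<^esub>"
proof -
  assume o: "one_param G \<T> \<gamma>"
  then have "\<gamma> (0 + 0) = \<gamma> 0 \<otimes>\<^bsub>G\<^esub> \<gamma> 0" unfolding one_param_def by blast
  then show ?thesis using one_param_carrier[OF o, of 0] by simp
qed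

lemma one_param_minus:
  assumes "one_param G \<T> \<gamma>" shows "\<gamma> (- t) = inv\<^bsub>G\<^esub> (\<gamma> t)"
proof -
  have "\<gamma> (- t) \<otimes>\<^bsub>G\<^esub> \<gamma> t = \<one>\<^bsub>G\<^esub>"
    using assms one_param_zero[OF assms] unfolding one_param_def by (metis add.left_inverse)
  then show ?thesis using inv_equality one_param_carrier[OF assms] by metis
qed

lemma p_one_param_add: "one_param G \<T> \<gamma> \<Longrightarrow> p (\<gamma> (s + t)) = p (\<gamma> s) ** p (\<gamma> t)"
  using p_mult one_param_carrier by (simp add: one_param_def)

lemma velocity_one_param: "has_velocity G \<T> p \<gamma> X \<Longrightarrow> one_param G \<T> \<gamma>"
  by (simp add: has_velocity_def)

lemma velocity_deriv:
  assumes "has_velocity G \<T> p \<gamma> X"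
  shows "((\<lambda>t. p (\<gamma> t)) has_vector_derivative p (\<gamma> t) ** X) (at t)"
    and "((\<lambda>t. p (\<gamma> t)) has_vector_derivative X ** p (\<gamma> t)) (at t)"
proof -
  have d: "((\<lambda>u. p (\<gamma> u)) has_vector_derivative X) (at (t - t))"
    using assms by (simp add: has_velocity_def)
  have sh: "((\<lambda>u::real. u - t) has_vector_derivative 1) (at t)"
    by (auto intro!: derivative_eq_intros)
  have d': "((\<lambda>u. p (\<gamma> (u - t))) has_vector_derivative X) (at t)"
    using vector_diff_chain_at[OF sh d] by (simp add: o_def)
  interpret bounded_bilinear "(**) :: real^'n^'n \<Rightarrow> real^'n^'n \<Rightarrow> real^'n^'n"
    by (rule bounded_bilinear_matrix_mult)
  have eq: "p (\<gamma> u) = p (\<gamma> t) ** p (\<gamma> (u - t))" "p (\<gamma> u) = p (\<gamma> (u - t)) ** p (\<gamma> t)" for u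
    using p_one_param_add[OF velocity_one_param[OF assms], of t "u - t"]
      p_one_param_add[OF velocity_one_param[OF assms], of "u - t" t] by simp_all
  have "((\<lambda>u. p (\<gamma> t) ** p (\<gamma> (u - t))) has_vector_derivative p (\<gamma> t) ** X) (at t)"
    by (rule bounded_linear.has_vector_derivative[OF bounded_linear_right d'])
  then show "((\<lambda>t. p (\<gamma> t)) has_vector_derivative p (\<gamma> t) ** X) (at t)"
    unfolding eq(1)[symmetric] .
  have "((\<lambda>u. p (\<gamma> (u - t)) ** p (\<gamma> t)) has_vector_derivative X ** p (\<gamma> t)) (at t)"
    by (rule bounded_linear.has_vector_derivative[OF bounded_linear_left d'])
  then show "((\<lambda>t. p (\<gamma> t)) has_vector_derivative X ** p (\<gamma> t)) (at t)"
    unfolding eq(2)[symmetric] .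
qed

lemma velocity_deriv_minus:
  assumes "has_velocity G \<T> p \<gamma> X"
  shows "((\<lambda>t. p (\<gamma> (- t))) has_vector_derivative - (X ** p (\<gamma> (- t)))) (at t)"
proof -
  have "((\<lambda>u::real. - u) has_vector_derivative -1) (at t)"
    by (auto intro!: derivative_eq_intros)
  from vector_diff_chain_at[OF this velocity_deriv(2)[OF assms]]
  show ?thesis by (simp add: o_def)
qed

text \<open>By the product rule \<open>p (\<gamma> t) ** p (\<kappa> (- t))\<close> has derivative
  zero, so \<open>\<gamma>\<close> and \<open>\<kappa>\<close> differ by a continuous curve in the
  finite kernel of \<open>p\<close>; as the line is connected, this curve is constant.\<close>

lemma velocity_unique:
  assumes g: "has_velocity G \<T> p \<gamma> X" and k: "has_velocity G \<T> p \<kappa> X"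
  shows "\<gamma> = \<kappa>"
proof -
  have og: "one_param G \<T> \<gamma>" and ok: "one_param G \<T> \<kappa>" using g k by (auto simp: has_velocity_def)
  interpret bounded_bilinear "(**) :: real^'n^'n \<Rightarrow> real^'n^'n \<Rightarrow> real^'n^'n"
    by (rule bounded_bilinear_matrix_mult)
  have "((\<lambda>t. p (\<gamma> t) ** p (\<kappa> (- t))) has_vector_derivative
      p (\<gamma> t) ** - (X ** p (\<kappa> (- t))) + (p (\<gamma> t) ** X) ** p (\<kappa> (- t))) (at t)" for t
    by (rule has_vector_derivative[OF velocity_deriv(1)[OF g] velocity_deriv_minus[OF k]])
  moreover have "p (\<gamma> t) ** - (X ** p (\<kappa> (- t))) + (p (\<gamma> t) ** X) ** p (\<kappa> (- t)) = 0" for t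
    by (simp add: minus_right matrix_mul_assoc)
  ultimately have "((\<lambda>t. p (\<gamma> t) ** p (\<kappa> (- t))) has_vector_derivative 0) (at t within UNIV)" for t
    by simp
  then obtain C where C: "p (\<gamma> t) ** p (\<kappa> (- t)) = C" for t
    using has_vector_derivative_zero_constant[of UNIV "\<lambda>t. p (\<gamma> t) ** p (\<kappa> (- t))"]
    by (metis UNIV_I convex_UNIV)
  have "C = mat 1" using C[of 0] one_param_zero[OF og] one_param_zero[OF ok] by simp
  define \<theta> where "\<theta> t = \<gamma> t \<otimes>\<^bsub>G\<^esub> \<kappa> (- t)" for t
  define K where "K = {x \<in> carrier G. p x = mat 1}"
  have "finite K" using reductive by (simp add: real_reductive_group_def K_def)
  have \<theta>K: "\<theta> t \<in> K" for t
    using C[of t] \<open>C = mat 1\<close> p_mult one_param_carrier[OF og] one_param_carrier[OF ok]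
    by (simp add: K_def \<theta>_def)
  have cont: "continuous_map euclidean \<T> \<theta>"
    unfolding \<theta>_def one_param_minus[OF ok]
    using og ok by (intro continuous_mult continuous_inv) (simp_all add: one_param_def)
  have closed: "closed {t. \<theta> t = x}" if "x \<in> K" for x
  proof -
    have "closedin \<T> {x}"
      using reductive that topspace
      by (intro closedin_Hausdorff_singleton) (simp_all add: real_reductive_group_def K_def)
    from closedin_continuous_map_preimage[OF cont this] show ?thesis by simp
  qed
  \<comment> \<open>Finitely many closed fibres: the set where \<open>\<theta>\<close> is the unit
    is closed and has a closed complement.\<close>
  have "{t. \<theta> t \<noteq> \<one>\<^bsub>G\<^esub>} = (\<Union>x\<in>K - {\<one>\<^bsub>G\<^esub>}. {t. \<theta> t = x})" using \<theta>K by auto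
  moreover have "closed (\<Union>x\<in>K - {\<one>\<^bsub>G\<^esub>}. {t. \<theta> t = x})"
    using \<open>finite K\<close> closed by (intro closed_UN) auto
  ultimately have "closed (- {t. \<theta> t = \<one>\<^bsub>G\<^esub>})" by (simp add: Collect_neg_eq)
  moreover have "closed {t. \<theta> t = \<one>\<^bsub>G\<^esub>}" by (rule closed) (simp add: K_def)
  moreover have "\<theta> 0 = \<one>\<^bsub>G\<^esub>"
    by (simp add: \<theta>_def one_param_zero[OF og] one_param_zero[OF ok])
  ultimately have "{t. \<theta> t = \<one>\<^bsub>G\<^esub>} = UNIV"
    using clopen[of "{t. \<theta> t = \<one>\<^bsub>G\<^esub>}"] by (auto simp: open_closed)
  then have \<theta>1: "\<theta> t = \<one>\<^bsub>G\<^esub>" for t by auto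
  show ?thesis
  proof
    fix t
    have "\<gamma> t \<otimes>\<^bsub>G\<^esub> inv\<^bsub>G\<^esub> (\<kappa> t) = \<one>\<^bsub>G\<^esub>"
      using \<theta>1[of t] by (simp add: \<theta>_def one_param_minus[OF ok])
    then show "\<gamma> t = \<kappa> t"
      using inv_equality[of "\<gamma> t" "inv\<^bsub>G\<^esub> (\<kappa> t)"] one_param_carrier[OF og] one_param_carrier[OF ok]
      by simp
  qed
qed

lemma exp_curve: "X \<in> lie_alg G \<T> p \<Longrightarrow> has_velocity G \<T> p (exp_curve G \<T> p X) X"
  using someI_ex[of "\<lambda>\<gamma>. has_velocity G \<T> p \<gamma> X"] by (simp add: lie_alg_def exp_curve_def)

text \<open>Frees \<open>exp_curve\<close> from the choice made by \<open>SOME\<close>: identities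
  between exponentials reduce to exhibiting a one-parameter subgroup with the right
  velocity.\<close>

lemma exp_curve_eq: "has_velocity G \<T> p \<gamma> X \<Longrightarrow> exp_curve G \<T> p X = \<gamma>"
  using velocity_unique exp_curve unfolding lie_alg_def by blast

lemma lie_algI: "has_velocity G \<T> p \<gamma> X \<Longrightarrow> X \<in> lie_alg G \<T> p"
  by (auto simp: lie_alg_def)

lemma velocity_scale:
  assumes "has_velocity G \<T> p \<gamma> X" shows "has_velocity G \<T> p (\<lambda>t. \<gamma> (r * t)) (r *\<^sub>R X)"
proof -
  have "one_param G \<T> \<gamma>" using assms by (simp add: has_velocity_def)
  moreover have "continuous_map euclidean euclidean (\<lambda>t. r * t)"
    by (auto intro!: continuous_intros)
  then have "continuous_map euclidean \<T> (\<gamma> \<circ> (\<lambda>t. r * t))"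
    using \<open>one_param G \<T> \<gamma>\<close> continuous_map_compose unfolding one_param_def by blast
  ultimately have "one_param G \<T> (\<lambda>t. \<gamma> (r * t))"
    unfolding one_param_def by (simp add: o_def distrib_left)
  moreover have "((\<lambda>t. p (\<gamma> (r * t))) has_vector_derivative r *\<^sub>R X) (at 0)"
  proof -
    have r: "((\<lambda>t. r * t) has_vector_derivative r) (at 0)"
      by (rule has_vector_derivative_eq_rhs, rule derivative_intros, rule derivative_intros) simp
    have "((\<lambda>t. p (\<gamma> t)) has_vector_derivative X) (at (r * 0))"
      using assms by (simp add: has_velocity_def)
    from vector_diff_chain_at[OF r this] show ?thesis by (simp add: o_def)
  qed
  ultimately show ?thesis by (simp add: has_velocity_def)
qed

lemma lie_alg_scale: "X \<in> lie_alg G \<T> p \<Longrightarrow> r *\<^sub>R X \<in> lie_alg G \<T> p"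
  using velocity_scale[OF exp_curve] lie_algI by blast

lemma exp_curve_scale:
  "X \<in> lie_alg G \<T> p \<Longrightarrow> exp_curve G \<T> p (r *\<^sub>R X) = (\<lambda>t. exp_curve G \<T> p X (r * t))"
  by (rule exp_curve_eq[OF velocity_scale[OF exp_curve]])

lemma velocity_zero: "has_velocity G \<T> p (\<lambda>_. \<one>\<^bsub>G\<^esub>) 0"
  by (auto simp: has_velocity_def one_param_def topspace)

lemma velocity_conj:
  assumes v: "has_velocity G \<T> p \<gamma> X" and g: "g \<in> carrier G"
  shows "has_velocity G \<T> p (\<lambda>t. g \<otimes>\<^bsub>G\<^esub> \<gamma> t \<otimes>\<^bsub>G\<^esub> inv\<^bsub>G\<^esub> g) (p g ** X ** p (inv\<^bsub>G\<^esub> g))"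
proof -
  have o: "one_param G \<T> \<gamma>" using v by (simp add: has_velocity_def)
  note c = one_param_carrier[OF o]
  have "g \<otimes>\<^bsub>G\<^esub> (\<gamma> s \<otimes>\<^bsub>G\<^esub> \<gamma> t) \<otimes>\<^bsub>G\<^esub> inv\<^bsub>G\<^esub> g
      = (g \<otimes>\<^bsub>G\<^esub> \<gamma> s \<otimes>\<^bsub>G\<^esub> inv\<^bsub>G\<^esub> g) \<otimes>\<^bsub>G\<^esub> (g \<otimes>\<^bsub>G\<^esub> \<gamma> t \<otimes>\<^bsub>G\<^esub> inv\<^bsub>G\<^esub> g)" for s t
  proof -
    have "inv\<^bsub>G\<^esub> g \<otimes>\<^bsub>G\<^esub> (g \<otimes>\<^bsub>G\<^esub> z) = z" if "z \<in> carrier G" for z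
      using g that by (simp flip: m_assoc)
    then show ?thesis using g c[of s] c[of t] by (simp add: m_assoc)
  qed
  moreover have "continuous_map euclidean \<T> (\<lambda>t. g \<otimes>\<^bsub>G\<^esub> \<gamma> t \<otimes>\<^bsub>G\<^esub> inv\<^bsub>G\<^esub> g)"
    using o g by (intro continuous_mult) (auto simp: one_param_def topspace)
  ultimately have "one_param G \<T> (\<lambda>t. g \<otimes>\<^bsub>G\<^esub> \<gamma> t \<otimes>\<^bsub>G\<^esub> inv\<^bsub>G\<^esub> g)"
    using o by (auto simp: one_param_def)
  moreover have "((\<lambda>t. p (g \<otimes>\<^bsub>G\<^esub> \<gamma> t \<otimes>\<^bsub>G\<^esub> inv\<^bsub>G\<^esub> g)) has_vector_derivative
      p g ** X ** p (inv\<^bsub>G\<^esub> g)) (at 0)"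
  proof -
    interpret bounded_bilinear "(**) :: real^'n^'n \<Rightarrow> real^'n^'n \<Rightarrow> real^'n^'n"
      by (rule bounded_bilinear_matrix_mult)
    have "((\<lambda>t. p (\<gamma> t)) has_vector_derivative X) (at 0)" using v by (simp add: has_velocity_def)
    then have "((\<lambda>t. p g ** p (\<gamma> t) ** p (inv\<^bsub>G\<^esub> g)) has_vector_derivative
        p g ** X ** p (inv\<^bsub>G\<^esub> g)) (at 0)"
      by (intro bounded_linear.has_vector_derivative[OF bounded_linear_left]
          bounded_linear.has_vector_derivative[OF bounded_linear_right])
    then show ?thesis using g c by (simp add: p_mult)
  qed
  ultimately show ?thesis by (simp add: has_velocity_def)
qed

end

section \<open>The differential of a smooth representation\<close>

text \<open>Lets an operator that depends linearly on a moving Lie algebra element be written as a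
  finite sum of fixed operators, with inner products as coefficients.\<close>

lemma subspace_orthonormal_expansion:
  fixes S :: "'a::euclidean_space set"
  assumes "subspace S"
  obtains B where "finite B" "B \<subseteq> S" "\<And>x. x \<in> S \<Longrightarrow> (\<Sum>b\<in>B. (x \<bullet> b) *\<^sub>R b) = x"
proof -
  obtain B where B: "B \<subseteq> S" "pairwise orthogonal B" "\<And>x. x \<in> B \<Longrightarrow> norm x = 1" "independent B" "span B = S"
    using orthonormal_basis_subspace[OF assms] by metis
  have fin: "finite B" using B(4) by (rule independent_imp_finite)
  have "(\<Sum>b\<in>B. (x \<bullet> b) *\<^sub>R b) = x" if x: "x \<in> S" for x
  proof -
    obtain c where c: "x = (\<Sum>b\<in>B. c b *\<^sub>R b)"
      using x B(5) span_finite[OF fin] by auto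
    have "x \<bullet> b = c b" if "b \<in> B" for b
    proof -
      have "x \<bullet> b = (\<Sum>a\<in>B. c a * (a \<bullet> b))" by (simp add: c inner_sum_left)
      also have "\<dots> = (\<Sum>a\<in>B. if a = b then c b else 0)"
        using that B(2,3) by (intro sum.cong) (auto simp: pairwise_def orthogonal_def dot_square_norm)
      finally show ?thesis using that fin by simp
    qed
    then show ?thesis using c by simp
  qed
  then show thesis using that fin B(1) by blast
qed

text \<open>As \<open>lie_alg\<close> is a set of velocities, the subspace property is an assumption
  here; \<open>lie_alg_closed\<close> supplies it later from the isomorphism with o(4,C).\<close>

locale smooth_rep = reductive G \<T> p
  for G :: "('g, 'z) monoid_scheme" and \<T> :: "'g topology" and p :: "'g \<Rightarrow> real^'n^'n" +
  fixes s :: "complex \<Rightarrow> 'v \<Rightarrow> 'v::{topological_ab_group_add, t2_space}"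
    and \<Phi> :: "'g \<Rightarrow> 'v \<Rightarrow> 'v"
  assumes smooth: "smooth_frechet_rep G \<T> p s \<Phi>"
    and subspace_lie_alg: "subspace (lie_alg G \<T> p)"
begin

abbreviation "\<gg> \<equiv> lie_alg G \<T> p"
abbreviation "D \<equiv> deriv_rep G \<T> p s \<Phi>"
abbreviation "e \<equiv> exp_curve G \<T> p"

sublocale vector_space s
  using smooth by (simp add: smooth_frechet_rep_def frechet_space_def)

lemma \<Phi>_linear: "g \<in> carrier G \<Longrightarrow> Vector_Spaces.linear s s (\<Phi> g)"
  using smooth by (simp add: smooth_frechet_rep_def continuous_rep_def)

lemma \<Phi>_diff: "g \<in> carrier G \<Longrightarrow> \<Phi> g (u - v) = \<Phi> g u - \<Phi> g v"
  using Vector_Spaces.linear.axioms(3)[OF \<Phi>_linear] by (rule module_hom.diff)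

lemma \<Phi>_add: "g \<in> carrier G \<Longrightarrow> \<Phi> g (u + v) = \<Phi> g u + \<Phi> g v"
  using Vector_Spaces.linear.axioms(3)[OF \<Phi>_linear] by (rule module_hom.add)

lemma \<Phi>_scale: "g \<in> carrier G \<Longrightarrow> \<Phi> g (s c u) = s c (\<Phi> g u)"
  using Vector_Spaces.linear.axioms(3)[OF \<Phi>_linear] by (rule module_hom.scale)

lemma \<Phi>_one [simp]: "\<Phi> \<one>\<^bsub>G\<^esub> u = u"
  using smooth by (simp add: smooth_frechet_rep_def continuous_rep_def)

lemma \<Phi>_mult: "g \<in> carrier G \<Longrightarrow> h \<in> carrier G \<Longrightarrow> \<Phi> (g \<otimes>\<^bsub>G\<^esub> h) u = \<Phi> g (\<Phi> h u)"
  using smooth by (simp add: smooth_frechet_rep_def continuous_rep_def)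

lemma \<Phi>_continuous:
  assumes "g \<in> carrier G" shows "continuous_on UNIV (\<Phi> g)"
proof -
  have c: "continuous_map (prod_topology \<T> euclidean) euclidean (\<lambda>(g, v). \<Phi> g v)"
    using smooth by (simp add: smooth_frechet_rep_def continuous_rep_def)
  have "continuous_map euclidean (prod_topology \<T> euclidean) (\<lambda>v::'v. (g, v))"
    using assms topspace by (intro continuous_map_pairedI) auto
  from continuous_map_compose[OF this c] show ?thesis by (simp add: o_def)
qed

lemma \<Phi>_tendsto: "g \<in> carrier G \<Longrightarrow> (f \<longlongrightarrow> l) F \<Longrightarrow> ((\<lambda>x. \<Phi> g (f x)) \<longlongrightarrow> \<Phi> g l) F"
  using \<Phi>_continuous continuous_on_tendsto_compose[of UNIV "\<Phi> g" f l F] by auto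

lemma D_tendsto: "X \<in> \<gg> \<Longrightarrow> (f \<longlongrightarrow> l) F \<Longrightarrow> ((\<lambda>x. D X (f x)) \<longlongrightarrow> D X l) F"
  using smooth continuous_on_tendsto_compose[of UNIV "D X" f l F]
  by (auto simp: smooth_frechet_rep_def)

lemma e_carrier: "X \<in> \<gg> \<Longrightarrow> e X t \<in> carrier G"
  using exp_curve velocity_one_param one_param_carrier by blast

lemma e_zero: "X \<in> \<gg> \<Longrightarrow> e X 0 = \<one>\<^bsub>G\<^esub>"
  using exp_curve velocity_one_param one_param_zero by blast

lemma e_scale: "X \<in> \<gg> \<Longrightarrow> e (t *\<^sub>R X) 1 = e X t"
  by (simp add: exp_curve_scale)

lemma zero_in_lie_alg: "0 \<in> \<gg>"
  using subspace_lie_alg by (rule real_vector.subspace_0)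

lemma lie_alg_add: "X \<in> \<gg> \<Longrightarrow> Y \<in> \<gg> \<Longrightarrow> X + Y \<in> \<gg>"
  using subspace_lie_alg by (rule real_vector.subspace_add)

lemma chart:
  obtains U where "openin (top_of_set \<gg>) U" "0 \<in> U"
    "\<And>k. Ck_on s \<gg> U k (\<lambda>X. \<Phi> (\<one>\<^bsub>G\<^esub> \<otimes>\<^bsub>G\<^esub> e X 1) u)"
proof -
  have "smooth_vector G \<T> p s \<Phi> u" using smooth by (simp add: smooth_frechet_rep_def)
  then have "\<exists>U. openin (top_of_set \<gg>) U \<and> 0 \<in> U \<and>
      (\<forall>k. Ck_on s \<gg> U k (\<lambda>X. \<Phi> (\<one>\<^bsub>G\<^esub> \<otimes>\<^bsub>G\<^esub> e X 1) u))"
    unfolding smooth_vector_def using one_closed by (rule bspec)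
  then show thesis using that by metis
qed

lemma e_0: "e 0 = (\<lambda>_. \<one>\<^bsub>G\<^esub>)"
  by (rule exp_curve_eq[OF velocity_zero])

text \<open>\<open>deriv_rep\<close> is a \<open>Lim\<close>, so convergence has to be known first.
  It comes from the chart at the unit: its derivative at 0 in direction X is taken along
  \<open>e (t *\<^sub>R X) 1 = e X t\<close>.\<close>

lemma D_lim:
  assumes X: "X \<in> \<gg>"
  shows "((\<lambda>t::real. s (complex_of_real (1 / t)) (\<Phi> (e X t) u - u)) \<longlongrightarrow> D X u) (at 0)"
proof -
  obtain U where U: "0 \<in> U" "\<And>k. Ck_on s \<gg> U k (\<lambda>X. \<Phi> (\<one>\<^bsub>G\<^esub> \<otimes>\<^bsub>G\<^esub> e X 1) u)"
    using chart[of u] by blast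
  have "Ck_on s \<gg> U (Suc 0) (\<lambda>X. \<Phi> (\<one>\<^bsub>G\<^esub> \<otimes>\<^bsub>G\<^esub> e X 1) u)" by (rule U(2))
  then obtain f' where "\<forall>x\<in>U. ((\<lambda>t::real. s (complex_of_real (1 / t))
      (\<Phi> (\<one>\<^bsub>G\<^esub> \<otimes>\<^bsub>G\<^esub> e (x + t *\<^sub>R X) 1) u - \<Phi> (\<one>\<^bsub>G\<^esub> \<otimes>\<^bsub>G\<^esub> e x 1) u)) \<longlongrightarrow> f' x) (at 0)"
    unfolding Ck_on.simps using X by blast
  then have f': "((\<lambda>t::real. s (complex_of_real (1 / t))
      (\<Phi> (\<one>\<^bsub>G\<^esub> \<otimes>\<^bsub>G\<^esub> e (0 + t *\<^sub>R X) 1) u - \<Phi> (\<one>\<^bsub>G\<^esub> \<otimes>\<^bsub>G\<^esub> e 0 1) u)) \<longlongrightarrow> f' 0) (at 0)"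
    using U(1) by (rule bspec)
  then have *: "((\<lambda>t::real. s (complex_of_real (1 / t)) (\<Phi> (e X t) u - u)) \<longlongrightarrow> f' 0) (at 0)"
    using X by (simp add: e_scale e_0 e_carrier)
  then show ?thesis unfolding deriv_rep_def using tendsto_Lim[OF _ *] by simp
qed

lemma D_unique:
  assumes "X \<in> \<gg>" "((\<lambda>t::real. s (complex_of_real (1 / t)) (\<Phi> (e X t) u - u)) \<longlongrightarrow> l) (at 0)"
  shows "D X u = l"
  using tendsto_unique[OF _ D_lim[OF assms(1)] assms(2)] by simp

lemma D_add_vec:
  assumes "X \<in> \<gg>" shows "D X (u + v) = D X u + D X v"
proof (rule D_unique[OF assms])
  show "((\<lambda>t. s (complex_of_real (1 / t)) (\<Phi> (e X t) (u + v) - (u + v))) \<longlongrightarrow> D X u + D X v) (at 0)"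
    using tendsto_add[OF D_lim[OF assms, of u] D_lim[OF assms, of v]]
    by (simp add: \<Phi>_add e_carrier[OF assms] algebra_simps)
qed

lemma D_diff_vec: "X \<in> \<gg> \<Longrightarrow> D X (u - v) = D X u - D X v"
  using D_add_vec[of X "u - v" v] by simp

lemma D_scale_vec:
  assumes "X \<in> \<gg>" shows "D X (s c u) = s c (D X u)"
proof -
  obtain q where "frechet_seminorms s q"
    using smooth frechet_space_seminorms by (auto simp: smooth_frechet_rep_def)
  then interpret frechet_seminorms s q .
  show ?thesis
  proof (rule D_unique[OF assms])
    show "((\<lambda>t. s (complex_of_real (1 / t)) (\<Phi> (e X t) (s c u) - s c u)) \<longlongrightarrow> s c (D X u)) (at 0)"
      using tendsto_scale[OF tendsto_const D_lim[OF assms, of u], of c]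
      by (simp add: \<Phi>_scale e_carrier[OF assms] scale_right_diff_distrib mult.commute)
  qed
qed

text \<open>The quotient for \<open>X + Y\<close> is split along the path 0, tX, tX + tY. The first
  leg gives \<open>D X u\<close>. On the second leg the Y-derivative \<open>f'\<close> stays near
  \<open>f' 0 = D Y u\<close> by continuity, and the mean value inequality passes this on to the
  quotient.\<close>

lemma D_add:
  assumes X: "X \<in> \<gg>" and Y: "Y \<in> \<gg>"
  shows "D (X + Y) u = D X u + D Y u"
proof -
  obtain q where "frechet_seminorms s q"
    using smooth frechet_space_seminorms by (auto simp: smooth_frechet_rep_def)
  then interpret frechet_seminorms s q .
  have XY: "X + Y \<in> \<gg>" using X Y by (rule lie_alg_add)
  obtain U where Uo: "openin (top_of_set \<gg>) U" and U: "0 \<in> U" "\<And>k. Ck_on s \<gg> U k (\<lambda>X. \<Phi> (\<one>\<^bsub>G\<^esub> \<otimes>\<^bsub>G\<^esub> e X 1) u)"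
    using chart[of u] by blast
  define F where "F Z = \<Phi> (\<one>\<^bsub>G\<^esub> \<otimes>\<^bsub>G\<^esub> e Z 1) u" for Z
  have F0: "F 0 = u" by (simp add: F_def e_0)
  have F_scale: "F (t *\<^sub>R Z) = \<Phi> (e Z t) u" if "Z \<in> \<gg>" for t Z
    using that by (simp add: F_def e_scale e_carrier)
  have "Ck_on s \<gg> U (Suc 0) F" unfolding F_def by (rule U(2))
  then obtain f' where f'_lim: "\<forall>x\<in>U. ((\<lambda>t::real. s (complex_of_real (1 / t))
      (F (x + t *\<^sub>R Y) - F x)) \<longlongrightarrow> f' x) (at 0)" and cont: "continuous_on U f'"
    unfolding Ck_on.simps using Y by blast
  note f' = bspec[OF f'_lim]
  have f'0: "f' 0 = D Y u"
    using f'[OF U(1)] by (intro D_unique[OF Y, symmetric]) (simp add: F0 F_scale Y)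
  \<comment> \<open>Limits from the right suffice by uniqueness, and let the mean value inequality
    run from 0 to t > 0.\<close>
  have lim: "((\<lambda>t. s (complex_of_real (1 / t)) (F (t *\<^sub>R Z) - u)) \<longlongrightarrow> D Z u) (at_right 0)" if "Z \<in> \<gg>" for Z
    using D_lim[OF that, of u] unfolding F_scale[OF that]
    by (rule filterlim_mono) (auto simp: at_le)
  have "((\<lambda>t. s (complex_of_real (1 / t)) (F (t *\<^sub>R X + t *\<^sub>R Y) - F (t *\<^sub>R X))) \<longlongrightarrow> D Y u) (at_right 0)"
    unfolding tendsto_iff_q
  proof (intro allI tendstoI)
    fix k and \<epsilon> :: real assume "\<epsilon> > 0"
    \<comment> \<open>The mean value inequality doubles the bound, so any constant below
      \<epsilon>/2 would do.\<close>
    define \<eta> where "\<eta> = \<epsilon> / 4"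
    have "\<eta> > 0" using \<open>\<epsilon> > 0\<close> by (simp add: \<eta>_def)
    have "(f' \<longlongrightarrow> f' 0) (at 0 within U)" using cont U(1) by (auto simp: continuous_on_def)
    then have "((\<lambda>x. q k (f' x - D Y u)) \<longlongrightarrow> 0) (at 0 within U)"
      unfolding tendsto_iff_q f'0 by blast
    then have "\<forall>\<^sub>F x in at 0 within U. q k (f' x - D Y u) < \<eta>"
      using \<open>\<eta> > 0\<close> by (rule order_tendstoD)
    then obtain r1 where r1: "r1 > 0" "\<And>x. x \<in> U \<Longrightarrow> x \<noteq> 0 \<Longrightarrow> norm x < r1 \<Longrightarrow> q k (f' x - D Y u) < \<eta>"
      unfolding eventually_at by (auto simp: dist_norm)
    have r1': "q k (f' x - D Y u) \<le> \<eta>" if "x \<in> U" "norm x < r1" for x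
      using r1(2)[of x] that \<open>\<eta> > 0\<close> by (cases "x = 0") (auto simp: f'0)
    obtain r2 where r2: "r2 > 0" "\<And>x. x \<in> \<gg> \<Longrightarrow> norm x < r2 \<Longrightarrow> x \<in> U"
      using Uo U(1) unfolding openin_euclidean_subtopology_iff by (auto simp: dist_norm)
    \<comment> \<open>Keeps the whole second leg inside the chart and inside the ball of radius
      \<open>r1\<close>; the summand 1 avoids division by zero when X = Y = 0.\<close>
    define r where "r = min r1 r2 / (norm X + norm Y + 1)"
    have "r > 0" using r1 r2 by (simp add: r_def add_nonneg_pos)
    have small: "t *\<^sub>R X + v *\<^sub>R Y \<in> U" "norm (t *\<^sub>R X + v *\<^sub>R Y) < r1"
      if "0 < t" "t < r" "0 \<le> v" "v \<le> t" for t v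
    proof -
      have "norm (t *\<^sub>R X + v *\<^sub>R Y) \<le> t * norm X + v * norm Y"
        using that by (intro order_trans[OF norm_triangle_ineq]) simp
      also have "\<dots> \<le> t * (norm X + norm Y)"
        using that by (simp add: distrib_left mult_right_mono)
      also have "\<dots> < t * (norm X + norm Y + 1)" using that by simp
      also have "\<dots> < r * (norm X + norm Y + 1)"
        using that by (intro mult_strict_right_mono) (auto simp: add_nonneg_pos)
      also have "\<dots> = min r1 r2"
      proof -
        have "norm X + norm Y + 1 \<noteq> 0" using norm_ge_zero[of X] norm_ge_zero[of Y] by linarith
        then show ?thesis by (simp add: r_def)
      qed
      finally have n: "norm (t *\<^sub>R X + v *\<^sub>R Y) < min r1 r2" .
      then show "norm (t *\<^sub>R X + v *\<^sub>R Y) < r1" by simp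
      have "t *\<^sub>R X + v *\<^sub>R Y \<in> \<gg>"
        using X Y by (intro lie_alg_add lie_alg_scale)
      then show "t *\<^sub>R X + v *\<^sub>R Y \<in> U" using r2(2) n by simp
    qed
    have est: "q k (s (complex_of_real (1 / t)) (F (t *\<^sub>R X + t *\<^sub>R Y) - F (t *\<^sub>R X)) - D Y u) < \<epsilon>"
      if t: "0 < t" "t < r" for t
    proof -
      have "q k (F (t *\<^sub>R X + t *\<^sub>R Y) - F (t *\<^sub>R X + 0 *\<^sub>R Y) - s (complex_of_real (t - 0)) (D Y u)) \<le> 2 * \<eta> * (t - 0)"
      proof (rule seminorm_mean_value[where h' = "\<lambda>v. f' (t *\<^sub>R X + v *\<^sub>R Y)"])
        fix v assume v: "0 \<le> v" "v \<le> t"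
        show "((\<lambda>w. s (complex_of_real (1 / w)) (F (t *\<^sub>R X + (v + w) *\<^sub>R Y) - F (t *\<^sub>R X + v *\<^sub>R Y)))
            \<longlongrightarrow> f' (t *\<^sub>R X + v *\<^sub>R Y)) (at 0)"
          using f'[OF small(1)[OF t v]] by (simp add: scaleR_left_distrib add.assoc)
        show "q k (f' (t *\<^sub>R X + v *\<^sub>R Y) - D Y u) \<le> \<eta>" by (rule r1'[OF small[OF t v]])
      qed (use t \<open>\<eta> > 0\<close> in auto)
      then have *: "q k (F (t *\<^sub>R X + t *\<^sub>R Y) - F (t *\<^sub>R X) - s (complex_of_real t) (D Y u)) \<le> 2 * \<eta> * t"
        by simp
      have "s (complex_of_real (1 / t)) (F (t *\<^sub>R X + t *\<^sub>R Y) - F (t *\<^sub>R X)) - D Y u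
          = s (complex_of_real (1 / t)) (F (t *\<^sub>R X + t *\<^sub>R Y) - F (t *\<^sub>R X) - s (complex_of_real t) (D Y u))"
        using t by (simp add: scale_right_diff_distrib)
      then have "q k (s (complex_of_real (1 / t)) (F (t *\<^sub>R X + t *\<^sub>R Y) - F (t *\<^sub>R X)) - D Y u)
          = (1 / t) * q k (F (t *\<^sub>R X + t *\<^sub>R Y) - F (t *\<^sub>R X) - s (complex_of_real t) (D Y u))"
        using t by (simp only: q_scale) (simp add: norm_divide)
      also have "\<dots> \<le> (1 / t) * (2 * \<eta> * t)" using * t by (intro mult_left_mono) auto
      also have "\<dots> < \<epsilon>" using t \<open>\<epsilon> > 0\<close> by (simp add: \<eta>_def)
      finally show ?thesis .
    qed
    show "\<forall>\<^sub>F t in at_right 0. dist (q k (s (complex_of_real (1 / t)) (F (t *\<^sub>R X + t *\<^sub>R Y) - F (t *\<^sub>R X)) - D Y u)) 0 < \<epsilon>"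
      unfolding eventually_at_right_field
      by (intro exI[of _ r]) (use est \<open>r > 0\<close> in \<open>auto simp: q_nonneg\<close>)
  qed
  from tendsto_add[OF lim[OF X] this]
  have "((\<lambda>t. s (complex_of_real (1 / t)) (F (t *\<^sub>R (X + Y)) - u)) \<longlongrightarrow> D X u + D Y u) (at_right 0)"
    by (simp add: scaleR_right_distrib flip: scale_right_distrib)
  from tendsto_unique[OF _ lim[OF XY] this] show ?thesis by simp
qed

lemma D_scaleR:
  assumes X: "X \<in> \<gg>" shows "D (r *\<^sub>R X) u = s (complex_of_real r) (D X u)"
proof (rule D_unique)
  show "r *\<^sub>R X \<in> \<gg>" using X by (rule lie_alg_scale)
  obtain q where "frechet_seminorms s q"
    using smooth frechet_space_seminorms by (auto simp: smooth_frechet_rep_def)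
  then interpret frechet_seminorms s q .
  show "((\<lambda>t. s (complex_of_real (1 / t)) (\<Phi> (e (r *\<^sub>R X) t) u - u)) \<longlongrightarrow> s (complex_of_real r) (D X u)) (at 0)"
  proof (cases "r = 0")
    case True
    then show ?thesis by (simp add: e_0)
  next
    case False
    have "filterlim (\<lambda>t. r * t) (at 0) (at (0::real))"
      using False by (auto simp: filterlim_at eventually_at_filter intro!: tendsto_eq_intros)
    from filterlim_compose[OF D_lim[OF X, of u] this]
    have "((\<lambda>t. s (complex_of_real (1 / (r * t))) (\<Phi> (e X (r * t)) u - u)) \<longlongrightarrow> D X u) (at 0)" .
    from tendsto_scale[OF tendsto_const this, of "complex_of_real r"]
    show ?thesis using False by (simp add: exp_curve_scale[OF X])
  qed
qed

lemma D_zero [simp]: "D 0 u = 0"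
  using D_scaleR[OF zero_in_lie_alg, of 0] by simp

lemma orbit_tendsto:
  assumes X: "X \<in> \<gg>" shows "((\<lambda>t. \<Phi> (e X t) u) \<longlongrightarrow> u) (at 0)"
proof -
  obtain q where "frechet_seminorms s q"
    using smooth frechet_space_seminorms by (auto simp: smooth_frechet_rep_def)
  then interpret frechet_seminorms s q .
  have "((\<lambda>t::real. complex_of_real t) \<longlongrightarrow> 0) (at 0)" by (auto intro!: tendsto_eq_intros)
  from tendsto_add[OF tendsto_scale[OF this D_lim[OF X, of u]] tendsto_const[of u]]
  have *: "((\<lambda>t. s (complex_of_real t) (s (complex_of_real (1 / t)) (\<Phi> (e X t) u - u)) + u) \<longlongrightarrow> u) (at 0)"
    by simp
  show ?thesis
    by (rule Lim_transform_eventually[OF *]) (auto simp: eventually_at_filter)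
qed

lemma Ad_in_lie_alg:
  "X \<in> \<gg> \<Longrightarrow> g \<in> carrier G \<Longrightarrow> p g ** X ** p (inv\<^bsub>G\<^esub> g) \<in> \<gg>"
  using velocity_conj[OF exp_curve] lie_algI by blast

text \<open>Differentiates g exp(tX) = exp(t Ad(g)X) g, applied to \<open>u\<close>.\<close>

lemma \<Phi>_D:
  assumes X: "X \<in> \<gg>" and g: "g \<in> carrier G"
  shows "\<Phi> g (D X u) = D (p g ** X ** p (inv\<^bsub>G\<^esub> g)) (\<Phi> g u)"
proof (rule D_unique[OF Ad_in_lie_alg[OF X g], symmetric])
  have "\<Phi> (e (p g ** X ** p (inv\<^bsub>G\<^esub> g)) t) (\<Phi> g u) = \<Phi> g (\<Phi> (e X t) u)" for t
  proof -
    have "e (p g ** X ** p (inv\<^bsub>G\<^esub> g)) t \<otimes>\<^bsub>G\<^esub> g = g \<otimes>\<^bsub>G\<^esub> e X t"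
      using exp_curve_eq[OF velocity_conj[OF exp_curve[OF X] g]] g e_carrier[OF X, of t]
      by (simp add: m_assoc)
    then show ?thesis
      using \<Phi>_mult g e_carrier[OF X] e_carrier[OF Ad_in_lie_alg[OF X g]] by metis
  qed
  then show "((\<lambda>t. s (complex_of_real (1 / t)) (\<Phi> (e (p g ** X ** p (inv\<^bsub>G\<^esub> g)) t) (\<Phi> g u) - \<Phi> g u))
      \<longlongrightarrow> \<Phi> g (D X u)) (at 0)"
    using \<Phi>_tendsto[OF g D_lim[OF X, of u]] by (simp add: \<Phi>_scale \<Phi>_diff g)
qed

lemma D_sum:
  assumes "finite B" "B \<subseteq> \<gg>"
  shows "D (\<Sum>b\<in>B. c b *\<^sub>R b) u = (\<Sum>b\<in>B. s (complex_of_real (c b)) (D b u))"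
  using assms
proof (induction B rule: finite_induct)
  case (insert b B)
  have "(\<Sum>b\<in>B. c b *\<^sub>R b) \<in> \<gg>"
    using insert.prems by (intro real_vector.subspace_sum[OF subspace_lie_alg] lie_alg_scale) auto
  then show ?case using insert by (simp add: D_add D_scaleR lie_alg_scale)
qed simp

lemma Ad_deriv:
  assumes X: "X \<in> \<gg>"
  shows "((\<lambda>t. p (e X t) ** Y ** p (inv\<^bsub>G\<^esub> (e X t))) has_vector_derivative X ** Y - Y ** X) (at 0)"
proof -
  interpret bounded_bilinear "(**) :: real^'n^'n \<Rightarrow> real^'n^'n \<Rightarrow> real^'n^'n"
    by (rule bounded_bilinear_matrix_mult)
  note v = exp_curve[OF X]
  have o: "one_param G \<T> (e X)" using v by (rule velocity_one_param)
  have "((\<lambda>t. p (e X t) ** Y) has_vector_derivative (X ** p (e X 0)) ** Y) (at 0)"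
    by (rule bounded_linear.has_vector_derivative[OF bounded_linear_left velocity_deriv(2)[OF v]])
  from has_vector_derivative[OF this velocity_deriv_minus[OF v]]
  have "((\<lambda>t. p (e X t) ** Y ** p (e X (- t))) has_vector_derivative
     p (e X 0) ** Y ** - (X ** p (e X (- 0))) + X ** p (e X 0) ** Y ** p (e X (- 0))) (at 0)" .
  then show ?thesis
    by (simp add: one_param_minus[OF o] one_param_zero[OF o] minus_right)
qed

text \<open>Differentiates \<open>\<Phi> (e X t) (D Y u) = D (A t) (v t)\<close> at 0, where
  \<open>A t\<close> is Ad(exp tX) Y and \<open>v t\<close> is the orbit of \<open>u\<close>. The
  left side gives \<open>D X (D Y u)\<close>, the right side the bracket term plus
  \<open>D Y (D X u)\<close>. Since the operator \<open>D (A t)\<close> moves with t,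
  \<open>A t\<close> is expanded in a fixed basis.\<close>

lemma D_bracket:
  assumes X: "X \<in> \<gg>" and Y: "Y \<in> \<gg>" and br: "X ** Y - Y ** X \<in> \<gg>"
  shows "D (X ** Y - Y ** X) u = D X (D Y u) - D Y (D X u)"
proof -
  obtain q where "frechet_seminorms s q"
    using smooth frechet_space_seminorms by (auto simp: smooth_frechet_rep_def)
  then interpret frechet_seminorms s q .
  obtain B where fin: "finite B" and B: "B \<subseteq> \<gg>"
    and expand: "\<And>Z. Z \<in> \<gg> \<Longrightarrow> (\<Sum>b\<in>B. (Z \<bullet> b) *\<^sub>R b) = Z"
    by (rule subspace_orthonormal_expansion[OF subspace_lie_alg]) blast
  define A where "A t = p (e X t) ** Y ** p (inv\<^bsub>G\<^esub> (e X t))" for t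
  define v where "v t = \<Phi> (e X t) u" for t
  have A: "A t \<in> \<gg>" for t unfolding A_def by (rule Ad_in_lie_alg[OF Y e_carrier[OF X]])
  have A0: "A 0 = Y" using e_zero[OF X] by (simp add: A_def)
  have D_A: "D (A t) w = (\<Sum>b\<in>B. s (complex_of_real (A t \<bullet> b)) (D b w))" for t w
    using D_sum[OF fin B, of "\<lambda>b. A t \<bullet> b" w] expand[OF A[of t]] by simp
  have dA: "((\<lambda>t. (A t \<bullet> b - A 0 \<bullet> b) / t) \<longlongrightarrow> (X ** Y - Y ** X) \<bullet> b) (at 0)" for b
  proof -
    have "((\<lambda>t. A t \<bullet> b) has_vector_derivative (X ** Y - Y ** X) \<bullet> b) (at 0)"
      unfolding A_def
      by (rule bounded_linear.has_vector_derivative[OF bounded_linear_inner_left Ad_deriv[OF X]])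
    then have "((\<lambda>t. A t \<bullet> b) has_field_derivative (X ** Y - Y ** X) \<bullet> b) (at 0)"
      by (simp add: has_real_derivative_iff_has_vector_derivative)
    then show ?thesis by (simp add: DERIV_def)
  qed
  have lhs: "((\<lambda>t. s (complex_of_real (1 / t)) (D (A t) (v t) - D (A 0) u)) \<longlongrightarrow> D X (D Y u)) (at 0)"
    using D_lim[OF X, of "D Y u"] by (simp add: \<Phi>_D[OF Y e_carrier[OF X]] A_def v_def e_zero X)
  \<comment> \<open>Product rule in the coordinates \<open>A t \<bullet> b\<close>: coefficients and
    vectors vary, but each \<open>D b\<close> is a fixed continuous operator.\<close>
  have "((\<lambda>t. \<Sum>b\<in>B. s (complex_of_real ((A t \<bullet> b - A 0 \<bullet> b) / t)) (D b (v t))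
        + s (complex_of_real (A 0 \<bullet> b)) (D b (s (complex_of_real (1 / t)) (v t - u))))
     \<longlongrightarrow> (\<Sum>b\<in>B. s (complex_of_real ((X ** Y - Y ** X) \<bullet> b)) (D b u)
        + s (complex_of_real (A 0 \<bullet> b)) (D b (D X u)))) (at 0)"
    using B D_lim[OF X, of u] orbit_tendsto[OF X, of u]
    by (intro tendsto_sum tendsto_add tendsto_scale tendsto_of_real dA D_tendsto tendsto_const)
       (auto simp: v_def)
  also have "(\<Sum>b\<in>B. s (complex_of_real ((X ** Y - Y ** X) \<bullet> b)) (D b u)
        + s (complex_of_real (A 0 \<bullet> b)) (D b (D X u))) = D (X ** Y - Y ** X) u + D Y (D X u)"
    using D_sum[OF fin B, of "\<lambda>b. (X ** Y - Y ** X) \<bullet> b" u] expand[OF br]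
      D_A[of 0 "D X u"] by (simp add: A0 sum.distrib)
  also have "(\<lambda>t. \<Sum>b\<in>B. s (complex_of_real ((A t \<bullet> b - A 0 \<bullet> b) / t)) (D b (v t))
        + s (complex_of_real (A 0 \<bullet> b)) (D b (s (complex_of_real (1 / t)) (v t - u))))
      = (\<lambda>t. s (complex_of_real (1 / t)) (D (A t) (v t) - D (A 0) u))"
  proof
    fix t
    have "s (complex_of_real ((A t \<bullet> b - A 0 \<bullet> b) / t)) (D b (v t))
        + s (complex_of_real (A 0 \<bullet> b)) (D b (s (complex_of_real (1 / t)) (v t - u)))
      = s (complex_of_real (1 / t)) (s (complex_of_real (A t \<bullet> b)) (D b (v t)) - s (complex_of_real (A 0 \<bullet> b)) (D b u))"
      if "b \<in> B" for b
      using that B by (auto simp: D_scale_vec D_diff_vec scale_right_diff_distrib scale_left_diff_distrib diff_divide_distrib)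
    then show "(\<Sum>b\<in>B. s (complex_of_real ((A t \<bullet> b - A 0 \<bullet> b) / t)) (D b (v t))
        + s (complex_of_real (A 0 \<bullet> b)) (D b (s (complex_of_real (1 / t)) (v t - u))))
      = s (complex_of_real (1 / t)) (D (A t) (v t) - D (A 0) u)"
      unfolding D_A by (simp add: scale_sum_right flip: sum_subtractf)
  qed
  finally have "D X (D Y u) = D (X ** Y - Y ** X) u + D Y (D X u)"
    using tendsto_unique[OF _ lhs] by simp
  then show ?thesis by simp
qed

end

section \<open>Representations of o(4,C)\<close>

locale o4_rep = vector_space s for s :: "complex \<Rightarrow> 'v \<Rightarrow> 'v::ab_group_add" +
  fixes \<rho> :: "complex^4^4 \<Rightarrow> 'v \<Rightarrow> 'v"
  assumes rho_linear: "X \<in> o4 \<Longrightarrow> Vector_Spaces.linear s s (\<rho> X)"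
    and rho_plus: "X \<in> o4 \<Longrightarrow> Y \<in> o4 \<Longrightarrow> \<rho> (X + Y) v = \<rho> X v + \<rho> Y v"
    and rho_mscale: "X \<in> o4 \<Longrightarrow> \<rho> (mscale c X) v = s c (\<rho> X v)"
    and rho_bracket: "X \<in> o4 \<Longrightarrow> Y \<in> o4 \<Longrightarrow> \<rho> (bracket X Y) v = \<rho> X (\<rho> Y v) - \<rho> Y (\<rho> X v)"

lemma o4_iff: "X \<in> o4 \<longleftrightarrow> (\<forall>i j. X $ j $ i = - X $ i $ j)"
  by (simp only: o4_def transpose_def vec_eq_iff mem_Collect_eq vec_lambda_beta vector_uminus_component)

lemma o4D: "X \<in> o4 \<Longrightarrow> X $ j $ i = - X $ i $ j"
  unfolding o4_iff by blast

lemma o4_add: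
  assumes "X \<in> o4" "Y \<in> o4" shows "X + Y \<in> o4"
  unfolding o4_iff
proof (intro allI)
  fix i j
  show "(X + Y) $ j $ i = - (X + Y) $ i $ j"
    using o4D[OF assms(1), of j i] o4D[OF assms(2), of j i] by (simp only: vector_add_component minus_add_distrib)
qed

lemma o4_mscale:
  assumes "X \<in> o4" shows "mscale c X \<in> o4"
  unfolding o4_iff
proof (intro allI)
  fix i j
  show "mscale c X $ j $ i = - mscale c X $ i $ j"
    using o4D[OF assms, of j i] by (simp only: mscale_def vec_lambda_beta mult_minus_right)
qed

lemma o4_bracket:
  assumes "X \<in> o4" "Y \<in> o4" shows "bracket X Y \<in> o4"
  unfolding o4_iff
proof (intro allI)
  fix i j
  have "X $ j $ k * Y $ k $ i = Y $ i $ k * X $ k $ j" for k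
    unfolding o4D[OF assms(1), of j k] o4D[OF assms(2), of k i] by simp
  moreover have "Y $ j $ k * X $ k $ i = X $ i $ k * Y $ k $ j" for k
    unfolding o4D[OF assms(2), of j k] o4D[OF assms(1), of k i] by simp
  ultimately show "bracket X Y $ j $ i = - bracket X Y $ i $ j"
    by (simp add: bracket_def matrix_matrix_mult_def)
qed

lemma mRe_add: "mRe (Z + W) = mRe Z + mRe W"
  and mIm_add: "mIm (Z + W) = mIm Z + mIm W"
  and mRe_mscale: "mRe (mscale c Z) = Re c *\<^sub>R mRe Z + (- Im c) *\<^sub>R mIm Z"
  and mIm_mscale: "mIm (mscale c Z) = Im c *\<^sub>R mRe Z + Re c *\<^sub>R mIm Z"
  by (simp_all add: mRe_def mIm_def mscale_def vec_eq_iff)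

lemma mRe_bracket: "mRe (bracket Z W) =
    (mRe Z ** mRe W - mRe W ** mRe Z) + (-1) *\<^sub>R (mIm Z ** mIm W - mIm W ** mIm Z)"
  by (simp add: mRe_def mIm_def bracket_def vec_eq_iff matrix_matrix_mult_def sum_subtractf)

lemma mIm_bracket: "mIm (bracket Z W) =
    (mRe Z ** mIm W - mIm W ** mRe Z) + (mIm Z ** mRe W - mRe W ** mIm Z)"
  by (simp add: mRe_def mIm_def bracket_def vec_eq_iff matrix_matrix_mult_def sum_subtractf sum.distrib)

lemma mRe_mcomplex [simp]: "mRe (mcomplex A) = A" and mIm_mcomplex [simp]: "mIm (mcomplex A) = 0"
  by (simp_all add: mRe_def mIm_def mcomplex_def vec_eq_iff)

lemma pair_iso_mem: "pair_iso \<psi> g g' \<Longrightarrow> X \<in> o4 \<Longrightarrow> \<psi> X \<in> g"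
  by (auto simp: pair_iso_def bij_betw_def)

lemma pair_iso_obtain:
  assumes "pair_iso \<psi> g g'" "Z \<in> g" obtains X where "X \<in> o4" "Z = \<psi> X"
  using assms by (auto simp: pair_iso_def bij_betw_def)

lemma pair_iso_closed:
  assumes \<psi>: "pair_iso \<psi> g g'" and Z: "Z \<in> g" and W: "W \<in> g"
  shows "Z + W \<in> g" "mscale c Z \<in> g" "bracket Z W \<in> g"
proof -
  obtain X where X: "X \<in> o4" "Z = \<psi> X" using pair_iso_obtain[OF \<psi> Z] .
  obtain Y where Y: "Y \<in> o4" "W = \<psi> Y" using pair_iso_obtain[OF \<psi> W] .
  have "Z + W = \<psi> (X + Y)" "mscale c Z = \<psi> (mscale c X)" "bracket Z W = \<psi> (bracket X Y)"
    using \<psi> X Y by (simp_all add: pair_iso_def)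
  then show "Z + W \<in> g" "mscale c Z \<in> g" "bracket Z W \<in> g"
    using X Y pair_iso_mem[OF \<psi>] o4_add o4_mscale o4_bracket by simp_all
qed

text \<open>The complexified set is a homomorphic image of o(4,C), hence closed under sums and
  brackets; real matrices embed with zero imaginary part, and taking real parts brings the closure
  back to \<open>lie_alg\<close>.\<close>

lemma (in reductive) lie_alg_closed:
  assumes \<psi>: "pair_iso \<psi> (complexified (lie_alg G \<T> p)) g'"
  shows "subspace (lie_alg G \<T> p)"
    and "X \<in> lie_alg G \<T> p \<Longrightarrow> Y \<in> lie_alg G \<T> p \<Longrightarrow> X ** Y - Y ** X \<in> lie_alg G \<T> p"
proof -
  let ?g = "lie_alg G \<T> p"
  have 0: "0 \<in> ?g" using velocity_zero by (rule lie_algI)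
  have mem: "mcomplex X \<in> complexified ?g" if "X \<in> ?g" for X
    using that 0 by (simp add: complexified_def)
  have "X + Y \<in> ?g" if "X \<in> ?g" "Y \<in> ?g" for X Y
    using pair_iso_closed(1)[OF \<psi> mem mem, OF that] by (simp add: complexified_def mRe_add)
  then show "subspace ?g" using 0 lie_alg_scale by (auto simp: subspace_def)
  assume "X \<in> ?g" "Y \<in> ?g"
  from pair_iso_closed(3)[OF \<psi> mem mem, OF this]
  show "X ** Y - Y ** X \<in> ?g" by (simp add: complexified_def mRe_bracket)
qed

lemma cderiv_o4_rep:
  assumes G: "real_reductive_group G \<T> p" and \<Phi>: "smooth_frechet_rep G \<T> p s \<Phi>"
    and \<psi>: "pair_iso \<psi> (complexified (lie_alg G \<T> p)) g'"
  shows "o4_rep s (\<lambda>X. cderiv_rep G \<T> p s \<Phi> (\<psi> X))"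
proof -
  interpret reductive G \<T> p by standard (rule G)
  interpret smooth_rep G \<T> p s \<Phi> by standard (rule \<Phi>, rule lie_alg_closed[OF \<psi>])
  have Re: "mRe (\<psi> X) \<in> \<gg>" and Im: "mIm (\<psi> X) \<in> \<gg>" if "X \<in> o4" for X
    using pair_iso_mem[OF \<psi> that] by (auto simp: complexified_def)
  have "cderiv_rep G \<T> p s \<Phi> (\<psi> X) (u + v) = cderiv_rep G \<T> p s \<Phi> (\<psi> X) u + cderiv_rep G \<T> p s \<Phi> (\<psi> X) v"
    "cderiv_rep G \<T> p s \<Phi> (\<psi> X) (s c u) = s c (cderiv_rep G \<T> p s \<Phi> (\<psi> X) u)"
    if "X \<in> o4" for X u v c
    using Re[OF that] Im[OF that]
    by (simp_all add: cderiv_rep_def D_add_vec D_scale_vec scale_right_distrib mult.commute)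
  then have lin: "Vector_Spaces.linear s s (cderiv_rep G \<T> p s \<Phi> (\<psi> X))" if "X \<in> o4" for X
    using that by unfold_locales auto
  show ?thesis
  proof (intro o4_rep.intro o4_rep_axioms.intro)
    show "vector_space s" by (rule vector_space_axioms)
  next
    fix X Y v c assume X: "X \<in> o4"
    show "Vector_Spaces.linear s s (cderiv_rep G \<T> p s \<Phi> (\<psi> X))" by (rule lin[OF X])
    obtain a b where c: "c = complex_of_real a + \<i> * complex_of_real b" using complex_eq by blast
    have "\<psi> (mscale c X) = mscale c (\<psi> X)" using \<psi> X by (simp add: pair_iso_def)
    then show "cderiv_rep G \<T> p s \<Phi> (\<psi> (mscale c X)) v = s c (cderiv_rep G \<T> p s \<Phi> (\<psi> X) v)"
      using Re[OF X] Im[OF X]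
      by (simp only: cderiv_rep_def mRe_mscale mIm_mscale D_add D_scaleR lie_alg_scale)
         (simp add: c scale_right_distrib scale_left_distrib algebra_simps flip: mult.assoc)
    assume Y: "Y \<in> o4"
    have "\<psi> (X + Y) = \<psi> X + \<psi> Y" and br: "\<psi> (bracket X Y) = bracket (\<psi> X) (\<psi> Y)"
      using \<psi> X Y by (simp_all add: pair_iso_def)
    then show "cderiv_rep G \<T> p s \<Phi> (\<psi> (X + Y)) v
        = cderiv_rep G \<T> p s \<Phi> (\<psi> X) v + cderiv_rep G \<T> p s \<Phi> (\<psi> Y) v"
      using Re X Y Im by (simp add: cderiv_rep_def mRe_add mIm_add D_add scale_right_distrib)
    have b: "A ** B - B ** A \<in> \<gg>" if "A \<in> \<gg>" "B \<in> \<gg>" for A B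
      using lie_alg_closed(2)[OF \<psi> that] .
    have D_br: "D (A ** B - B ** A) w = D A (D B w) - D B (D A w)" if "A \<in> \<gg>" "B \<in> \<gg>" for A B w
      using D_bracket[OF that b[OF that]] .
    show "cderiv_rep G \<T> p s \<Phi> (\<psi> (bracket X Y)) v
        = cderiv_rep G \<T> p s \<Phi> (\<psi> X) (cderiv_rep G \<T> p s \<Phi> (\<psi> Y) v)
          - cderiv_rep G \<T> p s \<Phi> (\<psi> Y) (cderiv_rep G \<T> p s \<Phi> (\<psi> X) v)"
      unfolding br cderiv_rep_def mRe_bracket mIm_bracket
      using Re[OF X] Im[OF X] Re[OF Y] Im[OF Y]
      by (simp only: D_add D_scaleR D_br b lie_alg_scale D_add_vec D_scale_vec D_diff_vec)
         (simp add: scale_right_distrib scale_right_diff_distrib)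
  qed
qed

section \<open>Symmetry breaking operators and the Lie algebra\<close>

text \<open>The exponential curve of \<open>X\<close> inside \<open>H\<close> is also one in
  \<open>G\<close>, and by uniqueness the one chosen there. The continuous map \<open>T\<close>
  carries the convergent difference quotients of \<open>\<Phi>\<close> along it to those of
  \<open>\<pi>\<close>, which therefore converge as well.\<close>

lemma symmetry_breaking_deriv:
  assumes G: "real_reductive_group G \<T> p" and \<Phi>: "smooth_frechet_rep G \<T> p sV \<Phi>"
    and \<psi>: "pair_iso \<psi> (complexified (lie_alg G \<T> p)) g'"
    and T: "symmetry_breaking H sV sW \<Phi> \<pi> T"
    and X: "X \<in> lie_alg (G\<lparr>carrier := H\<rparr>) (subtopology \<T> H) p"
  shows "T (deriv_rep G \<T> p sV \<Phi> X u) = deriv_rep (G\<lparr>carrier := H\<rparr>) (subtopology \<T> H) p sW \<pi> X (T u)"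
proof -
  interpret reductive G \<T> p by standard (rule G)
  interpret smooth_rep G \<T> p sV \<Phi> by standard (rule \<Phi>, rule lie_alg_closed[OF \<psi>])
  let ?G' = "G\<lparr>carrier := H\<rparr>" and ?T' = "subtopology \<T> H"
  define \<gamma> where "\<gamma> = exp_curve ?G' ?T' p X"
  have v': "has_velocity ?G' ?T' p \<gamma> X"
    using X someI_ex[of "\<lambda>\<gamma>. has_velocity ?G' ?T' p \<gamma> X"] by (simp add: lie_alg_def exp_curve_def \<gamma>_def)
  then have v: "has_velocity G \<T> p \<gamma> X" and \<gamma>H: "\<gamma> t \<in> H" for t
    by (auto simp: has_velocity_def one_param_def continuous_map_in_subtopology)
  have lin: "Vector_Spaces.linear sV sW T" and cont: "continuous_on UNIV T"
    and hom: "\<And>h u. h \<in> H \<Longrightarrow> T (\<Phi> h u) = \<pi> h (T u)"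
    using T by (auto simp: symmetry_breaking_def)
  interpret T: Vector_Spaces.linear sV sW T by (rule lin)
  have "((\<lambda>t. T (sV (complex_of_real (1 / t)) (\<Phi> (e X t) u - u))) \<longlongrightarrow> T (D X u)) (at 0)"
    using cont continuous_on_tendsto_compose[OF cont D_lim[OF lie_algI[OF v], of u]] by simp
  then have *: "((\<lambda>t. sW (complex_of_real (1 / t)) (\<pi> (\<gamma> t) (T u) - T u)) \<longlongrightarrow> T (D X u)) (at 0)"
    by (simp add: T.scale T.diff hom \<gamma>H exp_curve_eq[OF v])
  then show ?thesis unfolding deriv_rep_def[of ?G'] using tendsto_Lim[OF _ *] by (simp add: \<gamma>_def)
qed

lemma symmetry_breaking_cderiv:
  assumes G: "real_reductive_group G \<T> p" and \<Phi>: "smooth_frechet_rep G \<T> p sV \<Phi>"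
    and \<psi>: "pair_iso \<psi> (complexified (lie_alg G \<T> p))
      (complexified (lie_alg (G\<lparr>carrier := H\<rparr>) (subtopology \<T> H) p))"
    and T: "symmetry_breaking H sV sW \<Phi> \<pi> T"
    and X: "X \<in> o3"
  shows "T (cderiv_rep G \<T> p sV \<Phi> (\<psi> X) u)
    = cderiv_rep (G\<lparr>carrier := H\<rparr>) (subtopology \<T> H) p sW \<pi> (\<psi> X) (T u)"
proof -
  interpret T: Vector_Spaces.linear sV sW T using T by (simp add: symmetry_breaking_def)
  have "\<psi> X \<in> complexified (lie_alg (G\<lparr>carrier := H\<rparr>) (subtopology \<T> H) p)"
    using \<psi> X by (auto simp: pair_iso_def)
  then show ?thesis
    unfolding cderiv_rep_def complexified_def
    by (simp add: T.add T.scale symmetry_breaking_deriv[OF G \<Phi> \<psi> T])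
qed

section \<open>Free algebras and enveloping algebras\<close>

abbreviation scalar :: "complex \<Rightarrow> 'a free_alg" where
  "scalar c \<equiv> Poly_Mapping.single [] c"

lemma scalar_0_1 [simp]: "scalar 0 = 0" "scalar 1 = 1"
  by (simp_all flip: zero_list_def)

lemma mult_scalar: "scalar a * scalar b = scalar (a * b)"
  by (simp add: mult_single plus_list_def)

lemma scalar_numeral: "scalar (numeral n) = numeral n"
  by (simp flip: zero_list_def)

lemma free_alg_sum: "z = (\<Sum>w\<in>Poly_Mapping.keys z. Poly_Mapping.single w (Poly_Mapping.lookup z w))"
  by (rule poly_mapping_eqI) (simp add: lookup_sum lookup_single when_def in_keys_iff sum.delta')

lemma scalar_commute: "scalar c * z = z * scalar c" for z :: "'a free_alg"
proof -
  have "scalar c * Poly_Mapping.single w a = Poly_Mapping.single w a * scalar c" for w :: "'a list" and a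
    by (simp add: mult_single plus_list_def mult.commute)
  then show ?thesis
    by (subst (1 2) free_alg_sum[of z]) (simp only: sum_distrib_left sum_distrib_right)
qed

lemma free_over_single: "set w \<subseteq> L \<Longrightarrow> Poly_Mapping.single w c \<in> free_over L"
  by (auto simp: free_over_def)

lemma free_over_scalar [simp]: "scalar c \<in> free_over L"
  by (simp add: free_over_single)

lemma free_over_0 [simp]: "0 \<in> free_over L" and free_over_1 [simp]: "1 \<in> free_over L"
  using free_over_scalar[of 0] free_over_scalar[of 1] by simp_all

lemma free_over_letter: "X \<in> L \<Longrightarrow> letter X \<in> free_over L"
  by (simp add: letter_def free_over_single)

lemma free_over_add: "y \<in> free_over L \<Longrightarrow> z \<in> free_over L \<Longrightarrow> y + z \<in> free_over L"
  using keys_add[of y z] by (auto simp: free_over_def)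

lemma free_over_uminus: "z \<in> free_over L \<Longrightarrow> - z \<in> free_over L"
  by (simp add: free_over_def in_keys_iff)

lemma free_over_diff: "y \<in> free_over L \<Longrightarrow> z \<in> free_over L \<Longrightarrow> y - z \<in> free_over L"
  using free_over_add[OF _ free_over_uminus, of y L z] by simp

lemma free_over_mult: "y \<in> free_over L \<Longrightarrow> z \<in> free_over L \<Longrightarrow> y * z \<in> free_over L"
  using keys_mult[of y z] by (fastforce simp: free_over_def plus_list_def)

lemmas free_over_intros = free_over_letter free_over_add free_over_uminus free_over_diff free_over_mult

lemma free_over_induct [consumes 1, case_names scalar letter add mult]:
  assumes "z \<in> free_over L"
    and scalar: "\<And>c. P (scalar c)" and letter: "\<And>X. X \<in> L \<Longrightarrow> P (letter X)"
    and add: "\<And>y z. y \<in> free_over L \<Longrightarrow> z \<in> free_over L \<Longrightarrow> P y \<Longrightarrow> P z \<Longrightarrow> P (y + z)"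
    and mult: "\<And>y z. y \<in> free_over L \<Longrightarrow> z \<in> free_over L \<Longrightarrow> P y \<Longrightarrow> P z \<Longrightarrow> P (y * z)"
  shows "P z"
proof -
  have word: "P (Poly_Mapping.single w c)" if "set w \<subseteq> L" for w c
    using that
  proof (induction w)
    case (Cons X w)
    have "Poly_Mapping.single (X # w) c = letter X * Poly_Mapping.single w c"
      by (simp add: letter_def mult_single plus_list_def)
    then show ?case using Cons by (simp add: mult letter free_over_letter free_over_single)
  qed (rule scalar)
  have "(\<Sum>w\<in>A. Poly_Mapping.single w (Poly_Mapping.lookup z w)) \<in> free_over L \<and>
      P (\<Sum>w\<in>A. Poly_Mapping.single w (Poly_Mapping.lookup z w))"
    if "finite A" "A \<subseteq> Poly_Mapping.keys z" for A
    using that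
  proof (induction A rule: finite_induct)
    case empty
    then show ?case using scalar[of 0] by simp
  next
    case (insert w A)
    then have "set w \<subseteq> L" using assms(1) by (auto simp: free_over_def)
    then show ?case using insert by (simp add: word add free_over_add free_over_single)
  qed
  from this[of "Poly_Mapping.keys z"] show ?thesis by (simp flip: free_alg_sum)
qed

lemma free_eval_superset:
  assumes "finite A" "Poly_Mapping.keys z \<subseteq> A"
  shows "free_eval \<tau> z = (\<Sum>w\<in>A. Poly_Mapping.lookup z w * prod_list (map \<tau> w))"
  unfolding free_eval_def using assms by (intro sum.mono_neutral_left) (auto simp: in_keys_iff)

lemma free_eval_add: "free_eval \<tau> (y + z) = free_eval \<tau> y + free_eval \<tau> z"
proof -
  let ?A = "Poly_Mapping.keys y \<union> Poly_Mapping.keys z"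
  have "finite ?A" "Poly_Mapping.keys (y + z) \<subseteq> ?A" using keys_add[of y z] by auto
  then show ?thesis
    by (simp add: free_eval_superset[of ?A] lookup_add distrib_right sum.distrib)
qed

lemma free_eval_single: "free_eval \<tau> (Poly_Mapping.single w c) = c * prod_list (map \<tau> w)"
  by (simp add: free_eval_def)

section \<open>Operators attached to elements of the free algebra\<close>

locale free_rep = vector_space s for s :: "complex \<Rightarrow> 'v \<Rightarrow> 'v::ab_group_add" +
  fixes \<rho> :: "'a \<Rightarrow> 'v \<Rightarrow> 'v" and L :: "'a set"
  assumes linear: "X \<in> L \<Longrightarrow> Vector_Spaces.linear s s (\<rho> X)"
begin

abbreviation "act \<equiv> free_act s \<rho>"

lemma act_superset:
  assumes "finite A" "Poly_Mapping.keys z \<subseteq> A"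
  shows "act z v = (\<Sum>w\<in>A. s (Poly_Mapping.lookup z w) (foldr \<rho> w v))"
  unfolding free_act_def using assms by (intro sum.mono_neutral_left) (auto simp: in_keys_iff)

lemma act_add: "act (y + z) v = act y v + act z v"
proof -
  let ?A = "Poly_Mapping.keys y \<union> Poly_Mapping.keys z"
  have "finite ?A" "Poly_Mapping.keys (y + z) \<subseteq> ?A" using keys_add[of y z] by auto
  then show ?thesis
    by (simp add: act_superset[of ?A] lookup_add scale_left_distrib sum.distrib)
qed

lemma act_single: "act (Poly_Mapping.single w c) v = s c (foldr \<rho> w v)"
  by (simp add: free_act_def)

lemma act_scalar [simp]: "act (scalar c) v = s c v"
  by (simp add: act_single)

lemma act_0 [simp]: "act 0 v = 0" and act_1 [simp]: "act 1 v = v"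
  using act_scalar[of 0 v] act_scalar[of 1 v] by simp_all

lemma act_letter [simp]: "act (letter X) v = \<rho> X v"
  by (simp add: letter_def act_single)

lemma act_uminus: "act (- z) v = - act z v"
  using act_add[of z "- z" v] by (simp add: eq_neg_iff_add_eq_0 add.commute)

lemma act_diff: "act (y - z) v = act y v - act z v"
  using act_add[of y "- z" v] by (simp add: act_uminus)

lemma act_sum: "act (sum f A) v = (\<Sum>x\<in>A. act (f x) v)"
  by (induction A rule: infinite_finite_induct) (simp_all add: act_add)

lemma foldr_linear: "set w \<subseteq> L \<Longrightarrow> Vector_Spaces.linear s s (foldr \<rho> w)"
proof (induction w)
  case (Cons X w)
  then show ?case using Vector_Spaces.linear_compose[of s s "foldr \<rho> w" s "\<rho> X"] linear[of X] by (simp add: o_def)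
qed (simp add: linear_ident o_def id_def)

lemma act_linear:
  assumes "z \<in> free_over L" shows "Vector_Spaces.linear s s (act z)"
proof -
  have "Vector_Spaces.linear s s (foldr \<rho> w)" if "w \<in> Poly_Mapping.keys z" for w
    using that assms foldr_linear by (simp add: free_over_def)
  note hom = Vector_Spaces.linear.axioms(3)[OF this]
  show ?thesis unfolding free_act_def
    by unfold_locales
       (simp_all add: module_hom.add[OF hom] module_hom.scale[OF hom] scale_right_distrib
         sum.distrib scale_sum_right mult.commute)
qed

text \<open>The sum over the words of \<open>z\<close> is pulled through the operators of the words
  of \<open>y\<close>; hence linearity is asked of the letters of the left factor.\<close>

lemma act_mult:
  assumes y: "y \<in> free_over L"
  shows "act (y * z) v = act y (act z v)"
proof -
  have lin: "Vector_Spaces.linear s s (foldr \<rho> w)" if "w \<in> Poly_Mapping.keys y" for w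
    using that y foldr_linear by (simp add: free_over_def)
  note hom = Vector_Spaces.linear.axioms(3)[OF lin]
  have "act (y * z) v = (\<Sum>w\<in>Poly_Mapping.keys y. \<Sum>w'\<in>Poly_Mapping.keys z.
      act (Poly_Mapping.single w (Poly_Mapping.lookup y w) * Poly_Mapping.single w' (Poly_Mapping.lookup z w')) v)"
    by (subst free_alg_sum[of y], subst free_alg_sum[of z])
       (simp only: sum_distrib_left sum_distrib_right act_sum, rule sum.swap)
  also have "\<dots> = (\<Sum>w\<in>Poly_Mapping.keys y. s (Poly_Mapping.lookup y w) (foldr \<rho> w (act z v)))"
    by (intro sum.cong refl)
       (simp add: mult_single act_single plus_list_def module_hom.sum[OF hom]
         module_hom.scale[OF hom] scale_sum_right free_act_def[of s \<rho> z])
  finally show ?thesis by (simp add: free_act_def)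
qed

end

section \<open>The ideal of relations of U(L) and the center\<close>

context
  fixes L :: "(complex^'n^'n) set"
begin

lemma U_ideal_gen:
  assumes "r \<in> U_rel L" shows "r \<in> U_ideal L"
  using U_ideal.add[OF U_ideal.zero _ _ assms, of 1 1] by simp

lemma U_ideal_mult_left: "x \<in> U_ideal L \<Longrightarrow> y \<in> free_over L \<Longrightarrow> y * x \<in> U_ideal L"
proof (induction rule: U_ideal.induct)
  case (add x a b r)
  then have "y * x + (y * a) * r * b \<in> U_ideal L" by (intro U_ideal.add free_over_mult)
  then show ?case by (simp add: distrib_left mult.assoc)
qed (simp add: U_ideal.zero)

lemma U_ideal_mult_right: "x \<in> U_ideal L \<Longrightarrow> y \<in> free_over L \<Longrightarrow> x * y \<in> U_ideal L"
proof (induction rule: U_ideal.induct)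
  case (add x a b r)
  then have "x * y + a * r * (b * y) \<in> U_ideal L" by (intro U_ideal.add free_over_mult)
  then show ?case by (simp add: distrib_right mult.assoc)
qed (simp add: U_ideal.zero)

lemma U_ideal_add: "x \<in> U_ideal L \<Longrightarrow> y \<in> U_ideal L \<Longrightarrow> x + y \<in> U_ideal L"
proof (induction rule: U_ideal.induct)
  case (add x a b r)
  then have "(x + y) + a * r * b \<in> U_ideal L" by (intro U_ideal.add)
  then show ?case by (simp add: add_ac)
qed simp

lemma U_ideal_uminus: "x \<in> U_ideal L \<Longrightarrow> - x \<in> U_ideal L"
  using U_ideal_mult_left[of x "- 1"] by (simp add: free_over_uminus)

lemma U_ideal_diff: "x \<in> U_ideal L \<Longrightarrow> y \<in> U_ideal L \<Longrightarrow> x - y \<in> U_ideal L"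
  using U_ideal_add[OF _ U_ideal_uminus, of x y] by simp

lemma letter_add: "X \<in> L \<Longrightarrow> Y \<in> L \<Longrightarrow> letter (X + Y) - (letter X + letter Y) \<in> U_ideal L"
  by (rule U_ideal_gen) (auto simp: U_rel_def diff_diff_eq)

lemma letter_mscale:
  assumes "X \<in> L" shows "letter (mscale c X) - scalar c * letter X \<in> U_ideal L"
proof -
  have "scalar c * letter X = Poly_Mapping.single [X] c"
    by (simp add: letter_def mult_single plus_list_def)
  then show ?thesis using assms by (intro U_ideal_gen) (auto simp: U_rel_def)
qed

lemma letter_bracket:
  "X \<in> L \<Longrightarrow> Y \<in> L \<Longrightarrow> letter X * letter Y - letter Y * letter X - letter (bracket X Y) \<in> U_ideal L"
  by (rule U_ideal_gen) (unfold U_rel_def, blast)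

text \<open>Commuting with \<open>z\<close> passes to products by
  \<open>[u v, z] = u [v, z] + [u, z] v\<close>, so letters suffice.\<close>

lemma U_centerI:
  assumes z: "z \<in> free_over L" and c: "\<And>X. X \<in> L \<Longrightarrow> letter X * z - z * letter X \<in> U_ideal L"
  shows "z \<in> U_center L"
proof -
  have "u * z - z * u \<in> U_ideal L" if "u \<in> free_over L" for u
    using that
  proof (induction rule: free_over_induct)
    case (scalar c)
    show ?case using scalar_commute[of c z] by (simp add: U_ideal.zero)
  next
    case (letter X)
    then show ?case by (rule c)
  next
    case (add u v)
    then have "(u * z - z * u) + (v * z - z * v) \<in> U_ideal L" by (intro U_ideal_add)
    then show ?case by (simp add: algebra_simps)
  next
    case (mult u v)
    then have "u * (v * z - z * v) + (u * z - z * u) * v \<in> U_ideal L"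
      by (intro U_ideal_add U_ideal_mult_left U_ideal_mult_right)
    then show ?case by (simp add: algebra_simps)
  qed
  then show ?thesis using z by (simp add: U_center_def)
qed

end

section \<open>Quaternionic Casimir elements\<close>

text \<open>With \<open>h = \<i> x1\<close>, \<open>2 e = x2 + \<i> x3\<close> and
  \<open>- 2 f = x2 - \<i> x3\<close>, this is \<open>h^2 + 2 h + 4 f e\<close>, whose value on a
  highest weight vector of weight \<mu> is (\<mu> + 1)^2 - 1.\<close>

definition casimir :: "(complex^'n^'n) \<Rightarrow> complex^'n^'n \<Rightarrow> complex^'n^'n \<Rightarrow> (complex^'n^'n) free_alg" where
  "casimir x1 x2 x3 = - (letter x1 * letter x1 + letter x2 * letter x2 + letter x3 * letter x3)"

text \<open>\<open>decomp\<close> makes L the span of the triple plus elements commuting with it.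
  This covers o(3,C), where Z = 0, and either ideal of o(4,C), where Z lies in the opposite
  one.\<close>

locale quaternion_triple =
  fixes L :: "(complex^'n^'n) set" and x1 x2 x3 :: "complex^'n^'n"
  assumes mem: "x1 \<in> L" "x2 \<in> L" "x3 \<in> L"
    and br: "bracket x1 x2 = mscale 2 x3" "bracket x2 x3 = mscale 2 x1" "bracket x3 x1 = mscale 2 x2"
    and L_add: "\<And>X Y. X \<in> L \<Longrightarrow> Y \<in> L \<Longrightarrow> X + Y \<in> L"
    and L_mscale: "\<And>c X. X \<in> L \<Longrightarrow> mscale c X \<in> L"
    and decomp: "\<And>X. X \<in> L \<Longrightarrow> \<exists>a b c Z. Z \<in> L \<and>
      X = mscale a x1 + (mscale b x2 + (mscale c x3 + Z)) \<and>
      bracket Z x1 = 0 \<and> bracket Z x2 = 0 \<and> bracket Z x3 = 0"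
begin

lemma letter_br:
  assumes "X \<in> L" "Y \<in> L" "Z \<in> L" "bracket X Y = mscale c Z"
  shows "letter X * letter Y - letter Y * letter X - scalar c * letter Z \<in> U_ideal L"
  using U_ideal_add[OF letter_bracket[OF assms(1,2)] letter_mscale[OF assms(3), of c]]
  by (simp add: assms(4))

text \<open>\<open>[a, b^2] = 2 (c b + b c)\<close> and \<open>[a, c^2] = - 2 (b c + c b)\<close>
  cancel.\<close>

lemma commute_quadratic:
  assumes a: "a \<in> L" and b: "b \<in> L" and c: "c \<in> L"
    and ab: "bracket a b = mscale 2 c" and ca: "bracket c a = mscale 2 b"
  shows "letter a * (letter b * letter b + letter c * letter c)
    - (letter b * letter b + letter c * letter c) * letter a \<in> U_ideal L"
proof -
  let ?a = "letter a" and ?b = "letter b" and ?c = "letter c"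
  define r where "r = ?a * ?b - ?b * ?a - (?c + ?c)"
  define t where "t = ?c * ?a - ?a * ?c - (?b + ?b)"
  have "r \<in> U_ideal L" "t \<in> U_ideal L"
    using letter_br[OF a b c ab] letter_br[OF c a b ca]
    by (simp_all only: r_def t_def scalar_numeral mult_2)
  then have "r * ?b + ?b * r - t * ?c - ?c * t \<in> U_ideal L"
    using b c by (intro U_ideal_add U_ideal_diff U_ideal_mult_left U_ideal_mult_right free_over_letter)
  also have "r * ?b + ?b * r - t * ?c - ?c * t = ?a * (?b * ?b + ?c * ?c) - (?b * ?b + ?c * ?c) * ?a"
    unfolding r_def t_def by (simp add: algebra_simps)
  finally show ?thesis .
qed

lemma casimir_commute:
  assumes "X = x1 \<or> X = x2 \<or> X = x3"
  shows "letter X * casimir x1 x2 x3 - casimir x1 x2 x3 * letter X \<in> U_ideal L"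
proof -
  note q = commute_quadratic[OF mem(1,2,3) br(1) br(3)] commute_quadratic[OF mem(2,3,1) br(2) br(1)]
    commute_quadratic[OF mem(3,1,2) br(3) br(2)]
  show ?thesis
    using assms U_ideal_uminus[OF q(1)] U_ideal_uminus[OF q(2)] U_ideal_uminus[OF q(3)]
    by (elim disjE) (simp_all add: casimir_def algebra_simps)
qed

lemma casimir_free_over: "casimir x1 x2 x3 \<in> free_over L"
  unfolding casimir_def using mem by (intro free_over_intros)

lemma commute_letter:
  assumes "Z \<in> L" "Y \<in> L" "bracket Z Y = 0"
  shows "letter Z * (letter Y * letter Y) - letter Y * letter Y * letter Z \<in> U_ideal L"
proof -
  have "bracket Z Y = mscale 0 Z" by (simp add: assms(3) mscale_def vec_eq_iff)
  from letter_br[OF assms(1,2,1) this]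
  have "(letter Z * letter Y - letter Y * letter Z) * letter Y
      + letter Y * (letter Z * letter Y - letter Y * letter Z) \<in> U_ideal L"
    using assms by (intro U_ideal_add U_ideal_mult_left U_ideal_mult_right free_over_letter) simp_all
  then show ?thesis by (simp add: algebra_simps)
qed

lemma casimir_central: "casimir x1 x2 x3 \<in> U_center L"
proof (rule U_centerI[OF casimir_free_over])
  let ?C = "casimir x1 x2 x3"
  \<comment> \<open>\<open>letter\<close> is linear only modulo \<open>U_ideal\<close>, so
    commutation is transferred between congruent representatives.\<close>
  have comm_cong: "letter Y * ?C - ?C * letter Y \<in> U_ideal L"
    if "letter Y - y \<in> U_ideal L" "y * ?C - ?C * y \<in> U_ideal L" for Y y
  proof -
    have "(letter Y - y) * ?C - ?C * (letter Y - y) + (y * ?C - ?C * y) \<in> U_ideal L"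
      by (rule U_ideal_add[OF U_ideal_diff[OF U_ideal_mult_right U_ideal_mult_left]])
         (fact that casimir_free_over)+
    then show ?thesis by (simp add: algebra_simps)
  qed
  have comm_scale: "letter (mscale c Y) * ?C - ?C * letter (mscale c Y) \<in> U_ideal L"
    if "Y \<in> L" "letter Y * ?C - ?C * letter Y \<in> U_ideal L" for c Y
  proof (rule comm_cong[OF letter_mscale[OF that(1)]])
    have "scalar c * (letter Y * ?C - ?C * letter Y) \<in> U_ideal L"
      by (rule U_ideal_mult_left[OF that(2) free_over_scalar])
    moreover have "scalar c * (?C * letter Y) = ?C * (scalar c * letter Y)"
      by (simp only: scalar_commute[of c ?C] flip: mult.assoc)
    ultimately show "scalar c * letter Y * ?C - ?C * (scalar c * letter Y) \<in> U_ideal L"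
      by (simp add: right_diff_distrib mult.assoc)
  qed
  have comm_add: "letter (Y + Z) * ?C - ?C * letter (Y + Z) \<in> U_ideal L"
    if "Y \<in> L" "Z \<in> L" "letter Y * ?C - ?C * letter Y \<in> U_ideal L" "letter Z * ?C - ?C * letter Z \<in> U_ideal L" for Y Z
  proof (rule comm_cong[OF letter_add[OF that(1,2)]])
    show "(letter Y + letter Z) * ?C - ?C * (letter Y + letter Z) \<in> U_ideal L"
      using U_ideal_add[OF that(3,4)] by (simp add: algebra_simps)
  qed
  fix X assume "X \<in> L"
  then obtain a b c Z where Z: "Z \<in> L" "bracket Z x1 = 0" "bracket Z x2 = 0" "bracket Z x3 = 0"
    and X: "X = mscale a x1 + (mscale b x2 + (mscale c x3 + Z))"
    using decomp by blast
  have "- ((letter Z * (letter x1 * letter x1) - letter x1 * letter x1 * letter Z)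
      + (letter Z * (letter x2 * letter x2) - letter x2 * letter x2 * letter Z)
      + (letter Z * (letter x3 * letter x3) - letter x3 * letter x3 * letter Z)) \<in> U_ideal L"
    using Z mem by (intro U_ideal_uminus U_ideal_add commute_letter)
  then have "letter Z * ?C - ?C * letter Z \<in> U_ideal L"
    by (simp add: casimir_def algebra_simps)
  then show "letter X * ?C - ?C * letter X \<in> U_ideal L"
    unfolding X using mem Z
    by (intro comm_add comm_scale L_add L_mscale) (simp_all add: casimir_commute)
qed

text \<open>With the root vector moved to the right, the Casimir element is - x1^2 + 2 \<i> x1 - (x2
  - \<i> x3)(x2 + \<i> x3), where \<open>[x2, x3] = 2 x1\<close> produces the linear term. The last
  product lies in the left ideal; the rest is evaluated at \<open>\<tau>\<close>.\<close>

lemma casimir_HC: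
  assumes h: "x1 \<in> h" and N: "x2 + mscale \<i> x3 \<in> N"
  shows "HC_value L h N \<tau> (casimir x1 x2 x3) (- (\<tau> x1)\<^sup>2 + 2 * \<i> * \<tau> x1)"
proof -
  let ?a = "letter x1" and ?b = "letter x2" and ?c = "letter x3" and ?e = "letter (x2 + mscale \<i> x3)"
  define y where "y = scalar (- 1) * ?a * ?a + scalar (2 * \<i>) * ?a"
  have y: "y = Poly_Mapping.single [x1, x1] (-1) + Poly_Mapping.single [x1] (2 * \<i>)"
    by (simp add: y_def letter_def mult_single plus_list_def)
  have "y \<in> free_over h"
    unfolding y_def using h by (intro free_over_intros) auto
  moreover have "free_eval \<tau> y = - (\<tau> x1)\<^sup>2 + 2 * \<i> * \<tau> x1"
    by (simp add: y free_eval_add free_eval_single power2_eq_square)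
  moreover have "casimir x1 x2 x3 - y \<in> U_left_ideal L N"
  proof -
    define m where "m = - (?b - scalar \<i> * ?c)"
    have e: "?e - (?b + scalar \<i> * ?c) \<in> U_ideal L"
      using U_ideal_add[OF letter_add[OF mem(2) L_mscale[OF mem(3)], of \<i>] letter_mscale[OF mem(3), of \<i>]]
      by (simp add: algebra_simps)
    have m: "m \<in> free_over L" unfolding m_def using mem by (intro free_over_intros) auto
    have i: "z * (scalar \<i> * w) = scalar \<i> * (z * w)" for z w :: "(complex^'n^'n) free_alg"
      by (simp only: scalar_commute[of _ z, symmetric] flip: mult.assoc)
    have "scalar \<i> * scalar \<i> = (- 1 :: (complex^'n^'n) free_alg)"
      by (simp only: mult_scalar) (simp add: single_uminus)
    then have ii: "scalar \<i> * (scalar \<i> * z) = - z" "scalar (2 * \<i>) = scalar \<i> + scalar \<i>" "scalar (-1) = - 1"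
      for z :: "(complex^'n^'n) free_alg"
      by (simp_all add: single_uminus flip: mult.assoc single_add)
    have y': "y = - (?a * ?a) + (scalar \<i> + scalar \<i>) * ?a"
      unfolding y_def ii(2,3) by simp
    have "m * (?b + scalar \<i> * ?c) = - (?b * ?b) - ?c * ?c - scalar \<i> * (?b * ?c - ?c * ?b)"
      by (simp add: m_def ii i[of ?b] i[of ?c] algebra_simps)
    then have "casimir x1 x2 x3 - y - m * ?e
      = scalar \<i> * (?b * ?c - ?c * ?b - (?a + ?a)) - m * (?e - (?b + scalar \<i> * ?c))"
      by (simp add: casimir_def y' algebra_simps)
    moreover have "\<dots> \<in> U_ideal L"
      using letter_br[OF mem(2,3,1) br(2)]
      by (intro U_ideal_diff[OF U_ideal_mult_left U_ideal_mult_left] e m)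
         (simp_all only: scalar_numeral mult_2 free_over_scalar)
    ultimately have "casimir x1 x2 x3 - y - m * ?e \<in> U_left_ideal L N"
      by (simp only: U_left_ideal.base)
    from U_left_ideal.add[OF this m N] show ?thesis by simp
  qed
  ultimately show ?thesis using casimir_central
    unfolding HC_value_def by (intro conjI bexI[of _ y]) simp_all
qed

end

section \<open>The center modulo the Casimir element\<close>

text \<open>\<open>filt J S X n\<close> consists, modulo \<open>J\<close>, of the sums of products of at most \<open>n\<close> factors from \<open>X\<close>
  with coefficients from \<open>S\<close>.\<close>

inductive filt :: "'r::ring_1 set \<Rightarrow> 'r set \<Rightarrow> 'r set \<Rightarrow> nat \<Rightarrow> 'r \<Rightarrow> bool" for J S X where
  base: "a \<in> S \<Longrightarrow> filt J S X 0 a"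
| step: "filt J S X n a \<Longrightarrow> x \<in> X \<Longrightarrow> filt J S X (Suc n) (x * a)"
| mono: "filt J S X n a \<Longrightarrow> filt J S X (Suc n) a"
| add: "filt J S X n a \<Longrightarrow> filt J S X n b \<Longrightarrow> filt J S X n (a + b)"
| cong: "filt J S X n a \<Longrightarrow> b - a \<in> J \<Longrightarrow> filt J S X n b"

text \<open>One copy of sl(2,C) modulo a two-sided ideal \<open>J\<close> in which its Casimir
  element is a scalar, with coefficients \<open>S\<close> that commute with it. It is used twice:
  with \<open>S\<close> the words in the other copy, and for that other copy with \<open>S\<close>
  the scalars.\<close>

locale quaternion_filtration =
  fixes J S :: "'r::ring_1 set" and sc :: "complex \<Rightarrow> 'r" and x1 x2 x3 :: 'r and k :: complex
  assumes J_add: "a \<in> J \<Longrightarrow> b \<in> J \<Longrightarrow> a + b \<in> J"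
    and J_left: "a \<in> J \<Longrightarrow> r * a \<in> J" and J_right: "a \<in> J \<Longrightarrow> a * r \<in> J"
    and sc_commute: "sc c * r = r * sc c" and sc_mult: "sc (c * d) = sc c * sc d"
    and sc_nat: "sc (of_nat m) = of_nat m" and sc_minus: "sc (- c) = - sc c"
    and S_add: "a \<in> S \<Longrightarrow> b \<in> S \<Longrightarrow> a + b \<in> S"
    and S_scale: "a \<in> S \<Longrightarrow> sc c * a \<in> S" and S_zero: "0 \<in> S"
    and S_commute1: "a \<in> S \<Longrightarrow> x1 * a - a * x1 \<in> J"
    and S_commute2: "a \<in> S \<Longrightarrow> x2 * a - a * x2 \<in> J"
    and S_commute3: "a \<in> S \<Longrightarrow> x3 * a - a * x3 \<in> J"
    and r12: "x1 * x2 - x2 * x1 - (x3 + x3) \<in> J" and r23: "x2 * x3 - x3 * x2 - (x1 + x1) \<in> J"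
    and r31: "x3 * x1 - x1 * x3 - (x2 + x2) \<in> J"
    and quad: "x1 * x1 + x2 * x2 + x3 * x3 - sc k \<in> J"
begin

abbreviation "X \<equiv> {x1, x2, x3}"
abbreviation "F \<equiv> filt J S X"

text \<open>These name the defects of the relations. Congruences modulo \<open>J\<close> below are
  obtained by writing the difference as an explicit combination of defects, which is an identity
  valid in every ring.\<close>

definition "q12 = x1 * x2 - x2 * x1 - (x3 + x3)"
definition "q23 = x2 * x3 - x3 * x2 - (x1 + x1)"
definition "q31 = x3 * x1 - x1 * x3 - (x2 + x2)"
definition "q = x1 * x1 + x2 * x2 + x3 * x3 - sc k"

lemma q_J: "q12 \<in> J" "q23 \<in> J" "q31 \<in> J" "q \<in> J"
  using r12 r23 r31 quad by (simp_all add: q12_def q23_def q31_def q_def)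

lemmas q_defs = q12_def q23_def q31_def q_def

text \<open>Cyclic symmetry of the relations reduces statements about one distinguished generator to
  \<open>x1\<close>.\<close>

lemma rotate: "quaternion_filtration J S sc x2 x3 x1 k"
proof
  show "x2 * x2 + x3 * x3 + x1 * x1 - sc k \<in> J" using quad by (simp add: add_ac)
qed (fact J_add J_left J_right sc_commute sc_mult sc_nat sc_minus S_add S_scale S_zero
    S_commute1 S_commute2 S_commute3 r12 r23 r31)+

lemma rotate_X: "{x2, x3, x1} = X" "{x3, x1, x2} = X"
  by auto

lemma J_minus: "a \<in> J \<Longrightarrow> - a \<in> J"
  using J_left[of a "- 1"] by simp

lemma J_diff: "a \<in> J \<Longrightarrow> b \<in> J \<Longrightarrow> a - b \<in> J"
  using J_add[OF _ J_minus, of a b] by simp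

lemma F_scale: "F n a \<Longrightarrow> F n (sc c * a)"
proof (induction rule: filt.induct)
  case (base a)
  then show ?case by (intro filt.base S_scale)
next
  case (step n a x)
  have "sc c * (x * a) = x * (sc c * a)" by (simp only: sc_commute[of c x] flip: mult.assoc)
  then show ?case using filt.step[OF step.IH step.hyps(2)] by simp
next
  case (cong n a b)
  have "sc c * b - sc c * a \<in> J" using J_left[OF cong.hyps(2), of "sc c"] by (simp add: right_diff_distrib)
  then show ?case using cong.IH filt.cong by blast
qed (simp_all add: filt.mono filt.add distrib_left)

lemma F_J: "a \<in> J \<Longrightarrow> F n a"
proof -
  assume a: "a \<in> J"
  have "F 0 0" using S_zero by (rule filt.base)
  then have "F n 0" by (induction n) (simp_all add: filt.mono)
  then show ?thesis using a filt.cong[of J S X n 0 a] by simp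
qed

lemma F_of_nat: "F n a \<Longrightarrow> F n (of_nat m * a)"
  using F_scale[of n a "of_nat m"] by (simp add: sc_nat)

lemma F_minus: "F n a \<Longrightarrow> F n (- a)"
  using F_scale[of n a "- of_nat 1"] by (simp only: sc_minus sc_nat) simp

lemma F_diff:
  assumes "F n a" "F n b" shows "F n (a - b)"
  using filt.add[OF assms(1) F_minus[OF assms(2)]] by simp

lemma F_step: "F n a \<Longrightarrow> F (Suc n) (x1 * a)" "F n a \<Longrightarrow> F (Suc n) (x2 * a)" "F n a \<Longrightarrow> F (Suc n) (x3 * a)"
  by (simp_all add: filt.step)

lemma F_double: "F n a \<Longrightarrow> F n (a + a)"
  by (rule filt.add)

lemma F_cong: "F n a \<Longrightarrow> b - a = c \<Longrightarrow> c \<in> J \<Longrightarrow> F n b"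
  using filt.cong by blast

lemma F_br:
  assumes "F n a" "u - (z + z) \<in> J" "z \<in> X" shows "F (Suc n) (u * a)"
proof (rule F_cong)
  show "F (Suc n) (z * a + z * a)" using assms by (intro filt.add filt.step)
  show "u * a - (z * a + z * a) = (u - (z + z)) * a" by (simp add: algebra_simps)
qed (intro J_right assms)

text \<open>The commutator with \<open>x1\<close> is a derivation that sends each generator to a
  multiple of a generator modulo \<open>J\<close>, so it does not raise the degree.\<close>

lemma F_commutator1: "F n a \<Longrightarrow> F n (x1 * a - a * x1)"
proof (induction rule: filt.induct)
  case (base a)
  then show ?case by (intro F_J S_commute1)
next
  case (step n a x)
  have "F (Suc n) ((x1 * x - x * x1) * a)"
    using step.hyps(2)
  proof (elim insertE emptyE)
    assume "x = x1" then show ?thesis using F_J[OF J_diff[OF quad quad]] by simp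
  next
    assume "x = x2" then show ?thesis using F_br[OF step.hyps(1) r12] by simp
  next
    assume "x = x3"
    then show ?thesis using F_minus[OF F_br[OF step.hyps(1) r31]] by (simp add: algebra_simps)
  qed
  from filt.add[OF this filt.step[OF step.IH step.hyps(2)]]
  show ?case by (simp add: algebra_simps)
next
  case (add n a b)
  from filt.add[OF add.IH] show ?case by (simp add: algebra_simps)
next
  case (cong n a b)
  show ?case
    by (rule F_cong[OF cong.IH _ J_diff[OF J_left[OF cong.hyps(2), of x1] J_right[OF cong.hyps(2), of x1]]])
       (simp add: algebra_simps)
qed (rule filt.mono)

lemma F_commutator: "F n a \<Longrightarrow> x \<in> X \<Longrightarrow> F n (x * a - a * x)"
  using F_commutator1 quaternion_filtration.F_commutator1[OF rotate]
    quaternion_filtration.F_commutator1[OF quaternion_filtration.rotate[OF rotate]]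
  by (auto simp: rotate_X)

text \<open>\<open>4 * G a\<close> is the cross term in the Leibniz rule for the operator
  \<open>D\<close> below, applied to \<open>x1 * a\<close>.\<close>

definition G where "G a = x2 * (x3 * a - a * x3) - x3 * (x2 * a - a * x2)"

text \<open>Since \<open>x1\<^sup>2 + x2\<^sup>2 + x3\<^sup>2\<close> is a scalar, \<open>G\<close> acts on the layer of degree \<open>n\<close> of the filtration like
  the multiplication by \<open>- 2 n x1\<close>, although it seems to raise the degree by one like the latter.\<close>

lemma F_G: "F n a \<Longrightarrow> F n (G a + of_nat (2 * n) * (x1 * a))"
proof (induction rule: filt.induct)
  case (base a)
  have "G a \<in> J"
    unfolding G_def by (rule J_diff[OF J_left[OF S_commute3[OF base]] J_left[OF S_commute2[OF base]]])
  then show ?case by (simp add: F_J)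
next
  case (mono n a)
  from filt.add[OF filt.mono[OF mono.IH] F_double[OF F_step(1)[OF mono.hyps]]]
  show ?case by (simp add: algebra_simps)
next
  case (add n a b)
  from filt.add[OF add.IH] show ?case by (simp add: G_def algebra_simps)
next
  case (cong n a b)
  define d where "d = b - a"
  have "d \<in> J" using cong.hyps(2) by (simp add: d_def)
  then have "G d + of_nat (2 * n) * (x1 * d) \<in> J"
    unfolding G_def by (blast intro: J_add J_diff J_left J_right)
  then show ?case by (rule F_cong[OF cong.IH, rotated]) (simp add: G_def d_def algebra_simps)
next
  case (step n a x)
  define N where "N = (of_nat (2 * n) :: 'r)"
  have N: "y * (N * z) = N * (y * z)" for y z
    by (simp only: N_def mult_of_nat_commute[of _ y] flip: mult.assoc)
  have N2: "of_nat (2 * Suc n) = N + 1 + 1" by (simp add: N_def)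
  define i where "i = G a + N * (x1 * a)"
  define c2 where "c2 = x2 * a - a * x2"
  define c3 where "c3 = x3 * a - a * x3"
  have Fi: "F n i" using step.IH by (simp add: N_def i_def)
  have Fc: "F n c2" "F n c3" using F_commutator[OF step.hyps(1)] by (auto simp: c2_def c3_def)
  have FN: "F (Suc n) (N * y)" if "F (Suc n) y" for y unfolding N_def using that by (rule F_of_nat)
  note a = step.hyps(1)
  have "F (Suc n) (G (x * a) + (N + 1 + 1) * (x1 * (x * a)))"
    using step.hyps(2)
  proof (elim insertE emptyE)
    \<comment> \<open>The terms 2 x_k^2 a, of apparent degree n + 2, combine to 2 k a; this is where
      the quadratic relation enters.\<close>
    assume x: "x = x1"
    show ?thesis
    proof (rule F_cong)
      show "F (Suc n) (x1 * i + (sc k * a + sc k * a) - (x2 * c2 + x2 * c2) - (x3 * c3 + x3 * c3))"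
        using Fi Fc a by (intro F_diff filt.add F_step) (simp_all add: filt.mono F_scale)
      show "(q23 * x1 - x1 * q23) * a + q12 * (a * x3) + q31 * (a * x2) + (q * a + q * a) \<in> J"
        using q_J by (blast intro: J_add J_diff J_left J_right)
    qed (simp add: x G_def q_defs i_def c2_def c3_def N algebra_simps)
  next
    \<comment> \<open>Pulling \<open>x2\<close> out of \<open>G\<close> leaves - 2 x2 x1 a, which
      the growth of the coefficient from 2n to 2(n+1) cancels up to brackets of lower
      degree.\<close>
    assume x: "x = x2"
    show ?thesis
    proof (rule F_cong)
      show "F (Suc n) (x2 * i + (x1 * c2 + x1 * c2) + (N * (x3 * a + x3 * a) + (x3 * a + x3 * a) + (x3 * a + x3 * a)))"
        using Fi Fc a by (intro F_diff filt.add FN F_step)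
      show "q23 * c2 - x2 * (q23 * a) + (N * (q12 * a) + q12 * a + q12 * a) \<in> J"
        using q_J by (blast intro: J_add J_diff J_left J_right)
    qed (simp add: x G_def q_defs i_def c2_def c3_def N algebra_simps)
  next
    assume x: "x = x3"
    show ?thesis
    proof (rule F_cong)
      show "F (Suc n) (x3 * i + (x1 * c3 + x1 * c3) - (N * (x2 * a + x2 * a) + (x2 * a + x2 * a) + (x2 * a + x2 * a)))"
        using Fi Fc a by (intro F_diff filt.add FN F_step)
      show "q23 * c3 - x3 * (q23 * a) - (N * (q31 * a) + q31 * a + q31 * a) \<in> J"
        using q_J by (blast intro: J_add J_diff J_left J_right)
    qed (simp add: x G_def q_defs i_def c2_def c3_def N algebra_simps)
  qed
  then show ?case by (simp only: N2)
qed

definition ad where "ad x a = x * a - a * x"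
definition D where "D a = ad x1 (ad x1 a) + ad x2 (ad x2 a) + ad x3 (ad x3 a)"

lemma D_diff: "D (a - b) = D a - D b"
  by (simp add: D_def ad_def algebra_simps)

lemma D_add: "D (a + b) = D a + D b"
  by (simp add: D_def ad_def algebra_simps)

lemma D_J: "a \<in> J \<Longrightarrow> D a \<in> J"
  unfolding D_def ad_def by (blast intro: J_add J_diff J_left J_right)

lemma ad_J: "a \<in> J \<Longrightarrow> ad x a \<in> J"
  unfolding ad_def by (rule J_diff[OF J_left J_right])

lemma D_in_J: "ad x1 a \<in> J \<Longrightarrow> ad x2 a \<in> J \<Longrightarrow> ad x3 a \<in> J \<Longrightarrow> D a \<in> J"
  unfolding D_def by (rule J_add[OF J_add[OF ad_J ad_J] ad_J])

lemma F_D: "F n a \<Longrightarrow> F n (D a)"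
  unfolding D_def ad_def by (intro filt.add F_commutator) auto

text \<open>Leibniz rule for a second-order operator: the cross terms 2 [x_k, x1] [x_k, a] add up to
  \<open>4 G a\<close>, and \<open>D x1 = - 8 x1\<close>.\<close>

lemma D_x1:
  "D (x1 * a) - (x1 * D a + (G a + G a + G a + G a) - of_nat 8 * (x1 * a)) \<in> J"
proof -
  let ?c2 = "x2 * a - a * x2" and ?c3 = "x3 * a - a * x3"
  have 8: "of_nat 8 * z = z + z + z + z + z + z + z + z" for z :: 'r
  proof -
    have "(of_nat 8 :: 'r) = 1 + 1 + 1 + 1 + 1 + 1 + 1 + 1" by simp
    then show ?thesis by (simp only: distrib_right mult_1_left)
  qed
  have "(x3 * q31 - q31 * x3 - (x2 * q12 - q12 * x2)) * a - (q23 + q23 + q23 + q23) * a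
      - (q12 * ?c2 + q12 * ?c2) + (q31 * ?c3 + q31 * ?c3) \<in> J"
    using q_J by (blast intro: J_add J_diff J_left J_right)
  also have "(x3 * q31 - q31 * x3 - (x2 * q12 - q12 * x2)) * a - (q23 + q23 + q23 + q23) * a
      - (q12 * ?c2 + q12 * ?c2) + (q31 * ?c3 + q31 * ?c3)
    = D (x1 * a) - (x1 * D a + (G a + G a + G a + G a) - of_nat 8 * (x1 * a))"
    unfolding 8 by (simp add: D_def ad_def G_def q_defs algebra_simps)
  finally show ?thesis .
qed

text \<open>\<open>G\<close> singles out \<open>x1\<close>; behind an existential quantifier the
  statement becomes accessible to \<open>rotate\<close>.\<close>

lemma D_step1:
  assumes "F n a"
  shows "\<exists>g. F n (g + of_nat (2 * n) * (x1 * a)) \<and>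
    D (x1 * a) - (x1 * D a + (g + g + g + g) - of_nat 8 * (x1 * a)) \<in> J"
  using F_G[OF assms] D_x1 by blast

lemma rotate_D: "quaternion_filtration.D x2 x3 x1 = D"
  by (simp add: fun_eq_iff D_def quaternion_filtration.D_def[OF rotate]
      ad_def quaternion_filtration.ad_def[OF rotate] add_ac)

lemma D_step:
  assumes "F n a" "x \<in> X"
  shows "\<exists>g. F n (g + of_nat (2 * n) * (x * a)) \<and>
    D (x * a) - (x * D a + (g + g + g + g) - of_nat 8 * (x * a)) \<in> J"
  using assms D_step1[of n a] quaternion_filtration.D_step1[OF rotate, of n a]
    quaternion_filtration.D_step1[OF quaternion_filtration.rotate[OF rotate], of n a]
  by (auto simp: rotate_X rotate_D quaternion_filtration.rotate_D[OF rotate])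

text \<open>In the step from n to n + 1 the scalar - 4 n (n + 1) is increased by - 8 n from
  \<open>4 G\<close> and by - 8 from \<open>D x\<close>, which gives - 4 (n + 1)(n + 2). Below
  degree 0 there is only \<open>J\<close>, whence the case distinction.\<close>

lemma D_layer:
  "F n a \<Longrightarrow> (case n of 0 \<Rightarrow> D a \<in> J | Suc m \<Rightarrow> F m (D a + of_nat (4 * n * (n + 1)) * a))"
proof (induction rule: filt.induct)
  case (base a)
  then show ?case by (simp add: D_in_J ad_def S_commute1 S_commute2 S_commute3)
next
  case (step n a x)
  obtain g where g: "F n (g + of_nat (2 * n) * (x * a))"
    and gJ: "D (x * a) - (x * D a + (g + g + g + g) - of_nat 8 * (x * a)) \<in> J"
    using D_step[OF step.hyps] by blast
  let ?g = "g + of_nat (2 * n) * (x * a)"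
  define N where "N = (of_nat (4 * n * (n + 1)) :: 'r)"
  define M where "M = (of_nat (2 * n) :: 'r)"
  have N: "y * (N * z) = N * (y * z)" for y z
    by (simp only: N_def mult_of_nat_commute[of _ y] flip: mult.assoc)
  \<comment> \<open>Here \<open>4 (n + 1) (n + 2) = 4 n (n + 1) + 4 (2 n) + 8\<close>: one
    \<open>M\<close> for each copy of \<open>g\<close>.\<close>
  have N2: "of_nat (4 * Suc n * (Suc n + 1)) = N + M + M + M + M + of_nat 8"
    unfolding N_def M_def by (simp only: of_nat_add[symmetric]) (simp add: algebra_simps)
  have x: "F n (x * (D a + N * a))"
  proof (cases n)
    case 0
    then show ?thesis using step.IH by (auto simp: N_def intro!: F_J J_left)
  next
    case (Suc m)
    then show ?thesis using step.IH step.hyps(2) by (auto simp: N_def intro!: filt.step)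
  qed
  show ?case unfolding nat.case N2
  proof (rule F_cong[OF _ _ gJ])
    show "F n (x * (D a + N * a) + (?g + ?g + ?g + ?g))"
      by (rule filt.add[OF x filt.add[OF filt.add[OF filt.add[OF g g] g] g]])
  qed (unfold M_def[symmetric], simp add: N algebra_simps)
next
  case (mono n a)
  from filt.add[OF F_D[OF mono.hyps] F_of_nat[OF mono.hyps]] show ?case unfolding nat.case .
next
  case (add n a b)
  show ?case
  proof (cases n)
    case 0
    then show ?thesis using add.IH by (simp add: D_add J_add)
  next
    case (Suc m)
    then show ?thesis using filt.add[of J S X m, OF add.IH[unfolded Suc nat.case]]
      by (simp add: D_add algebra_simps)
  qed
next
  case (cong n a b)
  have Dba: "D (b - a) \<in> J" using cong.hyps(2) by (rule D_J)
  show ?case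
  proof (cases n)
    case 0
    then show ?thesis using cong.IH J_add[OF _ Dba, of "D a"] by (simp add: D_diff)
  next
    case (Suc m)
    have J: "D (b - a) + of_nat (4 * n * (n + 1)) * (b - a) \<in> J"
      by (rule J_add[OF Dba J_left[OF cong.hyps(2)]])
    from cong.IH have IH: "F m (D a + of_nat (4 * n * (n + 1)) * a)" by (simp add: Suc)
    have "F m (D b + of_nat (4 * n * (n + 1)) * b)"
      by (rule F_cong[OF IH _ J]) (simp add: D_diff algebra_simps del: of_nat_mult)
    then show ?thesis by (simp add: Suc)
  qed
qed

lemma F_0: "F n a \<Longrightarrow> n = 0 \<Longrightarrow> \<exists>b\<in>S. a - b \<in> J"
proof (induction rule: filt.induct)
  case (base a)
  then show ?case using J_diff[OF quad quad] by force
next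
  case (add n a b)
  then obtain a' b' where "a' \<in> S" "b' \<in> S" "a - a' \<in> J" "b - b' \<in> J" by blast
  then have "a' + b' \<in> S" "(a - a') + (b - b') \<in> J" using S_add J_add by blast+
  moreover have "(a - a') + (b - b') = (a + b) - (a' + b')" by simp
  ultimately show ?case by metis
next
  case (cong n a b)
  then obtain a' where a': "a' \<in> S" "a - a' \<in> J" by blast
  have "(b - a) + (a - a') \<in> J" using cong.hyps(2) a'(2) by (rule J_add)
  then show ?case using a'(1) by auto
qed simp_all

text \<open>\<open>D z\<close> lies in \<open>J\<close>, so a nonzero integer multiple of
  \<open>z\<close> drops to the next lower layer; dividing by it through \<open>sc\<close> lets the
  descent continue down to degree 0.\<close>

theorem central_in_S:
  assumes "F n z" "x1 * z - z * x1 \<in> J" "x2 * z - z * x2 \<in> J" "x3 * z - z * x3 \<in> J"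
  shows "\<exists>b\<in>S. z - b \<in> J"
  using assms
proof (induction n)
  case 0
  then show ?case using F_0 by blast
next
  case (Suc n)
  have "D z \<in> J" using Suc.prems(2-4) by (simp add: D_in_J ad_def)
  define N where "N = 4 * Suc n * (Suc n + 1)"
  have "N \<noteq> 0" by (simp add: N_def)
  have "F n (D z + of_nat N * z)" using D_layer[OF Suc.prems(1)] unfolding N_def nat.case .
  then have "F n (of_nat N * z)"
    by (rule F_cong[OF _ _ J_minus[OF \<open>D z \<in> J\<close>]]) simp
  then have "F n (sc (1 / of_nat N) * (of_nat N * z))" by (rule F_scale)
  moreover have "sc (1 / of_nat N) * (of_nat N * z) = z"
  proof -
    have "sc (1 / of_nat N) * sc (of_nat N) = sc (of_nat 1)"
      unfolding sc_mult[symmetric] using \<open>N \<noteq> 0\<close> by simp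
    then have "sc (1 / of_nat N) * of_nat N = 1" unfolding sc_nat by simp
    then show ?thesis by (simp flip: mult.assoc)
  qed
  ultimately have "F n z" by simp
  then show ?case using Suc by blast
qed

end

section \<open>Quaternionic bases of o(4,C) and o(3,C)\<close>

definition skew :: "4 \<Rightarrow> 4 \<Rightarrow> complex^4^4" where
  "skew a b = (\<chi> i j. if i = a \<and> j = b then 1 else if i = b \<and> j = a then - 1 else 0)"

text \<open>For \<open>\<epsilon> = 1\<close> and \<open>\<epsilon> = - 1\<close>, these are bases of the two ideals of o(4,C), acting on \<open>C\<^sup>4\<close> by left
  and right multiplication with quaternions.\<close>

definition q1 :: "complex \<Rightarrow> complex^4^4" where "q1 \<epsilon> = skew 2 1 + mscale \<epsilon> (skew 4 3)"
definition q2 :: "complex \<Rightarrow> complex^4^4" where "q2 \<epsilon> = skew 3 1 + mscale \<epsilon> (skew 2 4)"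
definition q3 :: "complex \<Rightarrow> complex^4^4" where "q3 \<epsilon> = skew 3 2 + mscale \<epsilon> (skew 4 1)"

definition c1 :: "complex \<Rightarrow> complex^4^4 \<Rightarrow> complex" where "c1 \<epsilon> X = (X $ 2 $ 1 + \<epsilon> * X $ 4 $ 3) / 2"
definition c2 :: "complex \<Rightarrow> complex^4^4 \<Rightarrow> complex" where "c2 \<epsilon> X = (X $ 3 $ 1 + \<epsilon> * X $ 2 $ 4) / 2"
definition c3 :: "complex \<Rightarrow> complex^4^4 \<Rightarrow> complex" where "c3 \<epsilon> X = (X $ 3 $ 2 + \<epsilon> * X $ 4 $ 1) / 2"

lemmas q_entries = q1_def q2_def q3_def skew_def mscale_def
lemmas c_defs = c1_def c2_def c3_def

lemma q_in_o4: "q1 \<epsilon> \<in> o4" "q2 \<epsilon> \<in> o4" "q3 \<epsilon> \<in> o4"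
  by (simp_all add: o4_iff forall_4 q_entries)

lemma o4_entries:
  assumes "X \<in> o4"
  shows "X $ 1 $ 1 = 0" "X $ 2 $ 2 = 0" "X $ 3 $ 3 = 0" "X $ 4 $ 4 = 0"
    "X $ 1 $ 2 = - X $ 2 $ 1" "X $ 1 $ 3 = - X $ 3 $ 1" "X $ 1 $ 4 = - X $ 4 $ 1"
    "X $ 2 $ 3 = - X $ 3 $ 2" "X $ 4 $ 2 = - X $ 2 $ 4" "X $ 3 $ 4 = - X $ 4 $ 3"
  using o4D[OF assms, of 1 1] o4D[OF assms, of 2 2] o4D[OF assms, of 3 3] o4D[OF assms, of 4 4]
    o4D[OF assms, of 1 2] o4D[OF assms, of 1 3] o4D[OF assms, of 1 4]
    o4D[OF assms, of 2 3] o4D[OF assms, of 4 2] o4D[OF assms, of 3 4]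
  by (simp_all add: eq_neg_iff_add_eq_0)

lemma o4_expand:
  assumes "X \<in> o4" "\<epsilon> = 1 \<or> \<epsilon> = - 1"
  shows "X = mscale (c1 \<epsilon> X) (q1 \<epsilon>) + (mscale (c2 \<epsilon> X) (q2 \<epsilon>) + (mscale (c3 \<epsilon> X) (q3 \<epsilon>) +
    (mscale (c1 (- \<epsilon>) X) (q1 (- \<epsilon>)) + (mscale (c2 (- \<epsilon>) X) (q2 (- \<epsilon>)) + mscale (c3 (- \<epsilon>) X) (q3 (- \<epsilon>))))))"
  using assms(2)
  by (auto simp: vec_eq_iff forall_4 q_entries c_defs o4_entries[OF assms(1)] field_simps)

lemma o4_zeroI:
  assumes "X \<in> o4" "\<epsilon> = 1 \<or> \<epsilon> = - 1"
    and "c1 \<epsilon> X = 0" "c2 \<epsilon> X = 0" "c3 \<epsilon> X = 0" "c1 (- \<epsilon>) X = 0" "c2 (- \<epsilon>) X = 0" "c3 (- \<epsilon>) X = 0"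
  shows "X = 0"
  by (subst o4_expand[OF assms(1,2)]) (simp add: assms(3-) mscale_def vec_eq_iff)

lemma bracket_components:
  assumes "X \<in> o4" "Y \<in> o4" "\<epsilon> = 1 \<or> \<epsilon> = - 1"
  shows "c1 \<epsilon> (bracket X Y) = 2 * (c2 \<epsilon> X * c3 \<epsilon> Y - c3 \<epsilon> X * c2 \<epsilon> Y)"
    "c2 \<epsilon> (bracket X Y) = 2 * (c3 \<epsilon> X * c1 \<epsilon> Y - c1 \<epsilon> X * c3 \<epsilon> Y)"
    "c3 \<epsilon> (bracket X Y) = 2 * (c1 \<epsilon> X * c2 \<epsilon> Y - c2 \<epsilon> X * c1 \<epsilon> Y)"
  using assms(3)
  by (auto simp: c_defs bracket_def matrix_matrix_mult_def sum_4 o4_entries[OF assms(1)]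
      o4_entries[OF assms(2)] field_simps)

lemma component_linear:
  "c1 \<epsilon> (X + Y) = c1 \<epsilon> X + c1 \<epsilon> Y" "c2 \<epsilon> (X + Y) = c2 \<epsilon> X + c2 \<epsilon> Y" "c3 \<epsilon> (X + Y) = c3 \<epsilon> X + c3 \<epsilon> Y"
  "c1 \<epsilon> (mscale a X) = a * c1 \<epsilon> X" "c2 \<epsilon> (mscale a X) = a * c2 \<epsilon> X" "c3 \<epsilon> (mscale a X) = a * c3 \<epsilon> X"
  by (simp_all add: c_defs mscale_def field_simps)

lemma q_components:
  assumes "\<epsilon> = 1 \<or> \<epsilon> = - 1"
  shows "c1 \<epsilon> (q1 \<epsilon>) = 1" "c2 \<epsilon> (q1 \<epsilon>) = 0" "c3 \<epsilon> (q1 \<epsilon>) = 0" "c1 (- \<epsilon>) (q1 \<epsilon>) = 0" "c2 (- \<epsilon>) (q1 \<epsilon>) = 0" "c3 (- \<epsilon>) (q1 \<epsilon>) = 0"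
    "c1 \<epsilon> (q2 \<epsilon>) = 0" "c2 \<epsilon> (q2 \<epsilon>) = 1" "c3 \<epsilon> (q2 \<epsilon>) = 0" "c1 (- \<epsilon>) (q2 \<epsilon>) = 0" "c2 (- \<epsilon>) (q2 \<epsilon>) = 0" "c3 (- \<epsilon>) (q2 \<epsilon>) = 0"
    "c1 \<epsilon> (q3 \<epsilon>) = 0" "c2 \<epsilon> (q3 \<epsilon>) = 0" "c3 \<epsilon> (q3 \<epsilon>) = 1" "c1 (- \<epsilon>) (q3 \<epsilon>) = 0" "c2 (- \<epsilon>) (q3 \<epsilon>) = 0" "c3 (- \<epsilon>) (q3 \<epsilon>) = 0"
  using assms by (auto simp: c_defs q_entries)

lemma q_brackets:
  assumes "\<epsilon> = 1 \<or> \<epsilon> = - 1"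
  shows "bracket (q1 \<epsilon>) (q2 \<epsilon>) = mscale 2 (q3 \<epsilon>)" "bracket (q2 \<epsilon>) (q3 \<epsilon>) = mscale 2 (q1 \<epsilon>)"
    "bracket (q3 \<epsilon>) (q1 \<epsilon>) = mscale 2 (q2 \<epsilon>)"
  using assms by (auto simp: vec_eq_iff forall_4 bracket_def matrix_matrix_mult_def sum_4 q_entries)

lemma q_opposite_commute:
  assumes "\<epsilon> = 1 \<or> \<epsilon> = - 1" "x \<in> {q1 (- \<epsilon>), q2 (- \<epsilon>), q3 (- \<epsilon>)}" "y \<in> {q1 \<epsilon>, q2 \<epsilon>, q3 \<epsilon>}"
  shows "bracket x y = 0"
proof -
  have o4: "bracket x y \<in> o4" "x \<in> o4" "y \<in> o4" using assms(2,3) q_in_o4 o4_bracket by auto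
  have m: "- \<epsilon> = 1 \<or> - \<epsilon> = - 1" using assms(1) by auto
  note br = bracket_components[OF o4(2,3) assms(1)] bracket_components[OF o4(2,3) m]
  show ?thesis
    by (rule o4_zeroI[OF o4(1) assms(1)]; unfold br; use assms(2,3) in
        \<open>auto simp: q_components[OF assms(1)] q_components[OF m, unfolded minus_minus]\<close>)
qed

lemma mscale_bracket: "bracket (mscale a X) Y = mscale a (bracket X Y)"
  by (simp add: bracket_def mscale_def vec_eq_iff matrix_matrix_mult_def sum_distrib_left algebra_simps)

lemma add_bracket: "bracket (X + X') Y = bracket X Y + bracket X' Y"
  by (simp add: bracket_def vec_eq_iff matrix_matrix_mult_def algebra_simps sum.distrib)

lemma mscale_0 [simp]: "mscale a 0 = 0"
  by (simp add: mscale_def vec_eq_iff)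

lemma quaternion_triple_o4:
  assumes \<epsilon>: "\<epsilon> = 1 \<or> \<epsilon> = - 1"
  shows "quaternion_triple o4 (q1 \<epsilon>) (q2 \<epsilon>) (q3 \<epsilon>)"
proof
  fix X assume X: "X \<in> o4"
  define Z where "Z = mscale (c1 (- \<epsilon>) X) (q1 (- \<epsilon>)) + (mscale (c2 (- \<epsilon>) X) (q2 (- \<epsilon>)) + mscale (c3 (- \<epsilon>) X) (q3 (- \<epsilon>)))"
  have "Z \<in> o4" unfolding Z_def by (intro o4_add o4_mscale q_in_o4)
  moreover have "X = mscale (c1 \<epsilon> X) (q1 \<epsilon>) + (mscale (c2 \<epsilon> X) (q2 \<epsilon>) + (mscale (c3 \<epsilon> X) (q3 \<epsilon>) + Z))"
    unfolding Z_def by (rule o4_expand[OF X \<epsilon>])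
  moreover have "bracket Z y = 0" if "y \<in> {q1 \<epsilon>, q2 \<epsilon>, q3 \<epsilon>}" for y
    using q_opposite_commute[OF \<epsilon> _ that] by (simp add: Z_def add_bracket mscale_bracket)
  ultimately show "\<exists>a b c Z. Z \<in> o4 \<and> X = mscale a (q1 \<epsilon>) + (mscale b (q2 \<epsilon>) + (mscale c (q3 \<epsilon>) + Z)) \<and>
      bracket Z (q1 \<epsilon>) = 0 \<and> bracket Z (q2 \<epsilon>) = 0 \<and> bracket Z (q3 \<epsilon>) = 0"
    by blast
qed (intro q_in_o4 q_brackets \<epsilon> o4_add o4_mscale; assumption)+

text \<open>With the factor 2 these are the sums of matching units of the two ideals, hence obey the
  same brackets as each of them.\<close>

abbreviation "j1 \<equiv> mscale 2 (skew 2 1)"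
abbreviation "j2 \<equiv> mscale 2 (skew 3 1)"
abbreviation "j3 \<equiv> mscale 2 (skew 3 2)"

lemma j_eq: "j1 = q1 1 + q1 (- 1)" "j2 = q2 1 + q2 (- 1)" "j3 = q3 1 + q3 (- 1)"
  by (simp_all add: q_entries vec_eq_iff)

lemma quaternion_triple_o3: "quaternion_triple o3 j1 j2 j3"
proof
  show "j1 \<in> o3" "j2 \<in> o3" "j3 \<in> o3"
    by (simp_all add: o3_def o4_iff forall_4 q_entries)
  show "bracket j1 j2 = mscale 2 j3" "bracket j2 j3 = mscale 2 j1" "bracket j3 j1 = mscale 2 j2"
    by (simp_all add: vec_eq_iff forall_4 bracket_def matrix_matrix_mult_def sum_4 q_entries)
  show "X + Y \<in> o3" if "X \<in> o3" "Y \<in> o3" for X Y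
    using that o4_add by (auto simp: o3_def)
  show "mscale c X \<in> o3" if "X \<in> o3" for c X
    using that o4_mscale by (auto simp: o3_def mscale_def)
  fix X assume X: "X \<in> o3"
  then have o4: "X \<in> o4" and 4: "X $ i $ 4 = 0" for i by (auto simp: o3_def)
  have "X = mscale (X $ 2 $ 1 / 2) j1 + (mscale (X $ 3 $ 1 / 2) j2 + (mscale (X $ 3 $ 2 / 2) j3 + 0))"
    using 4[of 1] 4[of 2] 4[of 3] by (simp add: vec_eq_iff forall_4 q_entries o4_entries[OF o4])
  moreover have "0 \<in> o3" by (simp add: o3_def o4_def vec_eq_iff transpose_def)
  moreover have "bracket 0 Y = 0" for Y :: "complex^4^4"
    by (simp add: bracket_def vec_eq_iff matrix_matrix_mult_def)
  ultimately show "\<exists>a b c Z. Z \<in> o3 \<and> X = mscale a j1 + (mscale b j2 + (mscale c j3 + Z)) \<and>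
      bracket Z j1 = 0 \<and> bracket Z j2 = 0 \<and> bracket Z j3 = 0"
    by blast
qed

abbreviation "cas \<epsilon> \<equiv> casimir (q1 \<epsilon>) (q2 \<epsilon>) (q3 \<epsilon>)"

text \<open>With w = l_1 - 1 + \<epsilon> l_2, \<open>casimir_HC\<close> gives w^2 + 2 w; undoing
  the shift by \<rho> = (1,0) completes the square.\<close>

lemma HC4_casimir:
  assumes "\<epsilon> = 1 \<or> \<epsilon> = - 1"
  shows "HC4 l (cas \<epsilon>) ((l $ 1 + \<epsilon> * l $ 2)\<^sup>2 - 1)"
proof -
  interpret quaternion_triple o4 "q1 \<epsilon>" "q2 \<epsilon>" "q3 \<epsilon>" by (rule quaternion_triple_o4[OF assms])
  have "q1 \<epsilon> = mscale (- \<i>) H1 + mscale (- \<i> * \<epsilon>) H2"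
    by (simp add: vec_eq_iff forall_4 H1_def H2_def q_entries algebra_simps)
  then have "q1 \<epsilon> \<in> cartan4" unfolding cartan4_def by blast
  moreover have "q2 \<epsilon> + mscale \<i> (q3 \<epsilon>) \<in> npos4"
    using o4_add[OF q_in_o4(2) o4_mscale[OF q_in_o4(3)]] assms unfolding npos4_def
    by (auto simp: vec_eq_iff forall_4 bracket_def matrix_matrix_mult_def sum_4 H1_def q_entries)
  moreover have "- (weight4 (l - axis 1 1) (q1 \<epsilon>))\<^sup>2 + 2 * \<i> * weight4 (l - axis 1 1) (q1 \<epsilon>)
      = (l $ 1 + \<epsilon> * l $ 2)\<^sup>2 - 1"
  proof -
    have w: "weight4 (l - axis 1 1) (q1 \<epsilon>) = - \<i> * (l $ 1 - 1 + \<epsilon> * l $ 2)"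
      by (simp add: weight4_def q_entries axis_def)
    show ?thesis unfolding w by (simp add: power2_eq_square algebra_simps)
  qed
  ultimately show ?thesis
    using casimir_HC[of cartan4 npos4 "weight4 (l - axis 1 1)"] by (simp add: HC4_def)
qed

text \<open>\<open>j1 = - 2 \<i> H1\<close> doubles the weight to 2n - 1, and the half sum 1/2 to
  the 1 that completes the square.\<close>

lemma HC3_casimir: "HC3 n (casimir j1 j2 j3) (4 * n\<^sup>2 - 1)"
proof -
  interpret quaternion_triple o3 j1 j2 j3 by (rule quaternion_triple_o3)
  have "j1 = mscale (- 2 * \<i>) H1"
    by (simp add: vec_eq_iff forall_4 H1_def q_entries)
  then have "j1 \<in> cartan3" unfolding cartan3_def by blast
  moreover have "j2 + mscale \<i> j3 \<in> npos3"
    using L_add[OF mem(2) L_mscale[OF mem(3)]] unfolding npos3_def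
    by (simp add: vec_eq_iff forall_4 bracket_def matrix_matrix_mult_def sum_4 H1_def q_entries algebra_simps)
  moreover have "- (weight3 (n - 1/2) j1)\<^sup>2 + 2 * \<i> * weight3 (n - 1/2) j1 = 4 * n\<^sup>2 - 1"
  proof -
    have w: "weight3 (n - 1/2) j1 = - \<i> * (2 * n - 1)"
      by (simp add: weight3_def q_entries algebra_simps)
    show ?thesis unfolding w by (simp add: power2_eq_square algebra_simps)
  qed
  ultimately show ?thesis
    using casimir_HC[of cartan3 npos3 "weight3 (n - 1/2)"] by (simp add: HC3_def)
qed

section \<open>The action of the enveloping algebra\<close>

context o4_rep
begin

text \<open>Extending \<open>\<rho>\<close> by zero makes all letters act linearly, so that \<open>free_act\<close> is multiplicative.\<close>

definition rho0 :: "complex^4^4 \<Rightarrow> 'v \<Rightarrow> 'v" where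
  "rho0 X v = (if X \<in> o4 then \<rho> X v else 0)"

lemma rho0_in [simp]: "X \<in> o4 \<Longrightarrow> rho0 X v = \<rho> X v" and rho0_notin [simp]: "X \<notin> o4 \<Longrightarrow> rho0 X v = 0"
  by (simp_all add: rho0_def)

lemma free_rep_rho0: "free_rep s rho0 UNIV"
proof (intro free_rep.intro free_rep_axioms.intro vector_space_axioms)
  fix X
  show "Vector_Spaces.linear s s (rho0 X)"
  proof (cases "X \<in> o4")
    case True
    then have "rho0 X = \<rho> X" by auto
    then show ?thesis using rho_linear[OF True] by simp
  next
    case False
    then have "rho0 X = (\<lambda>_. 0)" by auto
    then show ?thesis by (simp only:) (unfold_locales; simp)
  qed
qed

sublocale A: free_rep s rho0 UNIV by (rule free_rep_rho0)

lemma free_over_UNIV [simp]: "z \<in> free_over UNIV"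
  by (simp add: free_over_def)

lemma act_eq: "z \<in> free_over o4 \<Longrightarrow> free_act s \<rho> z v = A.act z v"
proof -
  assume z: "z \<in> free_over o4"
  have "foldr \<rho> w v = foldr rho0 w v" if "set w \<subseteq> o4" for w
    using that by (induction w) auto
  then show ?thesis using z unfolding free_act_def free_over_def by (intro sum.cong) auto
qed

lemma act_0_right [simp]: "A.act z 0 = 0"
  using Vector_Spaces.linear.axioms(3)[OF A.act_linear[OF free_over_UNIV]] by (rule module_hom.zero)

lemma act_scale_right: "A.act z (s c v) = s c (A.act z v)"
  using Vector_Spaces.linear.axioms(3)[OF A.act_linear[OF free_over_UNIV]] by (rule module_hom.scale)

lemma U_ideal_act: "z \<in> U_ideal o4 \<Longrightarrow> A.act z v = 0"
proof (induction arbitrary: v rule: U_ideal.induct)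
  case zero
  show ?case by simp
next
  case (add x a b r)
  have "A.act r w = 0" for w
    using \<open>r \<in> U_rel o4\<close>
    by (auto simp: U_rel_def A.act_diff A.act_mult A.act_single rho_plus rho_mscale rho_bracket
        o4_add o4_mscale o4_bracket)
  then show ?case using add.IH by (simp add: A.act_add A.act_mult)
qed

lemma act_casimir:
  "\<epsilon> = 1 \<or> \<epsilon> = - 1 \<Longrightarrow> free_act s \<rho> (cas \<epsilon>) v
    = - (\<rho> (q1 \<epsilon>) (\<rho> (q1 \<epsilon>) v) + \<rho> (q2 \<epsilon>) (\<rho> (q2 \<epsilon>) v) + \<rho> (q3 \<epsilon>) (\<rho> (q3 \<epsilon>) v))"
  using act_eq[OF quaternion_triple.casimir_free_over[OF quaternion_triple_o4], of \<epsilon>]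
  by (simp add: casimir_def A.act_uminus A.act_add A.act_diff A.act_mult q_in_o4)

end

section \<open>Verma modules\<close>

text \<open>\<open>sl2_op \<mu> p q r = p h + q e + r f\<close> on the weight basis \<open>f\<^sup>k v\<close> of the Verma module of sl(2,C) with
  highest weight \<open>\<mu>\<close>, extended to all integers \<open>k\<close>; functions are the coordinates.\<close>

definition sl2_op :: "complex \<Rightarrow> complex \<Rightarrow> complex \<Rightarrow> complex \<Rightarrow> (int \<Rightarrow> complex) \<Rightarrow> int \<Rightarrow> complex" where
  "sl2_op \<mu> p q r \<phi> k =
     p * (\<mu> - 2 * of_int k) * \<phi> k + q * ((of_int k + 1) * (\<mu> - of_int k)) * \<phi> (k + 1) + r * \<phi> (k - 1)"

lemma sl2_op_bracket:
  "sl2_op \<mu> p q r (sl2_op \<mu> p' q' r' \<phi>) k - sl2_op \<mu> p' q' r' (sl2_op \<mu> p q r \<phi>) k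
    = sl2_op \<mu> (q * r' - q' * r) (2 * (p * q' - p' * q)) (- 2 * (p * r' - p' * r)) \<phi> k"
  by (simp add: sl2_op_def) (simp add: algebra_simps)

text \<open>The generators are \<open>h = \<i> q1\<close>, \<open>2 e = q2 + \<i> q3\<close>, \<open>- 2 f = q2 - \<i> q3\<close>.\<close>

definition quat_op :: "complex \<Rightarrow> complex \<Rightarrow> complex^4^4 \<Rightarrow> (int \<Rightarrow> complex) \<Rightarrow> int \<Rightarrow> complex" where
  "quat_op \<mu> \<epsilon> X = sl2_op \<mu> (- \<i> * c1 \<epsilon> X) (c2 \<epsilon> X - \<i> * c3 \<epsilon> X) (- c2 \<epsilon> X - \<i> * c3 \<epsilon> X)"

text \<open>Outer tensor product of two Verma modules, one for each ideal. The highest weights are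
  the values of \<lambda> - \<rho> = (l_1 - 1, l_2) at
  \<open>\<i> q1 \<epsilon> = H1 + \<epsilon> H2\<close>.\<close>

definition verma :: "complex^2 \<Rightarrow> complex^4^4 \<Rightarrow> (int \<times> int \<Rightarrow> complex) \<Rightarrow> int \<times> int \<Rightarrow> complex" where
  "verma l X \<phi> = (\<lambda>(k, m). quat_op (l $ 1 + l $ 2 - 1) 1 X (\<lambda>k. \<phi> (k, m)) k
     + quat_op (l $ 1 - l $ 2 - 1) (- 1) X (\<lambda>m. \<phi> (k, m)) m)"

definition fun_scale :: "complex \<Rightarrow> ('i \<Rightarrow> complex) \<Rightarrow> 'i \<Rightarrow> complex" where
  "fun_scale c \<phi> = (\<lambda>i. c * \<phi> i)"

lemma fun_scale_apply [simp]: "fun_scale c \<phi> i = c * \<phi> i"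
  by (simp add: fun_scale_def)

lemma sl2_op_cong:
  "p = p' \<Longrightarrow> q = q' \<Longrightarrow> r = r' \<Longrightarrow> sl2_op \<mu> p q r \<phi> k = sl2_op \<mu> p' q' r' \<phi> k"
  by simp

lemma quat_op_bracket:
  assumes "X \<in> o4" "Y \<in> o4" "\<epsilon> = 1 \<or> \<epsilon> = - 1"
  shows "quat_op \<mu> \<epsilon> (bracket X Y) \<phi> k
    = quat_op \<mu> \<epsilon> X (quat_op \<mu> \<epsilon> Y \<phi>) k - quat_op \<mu> \<epsilon> Y (quat_op \<mu> \<epsilon> X \<phi>) k"
  unfolding quat_op_def sl2_op_bracket bracket_components[OF assms]
  by (rule sl2_op_cong) (simp_all add: algebra_simps)

lemma sl2_op_commute:
  "sl2_op \<mu> p q r (\<lambda>k. sl2_op \<mu>' p' q' r' (\<lambda>m. \<phi> (k, m)) m) k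
    = sl2_op \<mu>' p' q' r' (\<lambda>m. sl2_op \<mu> p q r (\<lambda>k. \<phi> (k, m)) k) m"
  by (simp add: sl2_op_def algebra_simps)

lemma quat_op_linear:
  "quat_op \<mu> \<epsilon> X (\<lambda>k. \<phi> k + \<psi> k) k = quat_op \<mu> \<epsilon> X \<phi> k + quat_op \<mu> \<epsilon> X \<psi> k"
  "quat_op \<mu> \<epsilon> X (\<lambda>k. c * \<phi> k) k = c * quat_op \<mu> \<epsilon> X \<phi> k"
  "quat_op \<mu> \<epsilon> (X + Y) \<phi> k = quat_op \<mu> \<epsilon> X \<phi> k + quat_op \<mu> \<epsilon> Y \<phi> k"
  "quat_op \<mu> \<epsilon> (mscale c X) \<phi> k = c * quat_op \<mu> \<epsilon> X \<phi> k"
  by (simp_all add: quat_op_def component_linear sl2_op_def algebra_simps)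

lemma vector_space_fun_scale: "vector_space fun_scale"
  by unfold_locales (simp_all add: fun_eq_iff algebra_simps)

lemma verma_o4_rep: "o4_rep fun_scale (verma l)"
proof (intro o4_rep.intro o4_rep_axioms.intro vector_space_fun_scale)
  fix X Y :: "complex^4^4" and \<phi> :: "int \<times> int \<Rightarrow> complex" and c
  show "Vector_Spaces.linear fun_scale fun_scale (verma l X)"
    by (intro Vector_Spaces.linear.intro vector_space_fun_scale module_hom.intro module_hom_axioms.intro
        vector_space_fun_scale[unfolded module_iff_vector_space[symmetric]])
       (simp_all add: verma_def fun_eq_iff quat_op_linear algebra_simps)
  assume "X \<in> o4"
  show "verma l (mscale c X) \<phi> = fun_scale c (verma l X \<phi>)"
    by (simp add: verma_def fun_eq_iff quat_op_linear algebra_simps)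
  assume "Y \<in> o4"
  show "verma l (X + Y) \<phi> = verma l X \<phi> + verma l Y \<phi>"
    by (simp add: verma_def fun_eq_iff quat_op_linear)
  show "verma l (bracket X Y) \<phi> = verma l X (verma l Y \<phi>) - verma l Y (verma l X \<phi>)"
    using quat_op_bracket[OF \<open>X \<in> o4\<close> \<open>Y \<in> o4\<close>]
    by (simp add: verma_def fun_eq_iff quat_op_linear)
       (simp add: quat_op_def sl2_op_commute)
qed

lemma quat_op_casimir:
  assumes "\<epsilon> = 1 \<or> \<epsilon> = - 1"
  shows "quat_op \<mu> \<epsilon> (q1 \<epsilon>) (quat_op \<mu> \<epsilon> (q1 \<epsilon>) \<phi>) k + quat_op \<mu> \<epsilon> (q2 \<epsilon>) (quat_op \<mu> \<epsilon> (q2 \<epsilon>) \<phi>) k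
    + quat_op \<mu> \<epsilon> (q3 \<epsilon>) (quat_op \<mu> \<epsilon> (q3 \<epsilon>) \<phi>) k = - (((\<mu> + 1)\<^sup>2 - 1) * \<phi> k)"
  by (simp add: quat_op_def q_components[OF assms]) (simp add: sl2_op_def algebra_simps power2_eq_square)

lemma quat_op_opposite:
  assumes "\<epsilon> = 1 \<or> \<epsilon> = - 1"
  shows "quat_op \<mu> (- \<epsilon>) (q1 \<epsilon>) \<phi> k = 0" "quat_op \<mu> (- \<epsilon>) (q2 \<epsilon>) \<phi> k = 0" "quat_op \<mu> (- \<epsilon>) (q3 \<epsilon>) \<phi> k = 0"
  by (simp_all add: quat_op_def q_components[OF assms] sl2_op_def)

lemma verma_casimir:
  assumes "\<epsilon> = 1 \<or> \<epsilon> = - 1"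
  shows "verma l (q1 \<epsilon>) (verma l (q1 \<epsilon>) \<phi>) + verma l (q2 \<epsilon>) (verma l (q2 \<epsilon>) \<phi>) + verma l (q3 \<epsilon>) (verma l (q3 \<epsilon>) \<phi>)
    = - fun_scale ((l $ 1 + \<epsilon> * l $ 2)\<^sup>2 - 1) \<phi>"
proof -
  have m: "1 = (1::complex) \<or> 1 = - (1::complex)" "- 1 = (1::complex) \<or> - 1 = - (1::complex)" by simp_all
  show ?thesis
    using assms quat_op_casimir[OF m(1)] quat_op_casimir[OF m(2)] quat_op_opposite[OF m(1)]
      quat_op_opposite[OF m(2), unfolded minus_minus]
    by (elim disjE) (simp_all add: verma_def fun_eq_iff)
qed

definition vacuum :: "int \<times> int \<Rightarrow> complex" where
  "vacuum = (\<lambda>i. if i = (0, 0) then 1 else 0)"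

text \<open>The coefficient k + 1 of the raising operator vanishes at k = - 1, so the extension to
  negative indices creates nothing above the vacuum.\<close>

lemma raise_vacuum:
  "sl2_op \<mu> 0 q 0 (\<lambda>k. vacuum (k, m)) k = 0" "sl2_op \<mu> 0 q 0 (\<lambda>m. vacuum (k, m)) m = 0"
  by (cases "k = - 1"; cases "m = - 1"; auto simp: sl2_op_def vacuum_def)+

text \<open>The eigenvalue equation for the bracket with \<open>H1\<close> leaves only the
  coefficients of the two raising operators.\<close>

lemma verma_npos4: "X \<in> npos4 \<Longrightarrow> verma l X vacuum = 0"
proof -
  assume X: "X \<in> npos4"
  then have o4: "X \<in> o4" and br: "bracket H1 X = X" by (auto simp: npos4_def)
  have "bracket H1 X $ i $ j = X $ i $ j" for i j by (simp add: br)
  note e = this[of 2 1] this[of 4 3] this[of 3 1] this[of 3 2] this[of 2 4] this[of 4 1]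
  have "X $ 2 $ 1 = 0" "X $ 4 $ 3 = 0" "X $ 3 $ 1 = - \<i> * X $ 3 $ 2" "X $ 2 $ 4 = - \<i> * X $ 4 $ 1"
    using e by (simp_all add: bracket_def matrix_matrix_mult_def sum_4 H1_def o4_entries[OF o4] algebra_simps)
  then have "c1 \<epsilon> X = 0" "- c2 \<epsilon> X - \<i> * c3 \<epsilon> X = 0" for \<epsilon>
    by (simp_all add: c_defs field_simps)
  then show ?thesis by (simp add: verma_def quat_op_def fun_eq_iff raise_vacuum)
qed

lemma verma_cartan4: "X \<in> cartan4 \<Longrightarrow> verma l X vacuum = fun_scale (weight4 (l - axis 1 1) X) vacuum"
  by (auto simp: cartan4_def verma_def quat_op_def c_defs sl2_op_def vacuum_def fun_eq_iff weight4_def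
      H1_def H2_def mscale_def axis_def algebra_simps) (simp add: field_simps)

text \<open>As rewrite rules, these would expand unapplied functions to abstractions.\<close>

declare fun_scale_apply [simp del] zero_fun_apply [simp del] plus_fun_apply [simp del]

section \<open>Central elements act by their Harish-Chandra values\<close>

text \<open>Serves for letters of the opposite ideal: they commute with the generators and are
  absorbed into the coefficients.\<close>

lemma (in quaternion_filtration) F_mult_commuting:
  assumes b: "\<And>x. x \<in> X \<Longrightarrow> b * x - x * b \<in> J" "\<And>a. a \<in> S \<Longrightarrow> b * a \<in> S" and "F n a"
  shows "F n (b * a)"
  using \<open>F n a\<close>
proof (induction rule: filt.induct)
  case (base a)
  then show ?case by (intro filt.base b)
next
  case (step n a x)
  have "b * (x * a) - x * (b * a) = (b * x - x * b) * a" by (simp add: algebra_simps)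
  then show ?case using filt.step[OF step.IH step.hyps(2)] J_right[OF b(1)[OF step.hyps(2)]] F_cong by metis
next
  case (cong n a b')
  have "b * b' - b * a \<in> J" using J_left[OF cong.hyps(2), of b] by (simp add: right_diff_distrib)
  then show ?case using cong.IH filt.cong by blast
qed (simp_all add: filt.mono filt.add distrib_left)

lemma (in quaternion_filtration) F_mono: "F n a \<Longrightarrow> n \<le> m \<Longrightarrow> F m a"
  by (induction m) (auto simp: le_Suc_eq intro: filt.mono)

text \<open>Every element has a finite degree. The factor \<open>a\<close> is general because a
  product applies its left factor to the result for its right factor.\<close>

lemma filt_exhausts:
  fixes J S :: "'a free_alg set"
  assumes "quaternion_filtration J S scalar x1 x2 x3 k"
    and letters: "\<And>Y n a. Y \<in> L \<Longrightarrow> filt J S {x1, x2, x3} n a \<Longrightarrow> filt J S {x1, x2, x3} (Suc n) (letter Y * a)"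
  shows "z \<in> free_over L \<Longrightarrow> filt J S {x1, x2, x3} n a \<Longrightarrow> \<exists>m. filt J S {x1, x2, x3} m (z * a)"
proof -
  interpret quaternion_filtration J S scalar x1 x2 x3 k by (rule assms)
  show "z \<in> free_over L \<Longrightarrow> F n a \<Longrightarrow> \<exists>m. F m (z * a)"
  proof (induction arbitrary: n a rule: free_over_induct)
    case (scalar c)
    then show ?case using F_scale by blast
  next
    case (letter Y)
    then show ?case using letters by blast
  next
    case (add y z)
    then obtain m m' where "F m (y * a)" "F m' (z * a)" by blast
    then have "F (max m m') (y * a)" "F (max m m') (z * a)" using F_mono by simp_all
    then have "F (max m m') ((y + z) * a)" by (simp add: distrib_right filt.add)
    then show ?case by blast
  next
    case (mult y z)
    then obtain m where "F m (z * a)" by blast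
    with mult.IH(1) obtain m' where "F m' (y * (z * a))" by blast
    then show ?case by (auto simp: mult.assoc)
  qed
qed

lemma scalar_of_nat: "scalar (of_nat m) = (of_nat m :: 'a free_alg)"
  using single_of_nat[where ?'a = "'a list" and ?'b = complex] by (simp add: zero_list_def)

lemma letter_commute_opposite:
  assumes \<epsilon>: "\<epsilon> = 1 \<or> \<epsilon> = - 1" and x: "x \<in> {q1 \<epsilon>, q2 \<epsilon>, q3 \<epsilon>}"
    and y: "y \<in> free_over {q1 (- \<epsilon>), q2 (- \<epsilon>), q3 (- \<epsilon>)}"
  shows "letter x * y - y * letter x \<in> U_ideal o4"
  using y
proof (induction rule: free_over_induct)
  case (scalar c)
  show ?case using scalar_commute[of c "letter x"] by (simp add: U_ideal.zero)
next
  case (letter Y)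
  have o4: "Y \<in> o4" "x \<in> o4" using letter x q_in_o4 by auto
  have br: "bracket Y x = mscale 0 x"
    using q_opposite_commute[OF \<epsilon> letter x] by (simp add: mscale_def vec_eq_iff)
  then show ?case
    using U_ideal_uminus[OF quaternion_triple.letter_br[OF quaternion_triple_o4[OF \<epsilon>] o4 o4(2) br]] by simp
next
  case (add y z)
  from U_ideal_add[OF add.IH] show ?case by (simp add: algebra_simps)
next
  case (mult y z)
  have sub: "free_over {q1 (- \<epsilon>), q2 (- \<epsilon>), q3 (- \<epsilon>)} \<subseteq> free_over o4"
    using q_in_o4 unfolding free_over_def by fast
  have "(letter x * y - y * letter x) * z + y * (letter x * z - z * letter x) \<in> U_ideal o4"
    using mult sub by (intro U_ideal_add U_ideal_mult_left U_ideal_mult_right) auto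
  then show ?case by (simp add: algebra_simps)
qed

lemma H_in_o4: "H1 \<in> o4" "H2 \<in> o4"
  by (simp_all add: o4_iff forall_4 H1_def H2_def)

text \<open>The vacuum is killed by the left ideal of the positive root spaces and is a weight
  vector for \<open>y\<close>, so the action of \<open>z\<close> on it pins down the related value
  \<open>c\<close>.\<close>

lemma verma_HC:
  assumes "HC4 l z c"
  shows "free_act fun_scale (verma l) z vacuum = fun_scale c vacuum"
proof -
  interpret V: o4_rep fun_scale "verma l" by (rule verma_o4_rep)
  obtain y where z: "z \<in> free_over o4" and y: "y \<in> free_over cartan4" and zy: "z - y \<in> U_left_ideal o4 npos4"
    and c: "c = free_eval (weight4 (l - axis 1 1)) y"
    using assms by (auto simp: HC4_def HC_value_def U_center_def)
  have "V.A.act w vacuum = 0" if "w \<in> U_left_ideal o4 npos4" for w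
    using that
  proof (induction rule: U_left_ideal.induct)
    case (base x)
    then show ?case by (rule V.U_ideal_act)
  next
    case (add x a X)
    then show ?case
      by (simp add: V.A.act_add V.A.act_mult verma_npos4 npos4_def)
  qed
  from this[OF zy] have "V.A.act z vacuum = V.A.act y vacuum" by (simp add: V.A.act_diff)
  also have "\<dots> = fun_scale c vacuum"
  proof -
    let ?\<tau> = "weight4 (l - axis 1 1)"
    have cartan: "X \<in> o4" if "X \<in> cartan4" for X
      using that H_in_o4 by (auto simp: cartan4_def intro: o4_add o4_mscale)
    have "foldr V.rho0 w vacuum = fun_scale (prod_list (map ?\<tau> w)) vacuum" if "set w \<subseteq> cartan4" for w
      using that
    proof (induction w)
      case Nil
      show ?case by simp
    next
      case (Cons X w)
      then have X: "X \<in> cartan4" and IH: "foldr V.rho0 w vacuum = fun_scale (prod_list (map ?\<tau> w)) vacuum" by auto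
      have "V.rho0 X (fun_scale (prod_list (map ?\<tau> w)) vacuum) = fun_scale (prod_list (map ?\<tau> w)) (V.rho0 X vacuum)"
        using V.act_scale_right[of "letter X"] by simp
      also have "V.rho0 X vacuum = fun_scale (?\<tau> X) vacuum"
        using cartan[OF X] verma_cartan4[OF X] by simp
      finally show ?case by (simp add: IH mult.commute)
    qed
    then have "V.A.act y vacuum = (\<Sum>w\<in>Poly_Mapping.keys y.
        fun_scale (Poly_Mapping.lookup y w * prod_list (map ?\<tau> w)) vacuum)"
      using y unfolding free_act_def free_over_def by (intro sum.cong) auto
    then show ?thesis by (simp add: c free_eval_def V.scale_sum_left)
  qed
  finally show ?thesis using V.act_eq[OF z] by simp
qed

section \<open>Transfer from the Verma module to joint eigenspaces of the Casimir elements\<close>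

context o4_rep
begin

definition eigen :: "complex^2 \<Rightarrow> 'v set" where
  "eigen l = {x. \<forall>\<epsilon>\<in>{1, - 1}. free_act s \<rho> (cas \<epsilon>) x = s ((l $ 1 + \<epsilon> * l $ 2)\<^sup>2 - 1) x}"

lemma cas_act_eq: "\<epsilon> = 1 \<or> \<epsilon> = - 1 \<Longrightarrow> free_act s \<rho> (cas \<epsilon>) v = A.act (cas \<epsilon>) v"
  by (intro act_eq quaternion_triple.casimir_free_over quaternion_triple_o4)

lemma act_hom: "A.act z (u + v) = A.act z u + A.act z v" "A.act z (s c u) = s c (A.act z u)"
  using Vector_Spaces.linear.axioms(3)[OF A.act_linear[OF free_over_UNIV]]
  by (auto intro: module_hom.add module_hom.scale)

lemma eigen_invariant:
  assumes x: "x \<in> eigen l"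
  shows "A.act z x \<in> eigen l"
proof -
  have "A.act (cas \<epsilon>) (A.act z x) = s ((l $ 1 + \<epsilon> * l $ 2)\<^sup>2 - 1) (A.act z x)"
    if \<epsilon>: "\<epsilon> = 1 \<or> \<epsilon> = - 1" and x: "A.act (cas \<epsilon>) x = s ((l $ 1 + \<epsilon> * l $ 2)\<^sup>2 - 1) x" for \<epsilon>
    using free_over_UNIV[of z] x
  proof (induction arbitrary: x rule: free_over_induct)
    case (scalar c)
    then show ?case by (simp add: act_hom mult.commute)
  next
    case (letter X)
    show ?case
    proof (cases "X \<in> o4")
      case True
      have "letter X * cas \<epsilon> - cas \<epsilon> * letter X \<in> U_ideal o4"
        using quaternion_triple.casimir_central[OF quaternion_triple_o4[OF \<epsilon>]] True
        by (simp add: U_center_def free_over_letter)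
      from U_ideal_act[OF this, of x] have "A.act (letter X) (A.act (cas \<epsilon>) x) = A.act (cas \<epsilon>) (A.act (letter X) x)"
        by (simp only: A.act_diff A.act_mult free_over_UNIV) simp
      then show ?thesis using letter.prems by (simp only: act_hom)
    next
      case False
      then show ?thesis by simp
    qed
  next
    case (add y z)
    then show ?case by (simp add: A.act_add act_hom scale_right_distrib)
  next
    case (mult y z)
    then show ?case by (simp add: A.act_mult)
  qed
  then show ?thesis using x by (simp add: eigen_def cas_act_eq)
qed

text \<open>\<open>J\<close> consists of the elements that kill \<open>eigen l\<close> and the Verma
  module, on which the Casimir elements take the same values. Modulo \<open>J\<close> the element
  \<open>z\<close> becomes a scalar \<open>d\<close>; the Verma module shows \<open>d = c\<close>,
  and the same congruence gives the action on \<open>eigen l\<close>.\<close>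

theorem central_act:
  assumes HC: "HC4 l z c" and x: "x \<in> eigen l"
  shows "free_act s \<rho> z x = s c x"
proof -
  interpret V: o4_rep fun_scale "verma l" by (rule verma_o4_rep)
  define J where "J = {z. (\<forall>x\<in>eigen l. A.act z x = 0) \<and> (\<forall>\<phi>. V.A.act z \<phi> = 0)}"
  have U_J: "u \<in> J" if "u \<in> U_ideal o4" for u
    using U_ideal_act[OF that] V.U_ideal_act[OF that] by (simp add: J_def)
  have J_add: "a + b \<in> J" if "a \<in> J" "b \<in> J" for a b
    using that by (simp add: J_def A.act_add V.A.act_add)
  have J_left: "r * a \<in> J" if "a \<in> J" for a r
    using that by (simp add: J_def A.act_mult V.A.act_mult)
  have J_right: "a * r \<in> J" if "a \<in> J" for a r
    using that by (simp add: J_def A.act_mult V.A.act_mult eigen_invariant)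
  have J_minus: "- a \<in> J" if "a \<in> J" for a
    using J_left[OF that, of "- 1"] by simp
  have J_diff: "a - b \<in> J" if "a \<in> J" "b \<in> J" for a b
    using J_add[OF that(1) J_minus[OF that(2)]] by simp
  have J_0: "0 \<in> J" using U_J U_ideal.zero by blast
  have filtration: "quaternion_filtration J S scalar (letter (q1 \<epsilon>)) (letter (q2 \<epsilon>)) (letter (q3 \<epsilon>)) (- ((l $ 1 + \<epsilon> * l $ 2)\<^sup>2 - 1))"
    if \<epsilon>: "\<epsilon> = 1 \<or> \<epsilon> = - 1" and S0: "0 \<in> S" and S_add: "\<And>a b. a \<in> S \<Longrightarrow> b \<in> S \<Longrightarrow> a + b \<in> S"
      and S_scale: "\<And>a c. a \<in> S \<Longrightarrow> scalar c * a \<in> S"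
      and comm: "\<And>a x. a \<in> S \<Longrightarrow> x \<in> {q1 \<epsilon>, q2 \<epsilon>, q3 \<epsilon>} \<Longrightarrow> letter x * a - a * letter x \<in> J" for S \<epsilon>
  proof -
    note br = quaternion_triple.letter_br[OF quaternion_triple_o4[OF \<epsilon>], of _ _ _ 2, unfolded scalar_numeral mult_2]
    have "- cas \<epsilon> - scalar (- ((l $ 1 + \<epsilon> * l $ 2)\<^sup>2 - 1)) \<in> J"
    proof -
      have "V.A.act (cas \<epsilon>) \<phi> = fun_scale ((l $ 1 + \<epsilon> * l $ 2)\<^sup>2 - 1) \<phi>" for \<phi>
        using V.cas_act_eq[OF \<epsilon>, of \<phi>] V.act_casimir[OF \<epsilon>, of \<phi>] verma_casimir[OF \<epsilon>, of l \<phi>] by simp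
      then show ?thesis using \<epsilon>
        by (auto simp: J_def A.act_diff A.act_uminus V.A.act_diff V.A.act_uminus eigen_def cas_act_eq
            simp del: minus_diff_eq)
    qed
    then have quad: "letter (q1 \<epsilon>) * letter (q1 \<epsilon>) + letter (q2 \<epsilon>) * letter (q2 \<epsilon>)
        + letter (q3 \<epsilon>) * letter (q3 \<epsilon>) - scalar (- ((l $ 1 + \<epsilon> * l $ 2)\<^sup>2 - 1)) \<in> J"
      unfolding casimir_def minus_minus .
    show ?thesis
    proof (unfold_locales; (intro J_add J_left J_right scalar_commute scalar_of_nat S0 S_add S_scale
          U_J[OF br] q_in_o4 q_brackets[OF \<epsilon>] quad; assumption)?)
      show "letter (q1 \<epsilon>) * a - a * letter (q1 \<epsilon>) \<in> J" "letter (q2 \<epsilon>) * a - a * letter (q2 \<epsilon>) \<in> J"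
        "letter (q3 \<epsilon>) * a - a * letter (q3 \<epsilon>) \<in> J" if "a \<in> S" for a
        using comm[OF that] by auto
    qed (simp_all add: mult_scalar single_uminus)
  qed
  have z: "z \<in> free_over o4" and central: "\<And>X. X \<in> o4 \<Longrightarrow> letter X * z - z * letter X \<in> J"
    using HC U_J by (auto simp: HC4_def HC_value_def U_center_def free_over_letter)
  have e: "1 = (1::complex) \<or> 1 = - (1::complex)" "- 1 = (1::complex) \<or> - 1 = - (1::complex)" by simp_all

  \<comment> \<open>First pass, over the triple for 1: with words in the opposite triple as
    coefficients, all letters of the first ideal are removed from \<open>z\<close>.\<close>
  define B where "B = {q1 (- 1), q2 (- 1), q3 (- 1)}"
  define S where "S = {a. \<exists>y\<in>free_over B. a - y \<in> J}"
  have S_free: "y \<in> S" if "y \<in> free_over B" for y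
    unfolding S_def using that J_0 by force
  interpret P: quaternion_filtration J S scalar "letter (q1 1)" "letter (q2 1)" "letter (q3 1)" "- ((l $ 1 + 1 * l $ 2)\<^sup>2 - 1)"
  proof (rule filtration[OF e(1)])
    show "0 \<in> S" by (simp add: S_free)
    fix a b c x assume "a \<in> S"
    then obtain y where y: "y \<in> free_over B" "a - y \<in> J" by (auto simp: S_def)
    have "scalar c * a - scalar c * y \<in> J" using J_left[OF y(2)] by (simp add: right_diff_distrib)
    then show "scalar c * a \<in> S" unfolding S_def using y(1) free_over_mult[OF free_over_scalar] by blast
    show "letter x * a - a * letter x \<in> J" if "x \<in> {q1 1, q2 1, q3 1}"
    proof -
      have "letter x * y - y * letter x \<in> J"
        using letter_commute_opposite[OF e(1) that] y(1) by (intro U_J) (simp add: B_def)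
      from J_add[OF this J_diff[OF J_left[OF y(2), of "letter x"] J_right[OF y(2), of "letter x"]]]
      show ?thesis by (simp add: algebra_simps)
    qed
    assume "b \<in> S"
    then obtain y' where y': "y' \<in> free_over B" "b - y' \<in> J" by (auto simp: S_def)
    have "(a + b) - (y + y') \<in> J" using J_add[OF y(2) y'(2)] by (simp add: algebra_simps)
    then show "a + b \<in> S" unfolding S_def using free_over_add[OF y(1) y'(1)] by blast
  qed
  have B_left: "P.F n (letter b * a)" if "P.F n a" "b \<in> B" for n a b
  proof (rule P.F_mult_commuting[OF _ _ that(1)])
    fix x assume "x \<in> {letter (q1 1), letter (q2 1), letter (q3 1)}"
    then obtain x' where x': "x' \<in> {q1 1, q2 1, q3 1}" "x = letter x'" by blast
    have "letter x' * letter b - letter b * letter x' \<in> J"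
      using letter_commute_opposite[OF e(1) x'(1), of "letter b"] that(2)
      by (intro U_J) (simp add: B_def free_over_letter)
    from J_minus[OF this] show "letter b * x - x * letter b \<in> J" by (simp add: x')
  next
    fix a assume "a \<in> S"
    then obtain y where y: "y \<in> free_over B" "a - y \<in> J" by (auto simp: S_def)
    have "letter b * a - letter b * y \<in> J" using J_left[OF y(2)] by (simp add: right_diff_distrib)
    then show "letter b * a \<in> S"
      unfolding S_def using y(1) free_over_mult[OF free_over_letter[OF that(2)]] by blast
  qed
  have "P.F (Suc n) (letter Y * a)" if Y: "Y \<in> o4" and a: "P.F n a" for Y n a
  proof -
    have sum_J: "letter (mscale b X + Z) - (scalar b * letter X + w) \<in> J"
      if "X \<in> o4" "Z \<in> o4" "letter Z - w \<in> J" for b X Z w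
      using J_add[OF J_add[OF U_J[OF letter_add[OF o4_mscale[OF that(1)] that(2), of b]]
            U_J[OF letter_mscale[OF that(1), of b]]] that(3)] by (simp add: algebra_simps)
    have last: "letter (mscale b X) - scalar b * letter X \<in> J" if "X \<in> o4" for b X
      using U_J[OF letter_mscale[OF that]] .
    define w where "w = scalar (c1 1 Y) * letter (q1 1) + (scalar (c2 1 Y) * letter (q2 1) + (scalar (c3 1 Y) * letter (q3 1)
      + (scalar (c1 (- 1) Y) * letter (q1 (- 1)) + (scalar (c2 (- 1) Y) * letter (q2 (- 1))
      + scalar (c3 (- 1) Y) * letter (q3 (- 1))))))"
    have "letter Y - w \<in> J"
      unfolding w_def by (subst o4_expand[OF Y e(1)])
        (intro sum_J last q_in_o4 o4_add o4_mscale)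
    from J_right[OF this, of a] have wJ: "letter Y * a - w * a \<in> J" by (simp add: left_diff_distrib)
    have "P.F (Suc n) (w * a)"
      unfolding w_def distrib_right mult.assoc
      by (intro filt.add P.F_scale P.F_step a filt.mono[OF B_left[OF a]]) (simp_all add: B_def)
    then show ?thesis using wJ by (rule filt.cong)
  qed
  then obtain n where "P.F n (z * 1)"
    using filt_exhausts[OF P.quaternion_filtration_axioms _ z filt.base[OF S_free[of 1]]] by auto
  then obtain b where "b \<in> S" "z - b \<in> J"
    using P.central_in_S[of n z] central q_in_o4 by auto
  then obtain y where y: "y \<in> free_over B" "b - y \<in> J" by (auto simp: S_def)
  have zy: "z - y \<in> J" using J_add[OF \<open>z - b \<in> J\<close> y(2)] by simp

  \<comment> \<open>Second pass, over the triple for - 1 with scalar coefficients. Being congruent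
    to \<open>z\<close>, the remainder \<open>y\<close> still commutes with all letters modulo
    \<open>J\<close>.\<close>
  define S' where "S' = {a. \<exists>d. a - scalar d \<in> J}"
  interpret Q: quaternion_filtration J S' scalar "letter (q1 (- 1))" "letter (q2 (- 1))" "letter (q3 (- 1))" "- ((l $ 1 + - 1 * l $ 2)\<^sup>2 - 1)"
  proof (rule filtration[OF e(2)])
    show "0 \<in> S'" unfolding S'_def using J_0 by (auto intro!: exI[of _ 0])
    fix a b c x assume "a \<in> S'"
    then obtain d where d: "a - scalar d \<in> J" by (auto simp: S'_def)
    have "scalar c * a - scalar (c * d) \<in> J" using J_left[OF d, of "scalar c"] by (simp add: right_diff_distrib mult_scalar)
    then show "scalar c * a \<in> S'" unfolding S'_def by blast
    have "letter x * a - a * letter x = letter x * (a - scalar d) - (a - scalar d) * letter x"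
      using scalar_commute[of d "letter x"] by (simp add: algebra_simps)
    then show "letter x * a - a * letter x \<in> J" using J_diff[OF J_left[OF d] J_right[OF d]] by simp
    assume "b \<in> S'"
    then obtain d' where d': "b - scalar d' \<in> J" by (auto simp: S'_def)
    have "(a + b) - scalar (d + d') \<in> J" using J_add[OF d d'] by (simp add: single_add algebra_simps)
    then show "a + b \<in> S'" unfolding S'_def by blast
  qed
  have "1 \<in> S'" unfolding S'_def using J_0 by (auto intro!: exI[of _ 1])
  moreover have "Q.F (Suc n) (letter Y * a)" if "Y \<in> B" "Q.F n a" for Y n a
    using that by (intro filt.step) (auto simp: B_def)
  ultimately obtain n where "Q.F n (y * 1)"
    using filt_exhausts[OF Q.quaternion_filtration_axioms _ y(1) filt.base] by blast
  moreover have "letter X * y - y * letter X \<in> J" if "X \<in> o4" for X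
    using J_diff[OF central[OF that] J_diff[OF J_left[OF zy, of "letter X"] J_right[OF zy, of "letter X"]]]
    by (simp add: algebra_simps)
  ultimately obtain b' where b': "b' \<in> S'" "y - b' \<in> J"
    using Q.central_in_S[of n y] q_in_o4 by auto
  then obtain d where "b' - scalar d \<in> J" by (auto simp: S'_def)
  from J_add[OF zy J_add[OF b'(2) this]] have zd: "z - scalar d \<in> J" by simp

  have "fun_scale c vacuum = fun_scale d vacuum"
    using zd verma_HC[OF HC] V.act_eq[OF z, of vacuum] by (auto simp: J_def V.A.act_diff)
  then have "fun_scale c vacuum (0, 0) = fun_scale d vacuum (0, 0)" by (rule arg_cong)
  then have "c = d" by (simp add: vacuum_def fun_scale_apply)
  then show ?thesis using zd x by (simp add: J_def A.act_diff act_eq[OF z])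
qed

end

section \<open>Projections onto primary components\<close>

text \<open>In the coordinates n_1 + n_2 and n_1 - n_2 the group W(D_2) acts by independent sign
  changes. The two squares, which are the Casimir values up to a constant, hence separate its
  orbits.\<close>

lemma W_D2_orbit_iff:
  "n \<in> W_D2_orbit m \<longleftrightarrow> (n $ 1 + n $ 2)\<^sup>2 = (m $ 1 + m $ 2)\<^sup>2 \<and> (n $ 1 - n $ 2)\<^sup>2 = (m $ 1 - m $ 2)\<^sup>2"
proof
  show "(n $ 1 + n $ 2)\<^sup>2 = (m $ 1 + m $ 2)\<^sup>2 \<and> (n $ 1 - n $ 2)\<^sup>2 = (m $ 1 - m $ 2)\<^sup>2" if "n \<in> W_D2_orbit m"
    using that by (auto simp: W_D2_orbit_def vector_2 power2_eq_square algebra_simps)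
  assume *: "(n $ 1 + n $ 2)\<^sup>2 = (m $ 1 + m $ 2)\<^sup>2 \<and> (n $ 1 - n $ 2)\<^sup>2 = (m $ 1 - m $ 2)\<^sup>2"
  define A B where "A = n $ 1 + n $ 2" and "B = n $ 1 - n $ 2"
  then have a: "A = m $ 1 + m $ 2 \<or> A = - (m $ 1 + m $ 2)" and b: "B = m $ 1 - m $ 2 \<or> B = - (m $ 1 - m $ 2)"
    using * by (simp_all only: power2_eq_iff)
  have n: "n $ 1 = (A + B) / 2" "n $ 2 = (A - B) / 2" by (simp_all add: A_def B_def)
  have "(n $ 1 = m $ 1 \<and> n $ 2 = m $ 2) \<or> (n $ 1 = m $ 2 \<and> n $ 2 = m $ 1) \<or>
      (n $ 1 = - m $ 2 \<and> n $ 2 = - m $ 1) \<or> (n $ 1 = - m $ 1 \<and> n $ 2 = - m $ 2)"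
    unfolding n using a b by (elim disjE) simp_all
  then show "n \<in> W_D2_orbit m"
    by (auto simp: W_D2_orbit_def vec_eq_iff forall_2 vector_2)
qed

context o4_rep
begin

abbreviation "C \<epsilon> \<equiv> free_act s \<rho> (cas \<epsilon>)"

lemma C_hom:
  assumes "\<epsilon> \<in> {1, - 1}"
  shows "C \<epsilon> (u + v) = C \<epsilon> u + C \<epsilon> v" "C \<epsilon> (u - v) = C \<epsilon> u - C \<epsilon> v" "C \<epsilon> (s c u) = s c (C \<epsilon> u)" "C \<epsilon> 0 = 0"
proof -
  have e: "\<epsilon> = 1 \<or> \<epsilon> = - 1" using assms by auto
  have "Vector_Spaces.linear s s (C \<epsilon>)"
    using A.act_linear[OF free_over_UNIV, of "cas \<epsilon>"] by (simp add: cas_act_eq[OF e, abs_def])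
  note hom = Vector_Spaces.linear.axioms(3)[OF this]
  show "C \<epsilon> (u + v) = C \<epsilon> u + C \<epsilon> v" "C \<epsilon> (u - v) = C \<epsilon> u - C \<epsilon> v" "C \<epsilon> (s c u) = s c (C \<epsilon> u)" "C \<epsilon> 0 = 0"
    by (simp_all add: module_hom.add[OF hom] module_hom.diff[OF hom] module_hom.scale[OF hom] module_hom.zero[OF hom])
qed

lemma C_commute:
  assumes "\<epsilon> \<in> {1, - 1}" "\<epsilon>' \<in> {1, - 1}"
  shows "C \<epsilon> (C \<epsilon>' v) = C \<epsilon>' (C \<epsilon> v)"
proof -
  have e: "\<epsilon> = 1 \<or> \<epsilon> = - 1" "\<epsilon>' = 1 \<or> \<epsilon>' = - 1" using assms by auto
  have "cas \<epsilon> * cas \<epsilon>' - cas \<epsilon>' * cas \<epsilon> \<in> U_ideal o4"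
    using quaternion_triple.casimir_central[OF quaternion_triple_o4[OF e(2)]]
      quaternion_triple.casimir_free_over[OF quaternion_triple_o4[OF e(1)]]
    by (simp add: U_center_def)
  from U_ideal_act[OF this, of v] show ?thesis
    by (simp add: A.act_diff A.act_mult cas_act_eq[OF e(1)] cas_act_eq[OF e(2)])
qed

end

text \<open>\<open>C_square\<close> says that the operator called \<open>N\<close> below is a square
  root of (l_1 + \<epsilon> l_2)^2. In the tensor product \<open>N\<close> will be
  \<open>S - 1\<close>; here only this equation matters.\<close>

locale split_o4_rep = o4_rep s \<rho> for s :: "complex \<Rightarrow> 'v \<Rightarrow> 'v::ab_group_add" and \<rho> +
  fixes l :: "complex^2"
  assumes regular: "l $ 1 \<noteq> l $ 2" "l $ 1 \<noteq> - (l $ 2)"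
    and C_square: "\<epsilon> \<in> {1, - 1} \<Longrightarrow>
      (\<lambda>v. s ((l $ 1 + \<epsilon> * l $ 2)\<^sup>2 / 2) v - s (1/2) (C \<epsilon> v))
        (s ((l $ 1 + \<epsilon> * l $ 2)\<^sup>2 / 2) v - s (1/2) (C \<epsilon> v)) = s ((l $ 1 + \<epsilon> * l $ 2)\<^sup>2) v"
begin

definition a where "a \<epsilon> = l $ 1 + \<epsilon> * l $ 2"

lemma a_nonzero: "\<epsilon> \<in> {1, - 1} \<Longrightarrow> a \<epsilon> \<noteq> 0"
  using regular eq_neg_iff_add_eq_0[of "l $ 1" "l $ 2"] by (auto simp: a_def)

text \<open>The eigenvalues \<open>(a + e)\<^sup>2 - 1\<close> of the Casimir element correspond to the eigenvalues \<open>- e a\<close> of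
  the square root \<open>N\<close> of \<open>a\<^sup>2\<close>.\<close>

definition N where "N \<epsilon> v = s ((a \<epsilon>)\<^sup>2 / 2) v - s (1/2) (C \<epsilon> v)"
definition proj where "proj \<epsilon> e v = s (1/2) v - s (e / (2 * a \<epsilon>)) (N \<epsilon> v)"

lemma N_hom:
  assumes "\<epsilon> \<in> {1, - 1}"
  shows "N \<epsilon> (u + v) = N \<epsilon> u + N \<epsilon> v" "N \<epsilon> (u - v) = N \<epsilon> u - N \<epsilon> v" "N \<epsilon> (s c u) = s c (N \<epsilon> u)"
  using C_hom[OF assms] by (simp_all add: N_def scale_right_distrib scale_right_diff_distrib mult.commute)

lemma N_square:
  assumes "\<epsilon> \<in> {1, - 1}" shows "N \<epsilon> (N \<epsilon> v) = s ((a \<epsilon>)\<^sup>2) v"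
  using C_square[OF assms] by (simp only: N_def a_def)

lemma N_commute:
  assumes "\<epsilon> \<in> {1, - 1}" "\<epsilon>' \<in> {1, - 1}" shows "N \<epsilon> (N \<epsilon>' v) = N \<epsilon>' (N \<epsilon> v)"
  using C_commute[OF assms, of v]
  by (simp add: N_def C_hom(2,3)[OF assms(1)] C_hom(2,3)[OF assms(2)] scale_right_diff_distrib mult.commute)

lemma proj_N: "\<epsilon> \<in> {1, - 1} \<Longrightarrow> \<epsilon>' \<in> {1, - 1} \<Longrightarrow> N \<epsilon> (proj \<epsilon>' e v) = proj \<epsilon>' e (N \<epsilon> v)"
  by (simp add: proj_def N_hom N_commute[of \<epsilon> \<epsilon>'])

lemma N_proj:
  assumes "\<epsilon> \<in> {1, - 1}" "e \<in> {1, - 1}" shows "N \<epsilon> (proj \<epsilon> e v) = s (- e * a \<epsilon>) (proj \<epsilon> e v)"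
proof -
  have "e * e = 1" using assms(2) by auto
  then have e: "e / (2 * a \<epsilon>) * (a \<epsilon>)\<^sup>2 = e * a \<epsilon> / 2" "- e * a \<epsilon> * (1/2) = - (e * a \<epsilon> / 2)"
    "- e * a \<epsilon> * (e / (2 * a \<epsilon>)) = - (1/2)"
    using a_nonzero[OF assms(1)] by (simp_all add: power2_eq_square field_simps)
  show ?thesis
    unfolding proj_def N_hom[OF assms(1)] N_square[OF assms(1)] scale_right_diff_distrib scale_scale e
    by simp
qed

lemma proj_sum: "proj \<epsilon> e v + proj \<epsilon> (- e) v = v"
  unfolding proj_def by (simp add: algebra_simps flip: scale_left_distrib)

lemma proj_id:
  assumes "\<epsilon> \<in> {1, - 1}" "e \<in> {1, - 1}" "N \<epsilon> v = s (- e * a \<epsilon>) v" shows "proj \<epsilon> e v = v"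
proof -
  have "e * e = 1" using assms(2) by auto
  then have "e / (2 * a \<epsilon>) * (- e * a \<epsilon>) = - (1/2)"
    using a_nonzero[OF assms(1)] by (simp add: field_simps)
  then have "proj \<epsilon> e v = s (1/2) v + s (1/2) v" unfolding proj_def assms(3) scale_scale by simp
  then show ?thesis by (simp flip: scale_left_distrib)
qed

lemma C_eq_N: "C \<epsilon> v = s ((a \<epsilon>)\<^sup>2) v - s 2 (N \<epsilon> v)"
  by (simp add: N_def scale_right_diff_distrib)

lemma N_eigen_iff:
  "C \<epsilon> v = s \<alpha> v \<longleftrightarrow> N \<epsilon> v = s (((a \<epsilon>)\<^sup>2 - \<alpha>) / 2) v"
proof
  assume "C \<epsilon> v = s \<alpha> v"
  then show "N \<epsilon> v = s (((a \<epsilon>)\<^sup>2 - \<alpha>) / 2) v"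
    by (simp add: N_def diff_divide_distrib scale_left_diff_distrib)
next
  assume "N \<epsilon> v = s (((a \<epsilon>)\<^sup>2 - \<alpha>) / 2) v"
  moreover have "2 * (((a \<epsilon>)\<^sup>2 - \<alpha>) / 2) = (a \<epsilon>)\<^sup>2 - \<alpha>" by simp
  ultimately show "C \<epsilon> v = s \<alpha> v" by (simp only: C_eq_N scale_scale scale_left_diff_distrib) simp
qed

text \<open>The roots of t^2 - a^2 are distinct. Concretely, (N - \<kappa>)^2 v = 0 becomes (a^2 +
  \<kappa>^2) v = 2 \<kappa> N v. For \<kappa> = 0 this forces v = 0; otherwise N v is a multiple
  \<beta> v, and (\<beta> - \<kappa>)^2 v = 0.\<close>

lemma N_semisimple:
  assumes \<epsilon>: "\<epsilon> \<in> {1, - 1}" and 0: "N \<epsilon> (N \<epsilon> v - s \<kappa> v) = s \<kappa> (N \<epsilon> v - s \<kappa> v)"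
  shows "N \<epsilon> v = s \<kappa> v"
proof -
  have "s ((a \<epsilon>)\<^sup>2) v - s \<kappa> (N \<epsilon> v) = s \<kappa> (N \<epsilon> v) - s (\<kappa> * \<kappa>) v"
    using 0 by (simp add: N_hom[OF \<epsilon>] N_square[OF \<epsilon>] scale_right_diff_distrib)
  then have eq: "s ((a \<epsilon>)\<^sup>2 + \<kappa> * \<kappa>) v = s (\<kappa> + \<kappa>) (N \<epsilon> v)"
    by (simp only: scale_left_distrib) (simp add: algebra_simps)
  show ?thesis
  proof (cases "\<kappa> = 0")
    case True
    then show ?thesis using eq a_nonzero[OF \<epsilon>] N_hom(3)[OF \<epsilon>, of 0 v] by simp
  next
    case False
    define \<beta> where "\<beta> = 1 / (\<kappa> + \<kappa>) * ((a \<epsilon>)\<^sup>2 + \<kappa> * \<kappa>)"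
    have "1 / (\<kappa> + \<kappa>) * (\<kappa> + \<kappa>) = 1" using False by (simp flip: mult_2)
    then have "s (1 / (\<kappa> + \<kappa>)) (s (\<kappa> + \<kappa>) (N \<epsilon> v)) = N \<epsilon> v" by (simp only: scale_scale scale_one)
    then have N: "N \<epsilon> v = s \<beta> v" unfolding eq[symmetric] scale_scale \<beta>_def by simp
    then have "s (\<beta> * \<beta>) v - s (\<beta> * \<kappa>) v = s (\<beta> * \<kappa>) v - s (\<kappa> * \<kappa>) v"
      using 0 by (simp add: N_hom[OF \<epsilon>] scale_right_diff_distrib mult.commute)
    then have "s ((\<beta> - \<kappa>) * (\<beta> - \<kappa>)) v = 0"
      by (simp only: left_diff_distrib right_diff_distrib scale_left_diff_distrib) (simp add: mult.commute)
    then show ?thesis using N by auto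
  qed
qed

text \<open>Passes from arbitrary powers to honest eigenvectors: \<open>E\<close> is - 2 (N -
  \<kappa>), which has the same kernel as its square by \<open>N_semisimple\<close>.\<close>

lemma primary_eigen:
  assumes y: "y \<in> primary s \<rho> n" and \<epsilon>: "\<epsilon> \<in> {1, - 1}"
  shows "C \<epsilon> y = s ((n $ 1 + \<epsilon> * n $ 2)\<^sup>2 - 1) y"
proof -
  let ?\<alpha> = "(n $ 1 + \<epsilon> * n $ 2)\<^sup>2 - 1"
  define E where "E w = C \<epsilon> w - s ?\<alpha> w" for w
  have e: "\<epsilon> = 1 \<or> \<epsilon> = - 1" using \<epsilon> by auto
  obtain k where k: "(E ^^ k) y = 0"
    using y HC4_casimir[OF e, of n] unfolding primary_def E_def by blast
  have step: "E w = 0" if "E (E w) = 0" for w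
  proof -
    let ?\<kappa> = "((a \<epsilon>)\<^sup>2 - ?\<alpha>) / 2"
    have "E w = s (- 2) (N \<epsilon> w - s ?\<kappa> w)"
    proof -
      have "- 2 * ?\<kappa> = ?\<alpha> - (a \<epsilon>)\<^sup>2" by (simp add: field_simps)
      then show ?thesis
        unfolding E_def C_eq_N
        by (simp only: scale_right_diff_distrib scale_scale scale_left_diff_distrib) (simp add: scale_minus_left)
    qed
    moreover have "N \<epsilon> (E w) = s ?\<kappa> (E w)" using that unfolding E_def[of "E w"] N_eigen_iff[symmetric] by simp
    ultimately have "s (- 2) (N \<epsilon> (N \<epsilon> w - s ?\<kappa> w)) = s (- 2) (s ?\<kappa> (N \<epsilon> w - s ?\<kappa> w))"
      by (simp only: N_hom[OF \<epsilon>] scale_left_commute)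
    then have "N \<epsilon> (N \<epsilon> w - s ?\<kappa> w) = s ?\<kappa> (N \<epsilon> w - s ?\<kappa> w)" by (simp only: scale_cancel_left) simp
    then have "N \<epsilon> w = s ?\<kappa> w" by (rule N_semisimple[OF \<epsilon>])
    then show ?thesis unfolding E_def N_eigen_iff[symmetric] by simp
  qed
  have "E y = 0" using k
  proof (induction k arbitrary: y)
    case 0
    then show ?case using C_hom(4)[OF \<epsilon>] by (simp add: E_def)
  next
    case (Suc k)
    then have "(E ^^ k) (E y) = 0" by (simp add: funpow_swap1)
    then show ?case using Suc.IH step by blast
  qed
  then show ?thesis by (simp add: E_def)
qed

text \<open>Membership in \<open>primary\<close> concerns all central elements, so this direction
  rests on \<open>central_act\<close>; exponent 1 suffices.\<close>

lemma eigen_primary: "y \<in> eigen n \<Longrightarrow> y \<in> primary s \<rho> n"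
  unfolding primary_def using central_act by (auto intro!: exI[of _ "1 :: nat"])

definition joint where "joint e e' v = proj 1 e (proj (- 1) e' v)"

lemma joint_eigen:
  assumes e: "e \<in> {1, - 1}" "e' \<in> {1, - 1}"
    and n: "n $ 1 + n $ 2 = a 1 + e" "n $ 1 - n $ 2 = a (- 1) + e'"
  shows "joint e e' v \<in> eigen n"
proof -
  have ee: "e * e = 1" "e' * e' = 1" using e by auto
  have N1: "N 1 (joint e e' v) = s (- e * a 1) (joint e e' v)"
    unfolding joint_def using e by (intro N_proj) auto
  have "N (- 1) (joint e e' v) = proj 1 e (s (- e' * a (- 1)) (proj (- 1) e' v))"
    unfolding joint_def using N_proj[of "- 1" e'] e(2) by (simp add: proj_N)
  then have N2: "N (- 1) (joint e e' v) = s (- e' * a (- 1)) (joint e e' v)"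
    by (simp add: joint_def proj_def N_hom scale_right_diff_distrib mult.commute)
  have "((a 1)\<^sup>2 - ((n $ 1 + n $ 2)\<^sup>2 - 1)) / 2 = - e * a 1"
    "((a (- 1))\<^sup>2 - ((n $ 1 - n $ 2)\<^sup>2 - 1)) / 2 = - e' * a (- 1)"
    unfolding n using ee by (simp_all add: power2_eq_square algebra_simps)
  then show ?thesis
    using N1 N2 N_eigen_iff[of 1] N_eigen_iff[of "- 1"] by (simp add: eigen_def)
qed

lemma joint_sum: "v - joint e e' v = joint (- e) e' v + (joint (- e) (- e') v + joint e (- e') v)"
proof -
  have d: "proj \<epsilon> e (u + w) = proj \<epsilon> e u + proj \<epsilon> e w" if "\<epsilon> \<in> {1, - 1}" for \<epsilon> e u w
    by (simp add: proj_def N_hom[OF that] scale_right_distrib)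
  have "joint e e' v + joint e (- e') v = proj 1 e v" for e
    unfolding joint_def by (subst d[symmetric]) (simp_all add: proj_sum)
  then have "joint e e' v + joint e (- e') v + (joint (- e) e' v + joint (- e) (- e') v) = v"
    by (simp only: proj_sum)
  then have "joint e e' v + (joint (- e) e' v + (joint (- e) (- e') v + joint e (- e') v)) = v"
    by (simp only: add_ac)
  then show ?thesis by (metis add_diff_cancel_left')
qed

text \<open>Existence: the remainder is the sum of three other joint projections, whose parameters
  lie in other orbits. Uniqueness: \<open>joint e e'\<close> kills the primary components of all
  other orbits and fixes that of \<open>m\<close>.\<close>

theorem primary_proj_joint:
  assumes e: "e \<in> {1, - 1}" "e' \<in> {1, - 1}"
    and m: "m $ 1 + m $ 2 = a 1 + e" "m $ 1 - m $ 2 = a (- 1) + e'"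
  shows "primary_proj s \<rho> m v = joint e e' v"
  unfolding primary_proj_def
proof (rule the_equality)
  let ?others = "\<Union>{primary s \<rho> n | n. n \<notin> W_D2_orbit m}"
  have joint_hom: "joint e e' (u + w) = joint e e' u + joint e e' w"
    "joint e e' (u - w) = joint e e' u - joint e e' w" "joint e e' (s c u) = s c (joint e e' u)" for u w c
    by (simp_all add: joint_def proj_def N_hom scale_right_distrib scale_right_diff_distrib mult.commute algebra_simps)
  have other: "joint d d' v \<in> span ?others"
    if d: "d \<in> {1, - 1}" "d' \<in> {1, - 1}" and ne: "d \<noteq> e \<or> d' \<noteq> e'" for d d'
  proof (rule span_base)
    define n :: "complex^2" where "n = vector [(a 1 + d + (a (- 1) + d')) / 2, (a 1 + d - (a (- 1) + d')) / 2]"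
    have n: "n $ 1 + n $ 2 = a 1 + d" "n $ 1 - n $ 2 = a (- 1) + d'"
      by (simp_all add: n_def vector_2 field_simps)
    \<comment> \<open>(a + e)^2 and (a - e)^2 differ by 4 a e, which is nonzero.\<close>
    have "n \<notin> W_D2_orbit m"
      unfolding W_D2_orbit_iff n m using e d ne a_nonzero[of 1] a_nonzero[of "- 1"]
      by (auto simp: power2_eq_square algebra_simps)
    moreover have "joint d d' v \<in> primary s \<rho> n" by (rule eigen_primary[OF joint_eigen[OF d n]])
    ultimately show "joint d d' v \<in> ?others" by blast
  qed
  have "v - joint e e' v \<in> span ?others"
    unfolding joint_sum using e by (intro span_add other) auto
  then show "joint e e' v \<in> primary s \<rho> m \<and> v - joint e e' v \<in> span ?others"
    using eigen_primary[OF joint_eigen[OF e m]] by blast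
  fix x assume x: "x \<in> primary s \<rho> m \<and> v - x \<in> span ?others"
  \<comment> \<open>A nonzero \<open>joint e e' y\<close> would be an eigenvector of both Casimir
    elements with the values of \<open>n\<close> and with those of \<open>m\<close>, so the orbits
    would coincide.\<close>
  have vanish: "joint e e' y = 0" if "y \<in> primary s \<rho> n" "n \<notin> W_D2_orbit m" for y n
  proof (rule ccontr)
    assume nz: "joint e e' y \<noteq> 0"
    have "(n $ 1 + \<epsilon> * n $ 2)\<^sup>2 = (m $ 1 + \<epsilon> * m $ 2)\<^sup>2" if \<epsilon>: "\<epsilon> \<in> {1, - 1}" for \<epsilon>
    proof -
      have "N \<epsilon> (joint e e' y) = joint e e' (N \<epsilon> y)"
        unfolding joint_def using \<epsilon> by (simp add: proj_N)
      then have "C \<epsilon> (joint e e' y) = joint e e' (C \<epsilon> y)" by (simp add: C_eq_N joint_hom)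
      also have "\<dots> = s ((n $ 1 + \<epsilon> * n $ 2)\<^sup>2 - 1) (joint e e' y)"
        unfolding primary_eigen[OF \<open>y \<in> primary s \<rho> n\<close> \<epsilon>] by (simp add: joint_hom)
      finally show ?thesis using joint_eigen[OF e m, of y] \<epsilon> nz by (auto simp: eigen_def)
    qed
    from this[of 1] this[of "- 1"] show False using that(2) by (simp add: W_D2_orbit_iff)
  qed
  have kill: "joint e e' w = 0" if "w \<in> span ?others" for w
    using that
  proof (induction rule: span_induct_alt)
    case base
    show ?case using joint_hom(3)[of 0 0] by simp
  next
    case (step c w y)
    then show ?case using vanish by (auto simp: joint_hom)
  qed
  have "N \<epsilon> x = s (- d * a \<epsilon>) x" if "\<epsilon> \<in> {1, - 1}" "d * d = 1" "m $ 1 + \<epsilon> * m $ 2 = a \<epsilon> + d" for \<epsilon> d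
  proof -
    have "((a \<epsilon>)\<^sup>2 - ((m $ 1 + \<epsilon> * m $ 2)\<^sup>2 - 1)) / 2 = - d * a \<epsilon>"
      unfolding that(3) using that(2) by (simp add: power2_eq_square algebra_simps)
    then show ?thesis using primary_eigen[of x m, OF _ that(1)] x unfolding N_eigen_iff by auto
  qed
  from this[of 1 e] this[of "- 1" e'] have "N 1 x = s (- e * a 1) x" "N (- 1) x = s (- e' * a (- 1)) x"
    using e m by auto
  then have "joint e e' x = x" unfolding joint_def using e by (simp add: proj_id)
  moreover have "joint e e' (v - x) = 0" using kill x by blast
  ultimately show "x = joint e e' v" by (simp add: joint_hom)
qed

end

section \<open>Tensor products with the natural representation\<close>

lemma vector_space_tensor:
  assumes "vector_space s" shows "vector_space (tensor_scale s)"
proof -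
  interpret vector_space s by (rule assms)
  show ?thesis
    by unfold_locales
      (simp_all add: tensor_scale_def vec_eq_iff scale_right_distrib scale_left_distrib)
qed

lemma mscale_nth: "mscale c X $ i $ j = c * X $ i $ j"
  by (simp add: mscale_def)

context o4_rep
begin

lemma rho_hom:
  assumes "X \<in> o4"
  shows "\<rho> X (u + v) = \<rho> X u + \<rho> X v" "\<rho> X (u - v) = \<rho> X u - \<rho> X v" "\<rho> X (- u) = - \<rho> X u"
    "\<rho> X (s c u) = s c (\<rho> X u)" "\<rho> X (sum f A) = (\<Sum>i\<in>A. \<rho> X (f i))" "\<rho> X 0 = 0"
proof -
  note hom = Vector_Spaces.linear.axioms(3)[OF rho_linear[OF assms]]
  show "\<rho> X (u + v) = \<rho> X u + \<rho> X v" "\<rho> X (u - v) = \<rho> X u - \<rho> X v" "\<rho> X (- u) = - \<rho> X u"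
    "\<rho> X (s c u) = s c (\<rho> X u)" "\<rho> X (sum f A) = (\<Sum>i\<in>A. \<rho> X (f i))" "\<rho> X 0 = 0"
    by (simp_all add: module_hom.add[OF hom] module_hom.diff[OF hom] module_hom.scale[OF hom]
        module_hom.neg[OF hom] module_hom.sum[OF hom] module_hom.zero[OF hom])
qed

lemma tensor_bracket_term:
  fixes x :: "'v^4"
  shows "(\<Sum>j\<in>UNIV. s (bracket X Y $ i $ j) (x $ j))
    = (\<Sum>j\<in>UNIV. s (X $ i $ j) (\<Sum>k\<in>UNIV. s (Y $ j $ k) (x $ k)))
      - (\<Sum>j\<in>UNIV. s (Y $ i $ j) (\<Sum>k\<in>UNIV. s (X $ j $ k) (x $ k)))"
proof -
  have "(\<Sum>j\<in>UNIV. s (X $ i $ j) (\<Sum>k\<in>UNIV. s (Y $ j $ k) (x $ k))) = (\<Sum>k\<in>UNIV. s ((X ** Y) $ i $ k) (x $ k))"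
    for X Y :: "complex^4^4" and i
    by (simp add: scale_sum_right matrix_matrix_mult_def scale_sum_left) (subst sum.swap, simp)
  then show ?thesis by (simp add: bracket_def scale_left_diff_distrib sum_subtractf)
qed

lemma tensor_o4_rep: "o4_rep (tensor_scale s) (tensor_act s \<rho>)"
proof (intro o4_rep.intro o4_rep_axioms.intro vector_space_tensor vector_space_axioms)
  fix X Y :: "complex^4^4" and x :: "'v^4" and c
  assume X: "X \<in> o4"
  have "tensor_act s \<rho> X (x + y) = tensor_act s \<rho> X x + tensor_act s \<rho> X y"
    "tensor_act s \<rho> X (tensor_scale s c x) = tensor_scale s c (tensor_act s \<rho> X x)" for x y c
    by (simp_all add: tensor_act_def tensor_scale_def vec_eq_iff rho_hom[OF X] scale_right_distrib
        sum.distrib scale_sum_right algebra_simps)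
  then show "Vector_Spaces.linear (tensor_scale s) (tensor_scale s) (tensor_act s \<rho> X)"
    by (intro Vector_Spaces.linear.intro vector_space_tensor vector_space_axioms module_hom.intro
        module_hom_axioms.intro vector_space_tensor[OF vector_space_axioms, unfolded module_iff_vector_space[symmetric]])
  show "tensor_act s \<rho> (mscale c X) x = tensor_scale s c (tensor_act s \<rho> X x)"
    by (simp add: tensor_act_def tensor_scale_def vec_eq_iff rho_mscale[OF X] scale_right_distrib
        scale_sum_right mscale_nth)
  assume Y: "Y \<in> o4"
  show "tensor_act s \<rho> (X + Y) x = tensor_act s \<rho> X x + tensor_act s \<rho> Y x"
    by (simp add: tensor_act_def vec_eq_iff rho_plus[OF X Y] scale_left_distrib sum.distrib algebra_simps)
  show "tensor_act s \<rho> (bracket X Y) x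
      = tensor_act s \<rho> X (tensor_act s \<rho> Y x) - tensor_act s \<rho> Y (tensor_act s \<rho> X x)"
    by (simp add: tensor_act_def vec_eq_iff rho_bracket[OF X Y] tensor_bracket_term rho_hom[OF X] rho_hom[OF Y]
        scale_right_distrib sum.distrib algebra_simps)
qed

end

lemma q_nth:
  "q1 \<epsilon> $ i $ j = skew 2 1 $ i $ j + \<epsilon> * skew 4 3 $ i $ j"
  "q2 \<epsilon> $ i $ j = skew 3 1 $ i $ j + \<epsilon> * skew 2 4 $ i $ j"
  "q3 \<epsilon> $ i $ j = skew 3 2 $ i $ j + \<epsilon> * skew 4 1 $ i $ j"
  by (simp_all add: q1_def q2_def q3_def mscale_def)

lemma skew_nth: "skew a b $ i $ j = (if i = a \<and> j = b then 1 else if i = b \<and> j = a then - 1 else 0)"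
  by (simp add: skew_def)

lemma vector_4_nth [simp]:
  fixes a b c d :: "'a::zero"
  shows "(vector [a, b, c, d] :: 'a^4) $ 1 = a" "(vector [a, b, c, d] :: 'a^4) $ 2 = b"
    "(vector [a, b, c, d] :: 'a^4) $ 3 = c" "(vector [a, b, c, d] :: 'a^4) $ 4 = d"
  by (simp_all add: vector_def)

section \<open>The Casimir elements on the tensor product and the mixed term\<close>

locale regular_o4_rep = o4_rep s \<rho> for s :: "complex \<Rightarrow> 'v \<Rightarrow> 'v::ab_group_add" and \<rho> +
  fixes l :: "complex^2"
  assumes inf_char: "inf_char4 s \<rho> l"
    and regular: "l $ 1 \<noteq> l $ 2" "l $ 1 \<noteq> - (l $ 2)"
begin

abbreviation "ts \<equiv> tensor_scale s"
abbreviation "tact \<equiv> tensor_act s \<rho>"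

sublocale T: o4_rep ts tact by (rule tensor_o4_rep)

lemma casimir_scalar:
  assumes "\<epsilon> \<in> {1, - 1}"
  shows "\<rho> (q3 \<epsilon>) (\<rho> (q3 \<epsilon>) u) = - s ((l $ 1 + \<epsilon> * l $ 2)\<^sup>2 - 1) u - \<rho> (q1 \<epsilon>) (\<rho> (q1 \<epsilon>) u) - \<rho> (q2 \<epsilon>) (\<rho> (q2 \<epsilon>) u)"
proof -
  have e: "\<epsilon> = 1 \<or> \<epsilon> = - 1" using assms by auto
  have "C \<epsilon> u = s ((l $ 1 + \<epsilon> * l $ 2)\<^sup>2 - 1) u"
    using inf_char HC4_casimir[OF e] unfolding inf_char4_def by blast
  then show ?thesis unfolding act_casimir[OF e] by (simp add: algebra_simps)
qed

lemma rho_brackets: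
  assumes "\<epsilon> \<in> {1, - 1}"
  shows "\<rho> (q1 \<epsilon>) (\<rho> (q2 \<epsilon>) u) = \<rho> (q2 \<epsilon>) (\<rho> (q1 \<epsilon>) u) + (\<rho> (q3 \<epsilon>) u + \<rho> (q3 \<epsilon>) u)"
    "\<rho> (q2 \<epsilon>) (\<rho> (q3 \<epsilon>) u) = \<rho> (q3 \<epsilon>) (\<rho> (q2 \<epsilon>) u) + (\<rho> (q1 \<epsilon>) u + \<rho> (q1 \<epsilon>) u)"
    "\<rho> (q1 \<epsilon>) (\<rho> (q3 \<epsilon>) u) = \<rho> (q3 \<epsilon>) (\<rho> (q1 \<epsilon>) u) - (\<rho> (q2 \<epsilon>) u + \<rho> (q2 \<epsilon>) u)"
proof -
  have e: "\<epsilon> = 1 \<or> \<epsilon> = - 1" using assms by auto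
  have two: "s 2 w = w + w" for w using scale_left_distrib[of 1 1 w] by simp
  note br = q_brackets[OF e]
  show "\<rho> (q1 \<epsilon>) (\<rho> (q2 \<epsilon>) u) = \<rho> (q2 \<epsilon>) (\<rho> (q1 \<epsilon>) u) + (\<rho> (q3 \<epsilon>) u + \<rho> (q3 \<epsilon>) u)"
    using rho_bracket[OF q_in_o4(1,2), of \<epsilon> \<epsilon> u] unfolding br(1) rho_mscale[OF q_in_o4(3)] two
    by (simp add: algebra_simps)
  show "\<rho> (q2 \<epsilon>) (\<rho> (q3 \<epsilon>) u) = \<rho> (q3 \<epsilon>) (\<rho> (q2 \<epsilon>) u) + (\<rho> (q1 \<epsilon>) u + \<rho> (q1 \<epsilon>) u)"
    using rho_bracket[OF q_in_o4(2,3), of \<epsilon> \<epsilon> u] unfolding br(2) rho_mscale[OF q_in_o4(1)] two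
    by (simp add: algebra_simps)
  show "\<rho> (q1 \<epsilon>) (\<rho> (q3 \<epsilon>) u) = \<rho> (q3 \<epsilon>) (\<rho> (q1 \<epsilon>) u) - (\<rho> (q2 \<epsilon>) u + \<rho> (q2 \<epsilon>) u)"
    using rho_bracket[OF q_in_o4(3,1), of \<epsilon> \<epsilon> u] unfolding br(3) rho_mscale[OF q_in_o4(2)] two
    by (simp add: algebra_simps)
qed

text \<open>The part \<open>q1 \<otimes> q1 + q2 \<otimes> q2 + q3 \<otimes> q3\<close> of the Casimir element of the tensor product. Since the
  quaternions square to \<open>- 1\<close>, it satisfies a quadratic equation.\<close>

definition S :: "complex \<Rightarrow> 'v^4 \<Rightarrow> 'v^4" where
  "S \<epsilon> x = vector [
     - \<rho> (q1 \<epsilon>) (x $ 2) - \<rho> (q2 \<epsilon>) (x $ 3) - s \<epsilon> (\<rho> (q3 \<epsilon>) (x $ 4)),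
     \<rho> (q1 \<epsilon>) (x $ 1) - \<rho> (q3 \<epsilon>) (x $ 3) + s \<epsilon> (\<rho> (q2 \<epsilon>) (x $ 4)),
     \<rho> (q2 \<epsilon>) (x $ 1) + \<rho> (q3 \<epsilon>) (x $ 2) - s \<epsilon> (\<rho> (q1 \<epsilon>) (x $ 4)),
     s \<epsilon> (\<rho> (q1 \<epsilon>) (x $ 3) - \<rho> (q2 \<epsilon>) (x $ 2) + \<rho> (q3 \<epsilon>) (x $ 1))]"

lemma tact_q:
  "tact (q1 \<epsilon>) x = vector [\<rho> (q1 \<epsilon>) (x $ 1) - x $ 2, \<rho> (q1 \<epsilon>) (x $ 2) + x $ 1,
     \<rho> (q1 \<epsilon>) (x $ 3) - s \<epsilon> (x $ 4), \<rho> (q1 \<epsilon>) (x $ 4) + s \<epsilon> (x $ 3)]"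
  "tact (q2 \<epsilon>) x = vector [\<rho> (q2 \<epsilon>) (x $ 1) - x $ 3, \<rho> (q2 \<epsilon>) (x $ 2) + s \<epsilon> (x $ 4),
     \<rho> (q2 \<epsilon>) (x $ 3) + x $ 1, \<rho> (q2 \<epsilon>) (x $ 4) - s \<epsilon> (x $ 2)]"
  "tact (q3 \<epsilon>) x = vector [\<rho> (q3 \<epsilon>) (x $ 1) - s \<epsilon> (x $ 4), \<rho> (q3 \<epsilon>) (x $ 2) - x $ 3,
     \<rho> (q3 \<epsilon>) (x $ 3) + x $ 2, \<rho> (q3 \<epsilon>) (x $ 4) + s \<epsilon> (x $ 1)]"
  by (simp_all add: vec_eq_iff forall_4 tensor_act_def sum_4 q_nth skew_nth)

text \<open>The negative sum of the squares of \<rho>(q_k) + q_k consists of the Casimir element of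
  \<open>\<rho>\<close>, the value 3 on C^4 because each q_k squares to - 1, and the cross term - 2
  S.\<close>

lemma T_casimir:
  assumes "\<epsilon> \<in> {1, - 1}"
  shows "T.C \<epsilon> x = ts ((l $ 1 + \<epsilon> * l $ 2)\<^sup>2 - 1) x + (x + x + x) - (S \<epsilon> x + S \<epsilon> x)"
proof -
  have e: "\<epsilon> = 1 \<or> \<epsilon> = - 1" using assms by auto
  note casimir_scalar[OF assms] rho_brackets[OF assms]
  moreover have "\<epsilon> * \<epsilon> = 1" using e by auto
  ultimately show ?thesis
    unfolding T.act_casimir[OF e] tact_q S_def
    by (simp add: vec_eq_iff forall_4 tensor_scale_def rho_hom q_in_o4 scale_right_distrib
        scale_right_diff_distrib)
qed

text \<open>In the square of the sum of \<rho>(q_k) \<otimes> q_k, the diagonal terms give the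
  Casimir element; the others combine, as the units anticommute, into brackets and give 2 S.
  Completing the square yields (S - 1)^2 = (l_1 + \<epsilon> l_2)^2.\<close>

lemma S_square:
  assumes "\<epsilon> \<in> {1, - 1}"
  shows "S \<epsilon> (S \<epsilon> x) = ts ((l $ 1 + \<epsilon> * l $ 2)\<^sup>2 - 1) x + (S \<epsilon> x + S \<epsilon> x)"
proof -
  have e: "\<epsilon> = 1 \<or> \<epsilon> = - 1" using assms by auto
  note casimir_scalar[OF assms] rho_brackets[OF assms]
  moreover have "\<epsilon> * \<epsilon> = 1" using e by auto
  ultimately show ?thesis
    unfolding S_def
    by (simp add: vec_eq_iff forall_4 tensor_scale_def rho_hom q_in_o4 scale_right_distrib
        scale_right_diff_distrib)
qed

end

context regular_o4_rep
begin

abbreviation "\<alpha> \<epsilon> \<equiv> l $ 1 + \<epsilon> * l $ 2"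

lemma N_T:
  assumes "\<epsilon> \<in> {1, - 1}"
  shows "ts ((\<alpha> \<epsilon>)\<^sup>2 / 2) x - ts (1/2) (T.C \<epsilon> x) = S \<epsilon> x - x"
proof -
  have h: "ts (1/2) (y + y) = y" for y
    unfolding T.scale_right_distrib by (simp flip: T.scale_left_distrib)
  have "T.C \<epsilon> x = ts ((\<alpha> \<epsilon>)\<^sup>2) x + ((x - S \<epsilon> x) + (x - S \<epsilon> x))"
    unfolding T_casimir[OF assms] by (simp add: T.scale_left_diff_distrib)
  then have "ts (1/2) (T.C \<epsilon> x) = ts ((\<alpha> \<epsilon>)\<^sup>2 / 2) x + (x - S \<epsilon> x)"
    by (simp only: T.scale_right_distrib[of _ "ts _ x"] h) simp
  then show ?thesis by simp
qed

lemma S_diff: "S \<epsilon> (x - y) = S \<epsilon> x - S \<epsilon> y"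
  by (simp add: S_def vec_eq_iff forall_4 rho_hom q_in_o4 scale_right_distrib scale_right_diff_distrib)

sublocale T: split_o4_rep ts tact l
proof (intro split_o4_rep.intro split_o4_rep_axioms.intro tensor_o4_rep regular)
  fix \<epsilon> :: complex and v assume \<epsilon>: "\<epsilon> \<in> {1, - 1}"
  show "ts ((\<alpha> \<epsilon>)\<^sup>2 / 2) (ts ((\<alpha> \<epsilon>)\<^sup>2 / 2) v - ts (1 / 2) (T.C \<epsilon> v)) -
      ts (1 / 2) (T.C \<epsilon> (ts ((\<alpha> \<epsilon>)\<^sup>2 / 2) v - ts (1 / 2) (T.C \<epsilon> v))) = ts ((\<alpha> \<epsilon>)\<^sup>2) v"
    unfolding N_T[OF \<epsilon>] by (simp add: S_diff S_square[OF \<epsilon>] T.scale_left_diff_distrib)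
qed

lemma T_N: "\<epsilon> \<in> {1, - 1} \<Longrightarrow> T.N \<epsilon> x = S \<epsilon> x - x"
  using N_T[of \<epsilon> x] by (simp only: T.N_def T.a_def)

definition "mixed z = \<rho> (q1 1) (\<rho> (q1 (- 1)) z) + \<rho> (q2 1) (\<rho> (q2 (- 1)) z) + \<rho> (q3 1) (\<rho> (q3 (- 1)) z)"

text \<open>Skew matrices have zero (4,4) entry, so a single \<open>S\<close> moves the fourth
  component into the other three. Only the product of \<open>S 1\<close> and \<open>S (- 1)\<close>
  comes back, and there it is \<open>mixed\<close>. The scalars 1/2 + k are the constant terms of
  1/2 - k (S - 1).\<close>

lemma joint_component:
  assumes "z $ 1 = 0" "z $ 2 = 0" "z $ 3 = 0"
  shows "T.joint e e' z $ 4 = s ((1/2 + e / (2 * \<alpha> 1)) * (1/2 + e' / (2 * \<alpha> (- 1)))) (z $ 4)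
    + s (e / (2 * \<alpha> 1) * (e' / (2 * \<alpha> (- 1)))) (mixed (z $ 4))"
proof -
  define k k' where "k = e / (2 * \<alpha> 1)" and "k' = e' / (2 * \<alpha> (- 1))"
  have p: "T.proj 1 e y = ts (1/2) y - ts k (S 1 y - y)" "T.proj (- 1) e' y = ts (1/2) y - ts k' (S (- 1) y - y)" for y
    by (simp_all add: T.proj_def T_N k_def k'_def T.a_def)
  have "T.joint e e' z $ 4 = s (1/2 + k) (s (1/2 + k') (z $ 4)) + s (k * k') (mixed (z $ 4))"
    unfolding T.joint_def p
    by (simp add: S_def tensor_scale_def assms rho_hom q_in_o4 mixed_def scale_right_distrib
        scale_right_diff_distrib scale_left_distrib distrib_right add_divide_distrib algebra_simps)
  then show ?thesis by (simp add: k_def k'_def)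
qed

lemma rho_opposite:
  assumes "x \<in> {q1 1, q2 1, q3 1}" "y \<in> {q1 (- 1), q2 (- 1), q3 (- 1)}"
  shows "\<rho> y (\<rho> x u) = \<rho> x (\<rho> y u)"
proof -
  have o4: "x \<in> o4" "y \<in> o4" using assms q_in_o4 by auto
  have "bracket y x = mscale 0 x"
    using q_opposite_commute[of 1 y x] assms by (simp add: mscale_def vec_eq_iff)
  then have "\<rho> y (\<rho> x u) - \<rho> x (\<rho> y u) = s 0 (\<rho> x u)"
    using rho_bracket[OF o4(2,1), of u] rho_mscale[OF o4(1), of 0 u] by simp
  then show ?thesis by simp
qed

lemma mixed_casimir:
  "mixed z + mixed z = s ((\<alpha> 1)\<^sup>2 - 1) z + s ((\<alpha> (- 1))\<^sup>2 - 1) z - free_act s \<rho> (casimir j1 j2 j3) z"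
proof -
  have o3_o4: "free_over o3 \<subseteq> (free_over o4 :: (complex^4^4) free_alg set)"
    unfolding free_over_def o3_def by fast
  have c: "casimir j1 j2 j3 \<in> free_over o4"
    using quaternion_triple.casimir_free_over[OF quaternion_triple_o3] o3_o4 by blast
  have j: "j1 \<in> o4" "j2 \<in> o4" "j3 \<in> o4"
    using quaternion_triple.mem[OF quaternion_triple_o3] by (auto simp: o3_def)
  have "free_act s \<rho> (casimir j1 j2 j3) z = - (\<rho> j1 (\<rho> j1 z) + \<rho> j2 (\<rho> j2 z) + \<rho> j3 (\<rho> j3 z))"
    unfolding act_eq[OF c] by (simp add: casimir_def A.act_uminus A.act_add A.act_diff A.act_mult j)
  also have "\<dots> = s ((\<alpha> 1)\<^sup>2 - 1) z + s ((\<alpha> (- 1))\<^sup>2 - 1) z - (mixed z + mixed z)"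
    unfolding j_eq
    by (simp add: rho_plus rho_hom q_in_o4 mixed_def rho_opposite casimir_scalar[of 1]
        casimir_scalar[of "- 1"] algebra_simps)
  finally show ?thesis by simp
qed

end

section \<open>Descent through T and the explicit coefficient\<close>

lemma free_act_intertwine:
  assumes T: "Vector_Spaces.linear sV sW T" and z: "z \<in> free_over L"
    and hom: "\<And>X u. X \<in> L \<Longrightarrow> T (\<rho> X u) = \<rho>' X (T u)"
  shows "T (free_act sV \<rho> z u) = free_act sW \<rho>' z (T u)"
proof -
  note h = Vector_Spaces.linear.axioms(3)[OF T]
  have "T (foldr \<rho> w u) = foldr \<rho>' w (T u)" if "set w \<subseteq> L" for w
    using that by (induction w) (auto simp: hom)
  then show ?thesis
    using z unfolding free_act_def free_over_def module_hom.sum[OF h] module_hom.scale[OF h]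
    by (intro sum.cong) auto
qed

lemma F'_entries:
  assumes "f \<in> F'" shows "f $ 1 = 0" "f $ 2 = 0" "f $ 3 = 0"
proof -
  have "j1 *v f = 0" "j2 *v f = 0"
    using assms quaternion_triple.mem[OF quaternion_triple_o3] by (auto simp: F'_def)
  then show "f $ 1 = 0" "f $ 2 = 0" "f $ 3 = 0"
    by (simp_all add: vec_eq_iff forall_4 matrix_vector_mult_def sum_4 mscale_nth skew_nth)
qed

lemma pr_F'_axis:
  assumes "f \<in> F'" "f \<noteq> 0"
  shows "pr_F' f (axis j 1) = (if j = 4 then 1 / f $ 4 else 0)"
proof -
  have "f $ 4 \<noteq> 0" using assms F'_entries[OF assms(1)] by (simp add: vec_eq_iff forall_4)
  then show ?thesis
    unfolding pr_F'_def F''_def by (intro the_equality) (auto simp: axis_def field_simps)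
qed

lemma rational_C_coeff: "rational_fun3 (C_coeff i \<delta>)"
proof -
  let ?\<sigma> = "if i = 1 then 1 else - 1 :: complex"
  let ?P = "\<lambda>l n. ?\<sigma> * (((l :: complex^2) $ i + n + \<delta> / 2) * (l $ i + (- 1) * n + \<delta> / 2))"
  let ?Q = "\<lambda>l n. 2 * ((l :: complex^2) $ 1 * l $ 1 + (- 1) * (l $ 2 * l $ 2)) + 0 * (n :: complex)"
  have "polynomial_fun3 ?P" "polynomial_fun3 ?Q" by (intro polynomial_fun3.intros)+
  moreover have "?Q (axis 1 1) 0 \<noteq> 0" by (simp add: axis_def)
  moreover have "C_coeff i \<delta> l n = ?P l n / ?Q l n" for l n
    by (simp add: C_coeff_def power2_eq_square)
  ultimately show ?thesis unfolding rational_fun3_def by blast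
qed

text \<open>\<open>\<alpha>\<close> and \<open>\<beta>\<close> are \<open>\<lambda>\<^sub>1 + \<lambda>\<^sub>2\<close> and \<open>\<lambda>\<^sub>1 - \<lambda>\<^sub>2\<close>, which are shifted by \<open>e\<close> and \<open>e'\<close>.\<close>

lemma coefficient_identity:
  fixes \<alpha> \<beta> \<nu> e e' :: complex
  assumes "\<alpha> \<noteq> 0" "\<beta> \<noteq> 0" "e * e = 1" "e' * e' = 1"
  shows "(1/2 + e / (2 * \<alpha>)) * (1/2 + e' / (2 * \<beta>))
      + e / (2 * \<alpha>) * (e' / (2 * \<beta>)) * (((\<alpha>\<^sup>2 - 1) + (\<beta>\<^sup>2 - 1) - (4 * \<nu>\<^sup>2 - 1)) / 2)
    = e * e' * ((e * \<alpha> + e' * \<beta> + 1)\<^sup>2 / 4 - \<nu>\<^sup>2) / (2 * (\<alpha> * \<beta>))" (is "?L = ?R")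
proof -
  have e2: "e\<^sup>2 = 1" "e'\<^sup>2 = 1" using assms by (simp_all add: power2_eq_square)
  have "8 * (\<alpha> * \<beta>) * ?L = 2 * (\<alpha> + e) * (\<beta> + e') + e * e' * (\<alpha>\<^sup>2 + \<beta>\<^sup>2 - 4 * \<nu>\<^sup>2 - 1)"
    using assms(1,2) by (simp add: field_simps)
  \<comment> \<open>The two polynomials differ by multiples of e^2 - 1 and e'^2 - 1.\<close>
  also have "\<dots> = e * e' * ((e * \<alpha> + e' * \<beta> + 1)\<^sup>2 - 4 * \<nu>\<^sup>2)"
    using e2 by algebra
  also have "\<dots> = 8 * (\<alpha> * \<beta>) * ?R"
    using assms(1,2) by (simp add: field_simps)
  finally have "8 * (\<alpha> * \<beta>) * ?L = 8 * (\<alpha> * \<beta>) * ?R" .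
  moreover have "8 * (\<alpha> * \<beta>) \<noteq> 0" using assms(1,2) by simp
  ultimately show ?thesis using mult_left_cancel by blast
qed

theorem theorem4p1:
  fixes G :: "('g, 'z) monoid_scheme" and \<T> :: "'g topology" and H :: "'g set"
    and p :: "'g \<Rightarrow> real^'n^'n" and p' :: "'g \<Rightarrow> real^'m^'m"
    and \<psi> :: "complex^4^4 \<Rightarrow> complex^'n^'n"
    and sV :: "complex \<Rightarrow> 'v \<Rightarrow> 'v::{topological_ab_group_add, t2_space}"
    and sW :: "complex \<Rightarrow> 'w \<Rightarrow> 'w::{topological_ab_group_add, t2_space}"
    and \<Phi> :: "'g \<Rightarrow> 'v \<Rightarrow> 'v" and \<pi> :: "'g \<Rightarrow> 'w \<Rightarrow> 'w" and T :: "'v \<Rightarrow> 'w"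
    and lam :: "complex^2" and \<nu> :: complex
    and i :: 2 and \<delta> :: complex and f0 :: "complex^4"
  defines "G' \<equiv> G\<lparr>carrier := H\<rparr>" and "\<T>' \<equiv> subtopology \<T> H"
  defines "d\<Phi> \<equiv> \<lambda>X. cderiv_rep G \<T> p sV \<Phi> (\<psi> X)"
    and "d\<pi> \<equiv> \<lambda>X. cderiv_rep G' \<T>' p sW \<pi> (\<psi> X)"
  assumes "real_reductive_group G \<T> p"
    and "subgroup H G" and "real_reductive_group G' \<T>' p'"
    and "pair_iso \<psi> (complexified (lie_alg G \<T> p)) (complexified (lie_alg G' \<T>' p))"
    and "in_cat_M G \<T> p sV \<Phi>" and "inf_char4 sV d\<Phi> lam"
    and "in_cat_M G' \<T>' p' sW \<pi>" and "inf_char3 sW d\<pi> \<nu>"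
    and "lam $ 1 \<noteq> lam $ 2" and "lam $ 1 \<noteq> - (lam $ 2)"
    and "primary_genuine (Z_group G p \<psi>) (tensor_scale sV) (tensor_act sV d\<Phi>)"
    and "symmetry_breaking H sV sW \<Phi> \<pi> T"
    and "f0 \<in> F'" and "f0 \<noteq> 0" and "\<delta> \<in> {1, - 1}"
  shows "rational_fun3 (C_coeff i \<delta>) \<and>
    (\<forall>u. tensor_pr sW T f0
            (primary_proj (tensor_scale sV) (tensor_act sV d\<Phi>) (lam + axis i \<delta>) (tensor sV u f0))
         = sW (C_coeff i \<delta> lam \<nu>) (T u))"
proof (intro conjI allI rational_C_coeff)
  fix u
  have \<Phi>: "smooth_frechet_rep G \<T> p sV \<Phi>" using assms by (simp add: in_cat_M_def)
  have lin: "Vector_Spaces.linear sV sW T" using assms by (simp add: symmetry_breaking_def)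
  interpret T: Vector_Spaces.linear sV sW T by (rule lin)
  interpret V: regular_o4_rep sV d\<Phi> lam
  proof (intro regular_o4_rep.intro regular_o4_rep_axioms.intro)
    show "o4_rep sV d\<Phi>"
      unfolding d\<Phi>_def by (rule cderiv_o4_rep) (fact assms \<Phi>)+
  qed (fact assms)+
  \<comment> \<open>Adding \<delta> to the i-th coordinate changes \<lambda>_1 + \<lambda>_2 by
    \<delta> and \<lambda>_1 - \<lambda>_2 by \<open>e'\<close>; the product of both is the sign in
    \<open>C_coeff\<close>.\<close>
  define e' where "e' = (if i = 1 then \<delta> else - \<delta>)"
  have i: "i = 1 \<or> i = 2" by (rule exhaust_2)
  have e': "e' \<in> {1, - 1}" "e' * e' = 1" "\<delta> * \<delta> = 1" "\<delta> * e' = (if i = 1 then 1 else - 1)"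
    using assms(19) by (auto simp: e'_def)
  have proj: "primary_proj V.ts V.tact (lam + axis i \<delta>) v = V.T.joint \<delta> e' v" for v
    using i by (intro V.T.primary_proj_joint assms(19) e') (auto simp: V.T.a_def e'_def axis_def)
  let ?a = "V.\<alpha> 1" and ?b = "V.\<alpha> (- 1)"
  have a: "?a \<noteq> 0" "?b \<noteq> 0" using V.T.a_nonzero[of 1] V.T.a_nonzero[of "- 1"] by (auto simp: V.T.a_def)
  \<comment> \<open>The value of 2 \<open>mixed\<close> from \<open>mixed_casimir\<close>, halved;
    the Casimir element of o(3,C) becomes 4 \<nu>^2 - 1 only after \<open>T\<close> is
    applied.\<close>
  let ?\<kappa> = "((?a\<^sup>2 - 1) + (?b\<^sup>2 - 1) - (4 * \<nu>\<^sup>2 - 1)) / 2"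
  have mixed: "T (V.mixed z) = sW ?\<kappa> (T z)" for z
  proof -
    have "T (free_act sV d\<Phi> (casimir j1 j2 j3) z) = free_act sW d\<pi> (casimir j1 j2 j3) (T z)"
    proof (rule free_act_intertwine[OF lin quaternion_triple.casimir_free_over[OF quaternion_triple_o3]])
      show "T (d\<Phi> X u) = d\<pi> X (T u)" if "X \<in> o3" for X u
        unfolding d\<Phi>_def d\<pi>_def G'_def \<T>'_def
        by (rule symmetry_breaking_cderiv[OF _ \<Phi> _ _ that]) (fact assms[unfolded G'_def \<T>'_def])+
    qed
    also have "\<dots> = sW (4 * \<nu>\<^sup>2 - 1) (T z)"
      using assms(12) HC3_casimir[of \<nu>] unfolding inf_char3_def by blast
    finally have cas: "T (free_act sV d\<Phi> (casimir j1 j2 j3) z) = sW (4 * \<nu>\<^sup>2 - 1) (T z)" .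
    have "T (V.mixed z) + T (V.mixed z) = sW (2 * ?\<kappa>) (T z)"
    proof -
      have k: "2 * ?\<kappa> = (?a\<^sup>2 - 1) + (?b\<^sup>2 - 1) - (4 * \<nu>\<^sup>2 - 1)" by simp
      have "T (V.mixed z + V.mixed z) = sW (2 * ?\<kappa>) (T z)"
        unfolding V.mixed_casimir k T.diff T.add T.scale cas
        by (simp only: T.vs2.scale_left_diff_distrib T.vs2.scale_left_distrib)
      then show ?thesis by (simp only: T.add)
    qed
    then have "sW (1/2) (T (V.mixed z) + T (V.mixed z)) = sW (1/2) (sW (2 * ?\<kappa>) (T z))" by simp
    then show ?thesis
      by (simp add: T.vs2.scale_right_distrib flip: T.vs2.scale_left_distrib)
  qed
  let ?f = "f0 $ 4"
  have f: "?f \<noteq> 0" using assms(17,18) F'_entries[of f0] by (simp add: vec_eq_iff forall_4)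
  \<comment> \<open>The factor \<open>1 / ?f\<close> will cancel the coordinate of \<open>f0\<close>
    in the tensor, so the choice of generator does not matter.\<close>
  have pr: "tensor_pr sW T f0 x = sW (1 / ?f) (T (x $ 4))" for x
    unfolding tensor_pr_def by (simp add: sum_4 pr_F'_axis[OF assms(17,18)])
  have C: "C_coeff i \<delta> lam \<nu> = (1/2 + \<delta> / (2 * ?a)) * (1/2 + e' / (2 * ?b)) + \<delta> / (2 * ?a) * (e' / (2 * ?b)) * ?\<kappa>"
  proof -
    have ab: "?a * ?b = (lam $ 1)\<^sup>2 - (lam $ 2)\<^sup>2" by (simp add: power2_eq_square algebra_simps)
    \<comment> \<open>Thus the square in \<open>coefficient_identity\<close> involves \<lambda>_i
      alone, and subtracting \<nu>^2 makes it a difference of squares, the numerator of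
      \<open>C_coeff\<close>.\<close>
    have "\<delta> * ?a + e' * ?b = 2 * \<delta> * lam $ i" using i by (auto simp: e'_def algebra_simps)
    then have "(\<delta> * ?a + e' * ?b + 1)\<^sup>2 / 4 = (lam $ i + \<delta> / 2)\<^sup>2"
      using e'(3) by (simp add: power2_eq_square field_simps)
    then show ?thesis
      unfolding coefficient_identity[OF a e'(3,2)] ab e'(4) C_coeff_def
      by (simp add: power2_eq_square algebra_simps)
  qed
  have "tensor_pr sW T f0 (V.T.joint \<delta> e' (tensor sV u f0)) = sW (C_coeff i \<delta> lam \<nu>) (T u)"
  proof -
    have z: "tensor sV u f0 $ 1 = 0" "tensor sV u f0 $ 2 = 0" "tensor sV u f0 $ 3 = 0" "tensor sV u f0 $ 4 = sV ?f u"
      by (simp_all add: tensor_def F'_entries[OF assms(17)])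
    have "T (V.T.joint \<delta> e' (tensor sV u f0) $ 4) = sW (C_coeff i \<delta> lam \<nu>) (sW ?f (T u))"
      unfolding V.joint_component[OF z(1,2,3)] z(4) T.add T.scale mixed C T.vs2.scale_left_distrib
      by simp
    then show ?thesis unfolding pr using f by (simp add: mult.commute)
  qed
  then show "tensor_pr sW T f0 (primary_proj V.ts V.tact (lam + axis i \<delta>) (tensor sV u f0)) = sW (C_coeff i \<delta> lam \<nu>) (T u)"
    unfolding proj .
qed

end
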